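(* Let $r\ge0$, $q=r+1$, $p\ge1$, $\rho_h>0$, $d_h\ge0$ ($1\le h\le r$), $\widehat a_*\in\mathbb R$, and let $\xi_1,\dots,\xi_p\in\mathbb R$ be pairwise distinct with $\xi_i+\rho_h>0$ for all $i,h$. Let $\boldsymbol\lambda=(n_1,\dots,n_r,\eta)\in\mathbb N_0^{r+1}$ be near the diagonal (entries pairwise differing by at most one; i.e. Laguerre admissible), $N=|\boldsymbol\lambda|\ge1$. If the rates $\{\rho_h:n_h>0\}$ are pairwise distinct, then the connection determinant $\Delta_{\mathrm H}=\det C$ (see context) is $$\Delta_{\mathrm H}=2^{-\binom\eta2}\prod_{h=1}^r\Bigl(\rho_h^{n_h}\prod_{k=0}^{n_h-1}(d_h+1)_k\Bigr)\prod_{1\le j<h\le r}(\rho_h-\rho_j)^{n_jn_h}.$$ In particular, $\Delta_{\mathrm H}\ne0$ for every such index under the stated hypotheses. Consequently, for every $\boldsymbol m\in\mathbb N_0^p$ with $|\boldsymbol\lambda|=|\boldsymbol m|+1$ and every $i_0\in\{1,\dots,p\}$, the adjacent moment matrix $\mathcal N_{i_0}$ is nonsingular. Thus the limiting Hermite $B$-problem is weakly normal, and the Rodrigues function $\mathcal B^{\mathrm H}_{\boldsymbol\lambda,\boldsymbol m}$ has a unique decomposition $\sum_{j=1}^qB_jU_j^{\mathrm H}$ with polynomials $B_j$ of the prescribed degrees $\deg B_j<\lambda_j$.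
   Context: $\phi_a(t)=\pi^{-1/2}\mathrm e^{-(t-a)^2}$; $(K_{\rho,d}f)(t)=\int_0^\infty\frac{\rho^d}{\Gamma(d)}u^{d-1}\mathrm e^{-\rho u}f(t+u)\,\mathrm du$ ($\rho,d>0$), $K_{\rho,0}=I$; $F=K_{\rho_1,d_1}\cdots K_{\rho_r,d_r}\phi_{\widehat a_*}$; rows $U_h^{\mathrm H}=K_{\rho_h,1}F$ ($1\le h\le r$), $U_q^{\mathrm H}=F$. $L_F(z)=\int_{\mathbb R}\mathrm e^{zt}F(t)\,\mathrm dt=\mathrm e^{\widehat a_*z+z^2/4}\prod_h(\rho_h/(\rho_h+z))^{d_h}$; $\Lambda_h(z)=\frac{\rho_h}{\rho_h+z}L_F(z)$ ($h\le r$), $\Lambda_q=L_F$ are the bilateral transforms of the rows. Put $\lambda_h=n_h$ ($h\le r$), $\lambda_q=\eta$, $\mathcal I_{\boldsymbol\lambda}=\{(j,k):1\le j\le q,\ 0\le k<\lambda_j\}$ ordered lexicographically, $D_{\boldsymbol n}(z)=\prod_h(\rho_h+z)^{n_h}$. Monic Hermite polynomials: $\mathrm e^{uz-z^2/4}=\sum_\ell H_\ell(u)z^\ell/\ell!$. Connection polynomials: $\Phi_{j,k}(z)=\frac{D_{\boldsymbol n}(z)}{L_F(z)}H_k(\partial_z)\Lambda_j(z)$, which are polynomials of degree $\le N-1$; $C$ is the $N\times N$ matrix $C_{\nu,(j,k)}=[z^\nu]\Phi_{j,k}$, $0\le\nu\le N-1$, $(j,k)\in\mathcal I_{\boldsymbol\lambda}$.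 Adjacent moment matrix: $\mathcal N_{i_0}=\bigl[\int_{\mathbb R}t^{k+\ell}\mathrm e^{\xi_it}U_j^{\mathrm H}(t)\,\mathrm dt\bigr]_{(i,\ell),(j,k)}$ with $(j,k)\in\mathcal I_{\boldsymbol\lambda}$ and $1\le i\le p$, $0\le\ell<m_i+\delta_{i,i_0}$, lexicographic orders. $B$-problem: polynomial vectors $(B_1,\dots,B_q)$, $\deg B_j\le\lambda_j-1$ ($B_j=0$ if $\lambda_j=0$), with $\int_{\mathbb R}t^k\mathrm e^{\xi_it}\sum_jB_jU_j^{\mathrm H}\,\mathrm dt=0$, $0\le k<m_i$, $1\le i\le p$; weakly normal means the solution space is one-dimensional. Rodrigues function: $\mathcal B^{\mathrm H}_{\boldsymbol\lambda,\boldsymbol m}=\prod_i(\xi_i+\partial_t)^{m_i}\prod_h\rho_h^{-n_h}K_{\rho_h,n_h}F$. $(a)_k=a(a+1)\cdots(a+k-1)$; factors with exponent zero equal one. *)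

theory Defs
  imports
    "HOL-Analysis.Analysis"
    "HOL-Library.Function_Algebras"
    "HOL-Computational_Algebra.Polynomial"
    "Jordan_Normal_Form.Determinant"
begin

(* Families indexed by 1..r, 1..q or 1..p are functions on nat that are only read on the
   relevant range.  A multi-index lambda = (n_1, ..., n_r, eta) is one function
   lam :: nat => nat with lam h = n_h for 1 <= h <= r and lam (r + 1) = eta. *)

definition gauss :: "real \<Rightarrow> real \<Rightarrow> real" where
  "gauss a t = exp (- ((t - a)\<^sup>2)) / sqrt pi"

definition gamma_op :: "real \<Rightarrow> real \<Rightarrow> (real \<Rightarrow> real) \<Rightarrow> real \<Rightarrow> real" where
  "gamma_op \<rho> d f t =
     (if d = 0 then f t
      else LINT u:{0<..}|lborel.
             \<rho> powr d / Gamma d * u powr (d - 1) * exp (- \<rho> * u) * f (t + u))"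

definition hermite_F ::
    "nat \<Rightarrow> (nat \<Rightarrow> real) \<Rightarrow> (nat \<Rightarrow> real) \<Rightarrow> real \<Rightarrow> real \<Rightarrow> real" where
  "hermite_F r \<rho> d a = foldr (\<lambda>h. gamma_op (\<rho> h) (d h)) [1..<r + 1] (gauss a)"

definition hermite_U ::
    "nat \<Rightarrow> (nat \<Rightarrow> real) \<Rightarrow> (nat \<Rightarrow> real) \<Rightarrow> real \<Rightarrow> nat \<Rightarrow> real \<Rightarrow> real" where
  "hermite_U r \<rho> d a j =
     (if j \<le> r then gamma_op (\<rho> j) 1 (hermite_F r \<rho> d a) else hermite_F r \<rho> d a)"

(* All transforms are used at real z with rho_h + z > 0 for every h, where the integrals
   converge; the values at other z are irrelevant. *)
definition bilateral :: "(real \<Rightarrow> real) \<Rightarrow> real \<Rightarrow> real" where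
  "bilateral f z = (LINT t|lborel. exp (z * t) * f t)"

definition hermite_L ::
    "nat \<Rightarrow> (nat \<Rightarrow> real) \<Rightarrow> (nat \<Rightarrow> real) \<Rightarrow> real \<Rightarrow> real \<Rightarrow> real" where
  "hermite_L r \<rho> d a = bilateral (hermite_F r \<rho> d a)"

definition row_transform ::
    "nat \<Rightarrow> (nat \<Rightarrow> real) \<Rightarrow> (nat \<Rightarrow> real) \<Rightarrow> real \<Rightarrow> nat \<Rightarrow> real \<Rightarrow> real" where
  "row_transform r \<rho> d a j z =
     (if j \<le> r then \<rho> j / (\<rho> j + z) * hermite_L r \<rho> d a z else hermite_L r \<rho> d a z)"

definition index_weight :: "nat \<Rightarrow> (nat \<Rightarrow> nat) \<Rightarrow> nat" where
  "index_weight k v = (\<Sum>i\<in>{1..k}. v i)"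

(* The pairs (i, l) with 1 <= i <= k and 0 <= l < v i, in lexicographic order. *)
definition lex_index :: "nat \<Rightarrow> (nat \<Rightarrow> nat) \<Rightarrow> (nat \<times> nat) list" where
  "lex_index k v = concat (map (\<lambda>i. map (Pair i) [0..<v i]) [1..<k + 1])"

definition rate_poly :: "nat \<Rightarrow> (nat \<Rightarrow> real) \<Rightarrow> (nat \<Rightarrow> nat) \<Rightarrow> real \<Rightarrow> real" where
  "rate_poly r \<rho> lam z = (\<Prod>h\<in>{1..r}. (\<rho> h + z) ^ lam h)"

(* Determined by the generating function exp (u z - z^2 / 4). *)
definition monic_hermite :: "nat \<Rightarrow> real poly" where
  "monic_hermite =
     (THE H. \<forall>u z. (\<lambda>l. poly (H l) u * z ^ l / fact l) sums exp (u * z - z\<^sup>2 / 4))"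

(* P(d/dz) applied to f *)
definition poly_deriv_op :: "real poly \<Rightarrow> (real \<Rightarrow> real) \<Rightarrow> real \<Rightarrow> real" where
  "poly_deriv_op P f z = (\<Sum>l\<le>Polynomial.degree P. Polynomial.coeff P l * (deriv ^^ l) f z)"

(* Specified by its values on the half-line of convergence, which is infinite, so that
   at most one polynomial qualifies. *)
definition connection_poly ::
    "nat \<Rightarrow> (nat \<Rightarrow> real) \<Rightarrow> (nat \<Rightarrow> real) \<Rightarrow> real \<Rightarrow> (nat \<Rightarrow> nat) \<Rightarrow> nat \<Rightarrow> nat \<Rightarrow> real poly" where
  "connection_poly r \<rho> d a lam j k =
     (THE P. Polynomial.degree P \<le> index_weight (r + 1) lam - 1 \<and>
        (\<forall>z. (\<forall>h\<in>{1..r}. 0 < \<rho> h + z) \<longrightarrow>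
           poly P z = rate_poly r \<rho> lam z / hermite_L r \<rho> d a z
             * poly_deriv_op (monic_hermite k) (row_transform r \<rho> d a j) z))"

definition connection_matrix ::
    "nat \<Rightarrow> (nat \<Rightarrow> real) \<Rightarrow> (nat \<Rightarrow> real) \<Rightarrow> real \<Rightarrow> (nat \<Rightarrow> nat) \<Rightarrow> real mat" where
  "connection_matrix r \<rho> d a lam =
     Matrix.mat (index_weight (r + 1) lam) (index_weight (r + 1) lam)
       (\<lambda>(\<nu>, c). case lex_index (r + 1) lam ! c of
          (j, k) \<Rightarrow> Polynomial.coeff (connection_poly r \<rho> d a lam j k) \<nu>)"

definition connection_det ::
    "nat \<Rightarrow> (nat \<Rightarrow> real) \<Rightarrow> (nat \<Rightarrow> real) \<Rightarrow> real \<Rightarrow> (nat \<Rightarrow> nat) \<Rightarrow> real" where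
  "connection_det r \<rho> d a lam = Determinant.det (connection_matrix r \<rho> d a lam)"

definition adjacent_moment_matrix ::
    "nat \<Rightarrow> (nat \<Rightarrow> real) \<Rightarrow> (nat \<Rightarrow> real) \<Rightarrow> real \<Rightarrow> (nat \<Rightarrow> nat)
      \<Rightarrow> nat \<Rightarrow> (nat \<Rightarrow> real) \<Rightarrow> (nat \<Rightarrow> nat) \<Rightarrow> nat \<Rightarrow> real mat" where
  "adjacent_moment_matrix r \<rho> d a lam p \<xi> m i0 =
     (let rows = lex_index p (\<lambda>i. m i + (if i = i0 then 1 else 0));
          cols = lex_index (r + 1) lam
      in Matrix.mat (length rows) (length cols)
           (\<lambda>(x, y). case rows ! x of (i, l) \<Rightarrow> case cols ! y of (j, k) \<Rightarrow>
              LINT t|lborel. t ^ (k + l) * exp (\<xi> i * t) * hermite_U r \<rho> d a j t))"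

(* Vectors (B_1, ..., B_q) with deg B_j < lam j, stored as families that vanish outside
   1..q; since degree 0 = 0, the zero polynomial is admitted separately. *)
definition admissible_vecs :: "nat \<Rightarrow> (nat \<Rightarrow> nat) \<Rightarrow> (nat \<Rightarrow> real poly) set" where
  "admissible_vecs q lam =
     {B. (\<forall>j\<in>{1..q}. B j = 0 \<or> Polynomial.degree (B j) < lam j) \<and> (\<forall>j. j \<notin> {1..q} \<longrightarrow> B j = 0)}"

definition linear_form ::
    "nat \<Rightarrow> (nat \<Rightarrow> real) \<Rightarrow> (nat \<Rightarrow> real) \<Rightarrow> real \<Rightarrow> (nat \<Rightarrow> real poly) \<Rightarrow> real \<Rightarrow> real" where
  "linear_form r \<rho> d a B t = (\<Sum>j\<in>{1..r + 1}. poly (B j) t * hermite_U r \<rho> d a j t)"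

definition B_solutions ::
    "nat \<Rightarrow> (nat \<Rightarrow> real) \<Rightarrow> (nat \<Rightarrow> real) \<Rightarrow> real \<Rightarrow> (nat \<Rightarrow> nat)
      \<Rightarrow> nat \<Rightarrow> (nat \<Rightarrow> real) \<Rightarrow> (nat \<Rightarrow> nat) \<Rightarrow> (nat \<Rightarrow> real poly) set" where
  "B_solutions r \<rho> d a lam p \<xi> m =
     {B \<in> admissible_vecs (r + 1) lam.
        \<forall>i\<in>{1..p}. \<forall>k<m i.
          (LINT t|lborel. t ^ k * exp (\<xi> i * t) * linear_form r \<rho> d a B t) = 0}"

definition poly_vec_scale :: "real \<Rightarrow> (nat \<Rightarrow> real poly) \<Rightarrow> nat \<Rightarrow> real poly" where
  "poly_vec_scale c B = (\<lambda>j. Polynomial.smult c (B j))"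

interpretation poly_vec: vector_space poly_vec_scale
  by unfold_locales
    (auto simp: poly_vec_scale_def fun_eq_iff smult_add_left smult_add_right)

definition weakly_normal ::
    "nat \<Rightarrow> (nat \<Rightarrow> real) \<Rightarrow> (nat \<Rightarrow> real) \<Rightarrow> real \<Rightarrow> (nat \<Rightarrow> nat)
      \<Rightarrow> nat \<Rightarrow> (nat \<Rightarrow> real) \<Rightarrow> (nat \<Rightarrow> nat) \<Rightarrow> bool" where
  "weakly_normal r \<rho> d a lam p \<xi> m \<longleftrightarrow>
     poly_vec.subspace (B_solutions r \<rho> d a lam p \<xi> m) \<and>
     poly_vec.dim (B_solutions r \<rho> d a lam p \<xi> m) = 1"

definition rodrigues ::
    "nat \<Rightarrow> (nat \<Rightarrow> real) \<Rightarrow> (nat \<Rightarrow> real) \<Rightarrow> real \<Rightarrow> (nat \<Rightarrow> nat)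
      \<Rightarrow> nat \<Rightarrow> (nat \<Rightarrow> real) \<Rightarrow> (nat \<Rightarrow> nat) \<Rightarrow> real \<Rightarrow> real" where
  "rodrigues r \<rho> d a lam p \<xi> m =
     foldr (\<lambda>i. (\<lambda>f t. \<xi> i * f t + deriv f t) ^^ m i) [1..<p + 1]
       (foldr (\<lambda>h f t. gamma_op (\<rho> h) (real (lam h)) f t / \<rho> h ^ lam h) [1..<r + 1]
          (hermite_F r \<rho> d a))"

end

(* On the half-line where all rho_h + z are positive, L(z) is an explicit exponential times powers of
   rho_h + z, so H_k(d/dz) Lambda_j / L is a combination of partial fractions 1 / (rho_h + z)^(i+1)
   and monomials z^i.  By the three-term recursion of the H_k, the coefficient at level k is an
   explicit product at the index (j, k) itself and vanishes at every other index; all remaining terms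
   have level i < k, and these belong to the index set because lambda is near the diagonal.  Hence
   the connection matrix is a partial-fraction matrix times a matrix that is triangular with respect
   to the level.  The former is evaluated by removing one linear factor rho_h + z at a time.

   Nonsingularity identifies the linear forms sum_j B_j U_j with the polynomials A of degree < N,
   through the transform L A / D.  Moment conditions at xi_i of order m_i mean that (z - xi_i)^(m_i)
   divides A.  A polynomial of degree < N with N prescribed zeros (with multiplicity) vanishes, which gives the
   nonsingular moment matrices; with N - 1 prescribed zeros it is unique up to a factor.  The
   Rodrigues function has transform L / D times the product of the (xi_i - z)^(m_i), and the
   transform is injective. *)
theory Submission
  imports Defs
    "HOL-Probability.Probability"
    "HOL-Complex_Analysis.Complex_Analysis"
begin

text \<open>L contains the powers (rho_h + z)^(-d_h) with arbitrary real d_h >= 0, so the Lambda_j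
  and their derivatives are in general not rational; after division by L they are. Hence all
  computations use the quotients \<open>G j k\<close> as functions on the half-line
  \<open>S\<close>, and polynomials are recognised by their values there. Conjugating d/dz by L
  gives f' + (L'/L) f with L'/L = a + z/2 - sum_h d_h / (rho_h + z): its simple pole at -rho_h and
  its slope 1/2 at infinity are the sources of (d_h + 1)_k and of the power of 2 in the determinant.
  Splitting mixed poles requires distinct rates, whereas the hypothesis separates only the rates
  with n_h > 0. The two fit together: an index of level k >= 1 forces some entry of lambda to be at
  least 2, hence all n_h > 0; otherwise only level 0 occurs and no product of poles is formed. The
  factor L / D is positive and continuous on \<open>S\<close> but in general not a polynomial. Zeros
  of A are therefore compared with vanishing moments through bounds of order |z - x|^m, which such a
  factor preserves.\<close>

section \<open>Determinants of polynomial bases\<close>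
text \<open>Coefficients of degree at least the length of the list are cut off, so the value
  describes a change of basis only under a degree bound on the members.\<close>

definition poly_list_det :: "real poly list \<Rightarrow> real" where
  "poly_list_det ps = Determinant.det
     (Matrix.mat (length ps) (length ps) (\<lambda>(\<nu>, c). Polynomial.coeff (ps ! c) \<nu>))"

text \<open>Laplace expansion along the last row, whose only nonzero entry is the corner entry
  1.\<close>

lemma poly_list_det_snoc_monic:
  assumes low: "\<And>q. q \<in> set ps \<Longrightarrow> Polynomial.coeff q (length ps) = 0"
    and "Polynomial.coeff p (length ps) = 1"
  shows "poly_list_det (ps @ [p]) = poly_list_det ps"
proof -
  define n where "n = length ps"
  define A where "A = Matrix.mat (Suc n) (Suc n) (\<lambda>(\<nu>, c). Polynomial.coeff ((ps @ [p]) ! c) \<nu>)"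
  have A: "A \<in> carrier_mat (Suc n) (Suc n)" by (simp add: A_def)
  have last: "A $$ (n, j) = (if j = n then 1 else 0)" if "j < Suc n" for j
    using that assms by (auto simp: A_def n_def nth_append)
  have "Determinant.det A = (\<Sum>j<Suc n. A $$ (n, j) * cofactor A n j)"
    by (rule laplace_expansion_row[OF A]) simp
  also have "\<dots> = cofactor A n n"
    using last[of n] by (simp add: last)
  also have "\<dots> = Determinant.det (mat_delete A n n)"
    by (simp add: cofactor_def)
  also have "mat_delete A n n = Matrix.mat n n (\<lambda>(\<nu>, c). Polynomial.coeff (ps ! c) \<nu>)"
    by (rule eq_matI) (auto simp: mat_delete_def A_def n_def nth_append)
  finally show ?thesis
    by (simp add: poly_list_det_def A_def n_def)
qed

text \<open>Evaluation at the root of the linear factor replaces row 0; it annihilates all columns but the last.\<close>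
lemma poly_list_det_mult_linear_snoc:
  assumes low: "\<And>q. q \<in> set ps \<Longrightarrow> Polynomial.degree q < length ps"
    and D: "Polynomial.degree D \<le> length ps"
  shows "poly_list_det (map ((*) [:c, 1:]) ps @ [D])
      = (- 1) ^ length ps * poly D (- c) * poly_list_det ps"
proof -
  define n where "n = length ps"
  define qs where "qs = map ((*) [:c, 1:]) ps @ [D]"
  define A where "A = Matrix.mat (Suc n) (Suc n) (\<lambda>(\<nu>, c). Polynomial.coeff (qs ! c) \<nu>)"
  \<comment> \<open>Unit upper triangular, so the determinant is unchanged; its row 0 of powers of
    \<open>- c\<close> turns coefficient columns into values at \<open>- c\<close>.\<close>
  define V where "V = Matrix.mat (Suc n) (Suc n)
     (\<lambda>(i, j). if i = 0 then (- c) ^ j else if i = j then 1 else 0)"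
  define P where "P = Matrix.mat n n (\<lambda>(\<nu>, c). Polynomial.coeff (ps ! c) \<nu>)"
  \<comment> \<open>Coefficient \<open>Suc i\<close> of (z + c) q is q_i + c q_(i+1). Deleting the
    row of values and the last column therefore leaves this unit bidiagonal matrix times
    \<open>P\<close>.\<close>
  define X where "X = Matrix.mat n n
     (\<lambda>(i, j). if i = j then 1 else if j = Suc i then c else 0)"
  have carr: "A \<in> carrier_mat (Suc n) (Suc n)" "V \<in> carrier_mat (Suc n) (Suc n)"
    "P \<in> carrier_mat n n" "X \<in> carrier_mat n n"
    by (simp_all add: A_def V_def P_def X_def)
  have deg: "Polynomial.degree (qs ! j) \<le> n" if "j < Suc n" for j
  proof (cases "j = n")
    case False
    then have "ps ! j \<in> set ps" "j < n" using that by (auto simp: n_def)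
    moreover have "Polynomial.degree ([:c, 1:] * ps ! j) \<le> 1 + Polynomial.degree (ps ! j)"
      by (rule order_trans[OF degree_mult_le]) simp
    ultimately show ?thesis
      using low[of "ps ! j"] by (simp add: qs_def nth_append n_def)
  qed (use D in \<open>simp add: qs_def nth_append n_def\<close>)
  have detV: "Determinant.det V = 1"
  proof -
    have "upper_triangular V" by (auto simp: V_def)
    then have "Determinant.det V = prod_list (diag_mat V)" by (rule det_upper_triangular) (rule carr)
    also have "diag_mat V = map (\<lambda>i. 1) [0..<Suc n]"
      by (auto simp: diag_mat_def V_def simp del: upt_Suc intro!: map_cong)
    finally show ?thesis by (simp add: map_replicate_const prod_list_replicate del: upt_Suc)
  qed
  have detX: "Determinant.det X = 1"
  proof -
    have "upper_triangular X" by (auto simp: X_def)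
    then have "Determinant.det X = prod_list (diag_mat X)" by (rule det_upper_triangular) (rule carr)
    also have "diag_mat X = map (\<lambda>i. 1) [0..<n]"
      by (auto simp: diag_mat_def X_def intro!: map_cong)
    finally show ?thesis by (simp add: map_replicate_const prod_list_replicate)
  qed
  have VA: "V * A \<in> carrier_mat (Suc n) (Suc n)" using carr by simp
  have ev: "(\<Sum>\<nu><Suc n. (- c) ^ \<nu> * Polynomial.coeff (qs ! j) \<nu>) = poly (qs ! j) (- c)"
    if "j < Suc n" for j
  proof -
    have "poly (qs ! j) (- c) = (\<Sum>\<nu>\<le>n. Polynomial.coeff (qs ! j) \<nu> * (- c) ^ \<nu>)"
      unfolding poly_altdef using deg[OF that]
      by (intro sum.mono_neutral_left) (auto simp: coeff_eq_0)
    then show ?thesis by (simp add: lessThan_Suc_atMost mult.commute)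
  qed
  have row0: "(V * A) $$ (0, j) = (if j = n then poly D (- c) else 0)" if "j < Suc n" for j
  proof -
    have "(V * A) $$ (0, j) = (\<Sum>\<nu><Suc n. (- c) ^ \<nu> * Polynomial.coeff (qs ! j) \<nu>)"
      using that by (simp add: V_def A_def scalar_prod_def lessThan_atLeast0 del: sum.op_ivl_Suc)
    then show ?thesis using ev[OF that] that by (auto simp: qs_def n_def nth_append)
  qed
  have rows: "(V * A) $$ (Suc i, j) = A $$ (Suc i, j)" if "i < n" "j < Suc n" for i j
  proof -
    have "(V * A) $$ (Suc i, j) = (\<Sum>\<nu>\<in>{0..<Suc n}. (if Suc i = \<nu> then 1 else 0) * A $$ (\<nu>, j))"
      using that by (simp add: V_def A_def scalar_prod_def del: sum.op_ivl_Suc)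
    also have "\<dots> = (\<Sum>\<nu>\<in>{0..<Suc n}. if Suc i = \<nu> then A $$ (\<nu>, j) else 0)"
      by (intro sum.cong) auto
    finally show ?thesis using that by (simp del: sum.op_ivl_Suc)
  qed
  have "Determinant.det A = Determinant.det (V * A)"
    using det_mult[OF carr(2,1)] detV by simp
  also have "\<dots> = (\<Sum>j<Suc n. (V * A) $$ (0, j) * cofactor (V * A) 0 j)"
    by (rule laplace_expansion_row[OF VA]) simp
  also have "\<dots> = (\<Sum>j<Suc n. if j = n then poly D (- c) * cofactor (V * A) 0 n else 0)"
    by (rule sum.cong) (auto simp: row0)
  also have "\<dots> = poly D (- c) * cofactor (V * A) 0 n"
    by simp
  also have "cofactor (V * A) 0 n = (- 1) ^ n * Determinant.det (mat_delete (V * A) 0 n)"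
    by (simp add: cofactor_def)
  also have "mat_delete (V * A) 0 n = X * P"
  proof (rule eq_matI)
    fix i j assume "i < dim_row (X * P)" "j < dim_col (X * P)"
    then have ij: "i < n" "j < n" by (simp_all add: X_def P_def)
    \<comment> \<open>In the last row \<open>X\<close> has no entry \<open>c\<close>; the term that
      would be lost is this coefficient, which the degree bound makes zero.\<close>
    have hi: "Polynomial.coeff (ps ! j) n = 0"
      using low[of "ps ! j"] ij by (simp add: n_def coeff_eq_0)
    have "mat_delete (V * A) 0 n $$ (i, j) = Polynomial.coeff ([:c, 1:] * ps ! j) (Suc i)"
      using ij carr rows[of i j] by (simp add: mat_delete_def V_def A_def qs_def n_def nth_append)
    also have "\<dots> = Polynomial.coeff (ps ! j) i + c * Polynomial.coeff (ps ! j) (Suc i)"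
      by simp
    also have "\<dots> = (\<Sum>\<nu>\<in>{0..<n}. (if \<nu> = i then Polynomial.coeff (ps ! j) i else 0)
         + (if \<nu> = Suc i then c * Polynomial.coeff (ps ! j) (Suc i) else 0))"
    proof -
      have "Suc i < n \<or> Suc i = n" using ij by auto
      then show ?thesis using ij hi by (auto simp: sum.distrib)
    qed
    also have "\<dots> = (\<Sum>\<nu>\<in>{0..<n}. X $$ (i, \<nu>) * P $$ (\<nu>, j))"
      using ij by (intro sum.cong) (auto simp: X_def P_def)
    also have "\<dots> = (X * P) $$ (i, j)"
      using ij by (simp add: scalar_prod_def X_def P_def)
    finally show "mat_delete (V * A) 0 n $$ (i, j) = (X * P) $$ (i, j)" .
  qed (use carr in \<open>simp_all add: mat_delete_def V_def A_def X_def P_def\<close>)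
  also have "Determinant.det (X * P) = Determinant.det P"
    using det_mult[OF carr(4,3)] detX by simp
  finally show ?thesis
    by (simp add: poly_list_det_def A_def P_def qs_def n_def)
qed

text \<open>A nonzero term of the Leibniz formula forces the level to increase along the permutation
  wherever it moves an index; the total level being invariant, nothing moves.\<close>
lemma det_level_triangular:
  fixes T :: "'a :: comm_ring_1 mat" and lev :: "nat \<Rightarrow> nat"
  assumes T: "T \<in> carrier_mat n n"
    and tri: "\<And>i j. \<lbrakk>i < n; j < n; i \<noteq> j; \<not> lev i < lev j\<rbrakk> \<Longrightarrow> T $$ (i, j) = 0"
  shows "Determinant.det T = (\<Prod>i<n. T $$ (i, i))"
proof -
  have zero: "signof p * (\<Prod>i = 0..<n. T $$ (i, p i)) = 0"
    if p: "p permutes {0..<n}" and "p \<noteq> id" for p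
  proof (rule ccontr)
    assume "\<not> ?thesis"
    then have nz: "(\<Prod>i = 0..<n. T $$ (i, p i)) \<noteq> 0" by auto
    then have ne0: "T $$ (i, p i) \<noteq> 0" if "i < n" for i
      using that by (metis atLeastLessThan_iff finite_atLeastLessThan prod_zero zero_le)
    have lt: "lev i < lev (p i)" if "i < n" "p i \<noteq> i" for i
      using tri[of i "p i"] ne0[OF that(1)] that permutes_in_image[OF p, of i] by auto
    obtain i0 where i0: "p i0 \<noteq> i0" using \<open>p \<noteq> id\<close> by (metis eq_id_iff)
    then have "i0 < n" using p by (metis atLeastLessThan_iff permutes_not_in zero_le)
    have "(\<Sum>i\<in>{0..<n}. lev i) < (\<Sum>i\<in>{0..<n}. lev (p i))"
    proof (rule sum_strict_mono_ex1)
      show "\<forall>i\<in>{0..<n}. lev i \<le> lev (p i)"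
        using lt by (metis atLeastLessThan_iff less_imp_le order_refl)
      show "\<exists>i\<in>{0..<n}. lev i < lev (p i)"
        using lt[OF \<open>i0 < n\<close> i0] \<open>i0 < n\<close> by force
    qed simp
    also have "\<dots> = (\<Sum>i\<in>{0..<n}. lev i)"
      by (rule sum.permute[OF p, of lev, unfolded o_def, symmetric])
    finally show False by simp
  qed
  have "Determinant.det T = (\<Sum>p\<in>{p. p permutes {0..<n}}. signof p * (\<Prod>i = 0..<n. T $$ (i, p i)))"
    using det_def'[OF T] .
  also have "\<dots> = (\<Sum>p\<in>{id}. signof p * (\<Prod>i = 0..<n. T $$ (i, p i)))"
    by (rule sum.mono_neutral_right) (use zero in \<open>auto simp: finite_permutations permutes_id\<close>)
  finally show ?thesis by (simp add: lessThan_atLeast0)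
qed

section \<open>The partial-fraction basis and its determinant\<close>

definition linear_factor :: "(nat \<Rightarrow> real) \<Rightarrow> nat \<Rightarrow> real poly" where
  "linear_factor \<rho> h = [:\<rho> h, 1:]"

definition rate_product :: "nat \<Rightarrow> (nat \<Rightarrow> real) \<Rightarrow> (nat \<Rightarrow> nat) \<Rightarrow> real poly" where
  "rate_product r \<rho> lam = (\<Prod>h\<in>{1..r}. linear_factor \<rho> h ^ lam h)"

text \<open>The numerators, over the common denominator \<open>rate_product\<close>, of the partial fractions
  \<open>1 / (\<rho>\<^sub>j + z)\<^sup>k\<^sup>+\<^sup>1\<close> for \<open>j \<le> r\<close> and of the monomials \<open>z\<^sup>k\<close> for \<open>j = r + 1\<close>.\<close>
definition pf_basis :: "nat \<Rightarrow> (nat \<Rightarrow> real) \<Rightarrow> (nat \<Rightarrow> nat) \<Rightarrow> nat \<times> nat \<Rightarrow> real poly" where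
  "pf_basis r \<rho> lam = (\<lambda>(j, k). if j \<le> r
     then (\<Prod>h\<in>{1..r} - {j}. linear_factor \<rho> h ^ lam h) * linear_factor \<rho> j ^ (lam j - Suc k)
     else Polynomial.monom 1 k * rate_product r \<rho> lam)"

lemma degree_linear_factor_power: "Polynomial.degree (linear_factor \<rho> h ^ n) = n"
  by (subst degree_power_eq) (simp_all add: linear_factor_def)

lemma linear_factor_neq_0 [simp]: "linear_factor \<rho> h \<noteq> 0"
  by (simp add: linear_factor_def)

lemma degree_prod_linear_factor:
  assumes "finite H"
  shows "Polynomial.degree (\<Prod>h\<in>H. linear_factor \<rho> h ^ lam h) = (\<Sum>h\<in>H. lam h)"
  by (subst degree_prod_sum_eq) (simp_all add: degree_linear_factor_power)

lemma lead_coeff_linear_factor_power: "lead_coeff (linear_factor \<rho> h ^ n) = 1"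
  by (simp add: lead_coeff_power linear_factor_def)

lemma degree_rate_product: "Polynomial.degree (rate_product r \<rho> lam) = index_weight r lam"
  by (simp add: rate_product_def index_weight_def degree_prod_linear_factor)

lemma lead_coeff_rate_product: "lead_coeff (rate_product r \<rho> lam) = 1"
  by (simp add: rate_product_def lead_coeff_prod lead_coeff_linear_factor_power)

lemma rate_product_neq_0 [simp]: "rate_product r \<rho> lam \<noteq> 0"
  by (simp add: rate_product_def)

lemma poly_rate_product: "poly (rate_product r \<rho> lam) z = rate_poly r \<rho> lam z"
  by (simp add: rate_product_def rate_poly_def poly_prod linear_factor_def add.commute)

lemma lex_index_0 [simp]: "lex_index 0 v = []"
  by (simp add: lex_index_def)

lemma lex_index_Suc: "lex_index (Suc k) v = lex_index k v @ map (Pair (Suc k)) [0..<v (Suc k)]"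
  by (simp add: lex_index_def)

lemma length_lex_index: "length (lex_index k v) = index_weight k v"
  by (induction k) (simp_all add: lex_index_Suc index_weight_def)

lemma set_lex_index: "set (lex_index k v) = {(i, l). 1 \<le> i \<and> i \<le> k \<and> l < v i}"
  by (induction k) (auto simp: lex_index_Suc le_Suc_eq)

lemma distinct_lex_index: "distinct (lex_index k v)"
  by (induction k) (auto simp: lex_index_Suc distinct_map inj_on_def set_lex_index)

lemma degree_pf_basis_pole:
  assumes "1 \<le> j" "j \<le> r" "k < lam j"
  shows "Polynomial.degree (pf_basis r \<rho> lam (j, k)) < index_weight r lam"
proof -
  have "Polynomial.degree (pf_basis r \<rho> lam (j, k))
      \<le> (\<Sum>h\<in>{1..r} - {j}. lam h) + (lam j - Suc k)"
    using assms degree_mult_le[of "\<Prod>h\<in>{1..r} - {j}. linear_factor \<rho> h ^ lam h"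
        "linear_factor \<rho> j ^ (lam j - Suc k)"]
    by (simp add: pf_basis_def degree_prod_linear_factor degree_linear_factor_power)
  also have "\<dots> < (\<Sum>h\<in>{1..r} - {j}. lam h) + lam j" using assms by simp
  also have "\<dots> = index_weight r lam"
    unfolding index_weight_def using assms by (subst sum.remove[of _ j]) auto
  finally show ?thesis .
qed

lemma rate_product_remove:
  assumes "1 \<le> j" "j \<le> r"
  shows "rate_product r \<rho> lam
    = linear_factor \<rho> j ^ lam j * (\<Prod>h\<in>{1..r} - {j}. linear_factor \<rho> h ^ lam h)"
  unfolding rate_product_def using assms by (subst prod.remove[of _ j]) auto

lemma index_weight_Suc: "index_weight (Suc k) v = index_weight k v + v (Suc k)"
  by (simp add: index_weight_def)

lemma choose_Suc_2: "Suc n choose 2 = (n choose 2) + n"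
  by (simp add: numeral_2_eq_2)

lemma minus_one_power_mult_power_diff:
  "(- 1) ^ n * (x - y) ^ n = (y - (x::real)) ^ n"
  by (simp flip: power_mult_distrib)

text \<open>Outer induction on the number of rates, inner induction on the multiplicity
  \<open>n\<close> of the last one. Passing from \<open>n\<close> to \<open>Suc n\<close> multiplies
  every earlier numerator by the last linear factor and appends the product of the other factors, so
  \<open>poly_list_det_mult_linear_snoc\<close> applies; the value of that product at
  \<open>- \<rho> (Suc r)\<close> supplies the confluent Vandermonde factor.\<close>

lemma poly_list_det_poles:
  "poly_list_det (map (pf_basis r \<rho> lam) (lex_index r lam))
    = (\<Prod>h\<in>{1..r}. (- 1) ^ (lam h choose 2)) * (\<Prod>h\<in>{1..r}. \<Prod>j\<in>{1..<h}. (\<rho> h - \<rho> j) ^ (lam j * lam h))"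
proof (induction r arbitrary: lam)
  case 0
  show ?case by (simp add: poly_list_det_def)
next
  case (Suc r)
  have "poly_list_det (map (pf_basis (Suc r) \<rho> (lam(Suc r := n))) (lex_index (Suc r) (lam(Suc r := n))))
      = (- 1) ^ (n choose 2) * (\<Prod>j\<in>{1..r}. (\<rho> (Suc r) - \<rho> j) ^ (lam j * n))
        * poly_list_det (map (pf_basis r \<rho> lam) (lex_index r lam))" (is "?P n = ?R n") for n
  proof (induction n)
    case 0
    have lex: "lex_index (Suc r) (lam(Suc r := 0)) = lex_index r lam"
      by (auto simp: lex_index_Suc lex_index_def intro!: arg_cong[where f = concat])
    have "pf_basis (Suc r) \<rho> (lam(Suc r := 0)) b = pf_basis r \<rho> lam b" if "b \<in> set (lex_index r lam)" for b
    proof -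
      obtain j k where b: "b = (j, k)" "1 \<le> j" "j \<le> r" "k < lam j"
        using \<open>b \<in> _\<close> by (auto simp: set_lex_index)
      have "{1..Suc r} - {j} = insert (Suc r) ({1..r} - {j})" using b by auto
      moreover have "(\<Prod>h\<in>{1..r} - {j}. linear_factor \<rho> h ^ (lam(Suc r := 0)) h)
          = (\<Prod>h\<in>{1..r} - {j}. linear_factor \<rho> h ^ lam h)"
        by (intro prod.cong) auto
      ultimately show ?thesis using b by (simp add: pf_basis_def)
    qed
    then have "map (pf_basis (Suc r) \<rho> (lam(Suc r := 0))) (lex_index r lam)
        = map (pf_basis r \<rho> lam) (lex_index r lam)" by simp
    then show ?case by (simp only: lex) (simp add: numeral_2_eq_2)
  next
    case (Suc n)
    define l0 where "l0 = lam(Suc r := n)"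
    define l1 where "l1 = lam(Suc r := Suc n)"
    define ps where "ps = map (pf_basis (Suc r) \<rho> l0) (lex_index (Suc r) l0)"
    have len: "length ps = index_weight r lam + n"
      by (simp add: ps_def length_lex_index index_weight_Suc l0_def) (simp add: index_weight_def)
    have lex: "lex_index (Suc r) l1 = lex_index (Suc r) l0 @ [(Suc r, n)]"
      by (auto simp: lex_index_Suc l0_def l1_def lex_index_def intro!: arg_cong[where f = concat])
    have step: "pf_basis (Suc r) \<rho> l1 b = [:\<rho> (Suc r), 1:] * pf_basis (Suc r) \<rho> l0 b"
      if "b \<in> set (lex_index (Suc r) l0)" for b
    proof -
      obtain j k where b: "b = (j, k)" "1 \<le> j" "j \<le> Suc r" "k < l0 j"
        using \<open>b \<in> _\<close> by (auto simp: set_lex_index)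
      show ?thesis
      proof (cases "j = Suc r")
        case True
        then have "k < n" using b by (simp add: l0_def)
        then have "Suc n - Suc k = Suc (n - Suc k)" by simp
        moreover have "(\<Prod>h\<in>{1..Suc r} - {Suc r}. linear_factor \<rho> h ^ l1 h)
            = (\<Prod>h\<in>{1..Suc r} - {Suc r}. linear_factor \<rho> h ^ l0 h)"
          by (intro prod.cong) (auto simp: l0_def l1_def)
        ultimately show ?thesis using b True
          by (simp add: pf_basis_def l0_def l1_def flip: linear_factor_def)
      next
        case False
        then have S: "{1..Suc r} - {j} = insert (Suc r) ({1..r} - {j})" using b by auto
        have "(\<Prod>h\<in>{1..r} - {j}. linear_factor \<rho> h ^ l1 h)
            = (\<Prod>h\<in>{1..r} - {j}. linear_factor \<rho> h ^ l0 h)"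
          by (intro prod.cong) (auto simp: l0_def l1_def)
        with False b S show ?thesis
          by (simp add: pf_basis_def l0_def l1_def mult_ac flip: linear_factor_def)
      qed
    qed
    have last: "pf_basis (Suc r) \<rho> l1 (Suc r, n) = rate_product r \<rho> lam"
    proof -
      have "{1..Suc r} - {Suc r} = {1..r}" by auto
      then show ?thesis by (auto simp: pf_basis_def rate_product_def l1_def intro!: prod.cong)
    qed
    have "map (pf_basis (Suc r) \<rho> l1) (lex_index (Suc r) l1)
        = map ((*) [:\<rho> (Suc r), 1:]) ps @ [rate_product r \<rho> lam]"
      using step by (simp add: lex last ps_def)
    then have "?P (Suc n) = (- 1) ^ length ps * poly (rate_product r \<rho> lam) (- \<rho> (Suc r)) * poly_list_det ps"
    proof (simp only: flip: l1_def, intro poly_list_det_mult_linear_snoc)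
      show "Polynomial.degree q < length ps" if q: "q \<in> set ps" for q
      proof -
        obtain b where "q = pf_basis (Suc r) \<rho> l0 b" "b \<in> set (lex_index (Suc r) l0)"
          using q by (auto simp: ps_def)
        moreover obtain j k where "b = (j, k)" by (cases b)
        ultimately have "q = pf_basis (Suc r) \<rho> l0 (j, k)" "1 \<le> j" "j \<le> Suc r" "k < l0 j"
          by (simp_all add: set_lex_index)
        then have "Polynomial.degree q < index_weight (Suc r) l0"
          using degree_pf_basis_pole[of j "Suc r" k l0 \<rho>] by simp
        then show ?thesis by (simp add: ps_def length_lex_index)
      qed
    qed (simp add: degree_rate_product len)
    also have "poly (rate_product r \<rho> lam) (- \<rho> (Suc r)) = (\<Prod>j\<in>{1..r}. (\<rho> j - \<rho> (Suc r)) ^ lam j)"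
      by (simp add: poly_rate_product rate_poly_def)
    also have "\<dots> = (- 1) ^ index_weight r lam * (\<Prod>j\<in>{1..r}. (\<rho> (Suc r) - \<rho> j) ^ lam j)"
      by (simp add: index_weight_def power_sum minus_one_power_mult_power_diff flip: prod.distrib)
    also have "poly_list_det ps = ?R n"
      using Suc by (simp only: ps_def l0_def)
    also have "(- 1) ^ length ps * ((- 1) ^ index_weight r lam * (\<Prod>j = 1..r. (\<rho> (Suc r) - \<rho> j) ^ lam j)) *
       ((- 1) ^ (n choose 2) * (\<Prod>j = 1..r. (\<rho> (Suc r) - \<rho> j) ^ (lam j * n)) * poly_list_det (map (pf_basis r \<rho> lam) (lex_index r lam)))
       = ((- 1) ^ (length ps + index_weight r lam) * (- 1) ^ (n choose 2)) * (\<Prod>j = 1..r. (\<rho> (Suc r) - \<rho> j) ^ lam j * (\<rho> (Suc r) - \<rho> j) ^ (lam j * n))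
          * poly_list_det (map (pf_basis r \<rho> lam) (lex_index r lam))"
      by (simp add: power_add prod.distrib)
    \<comment> \<open>\<open>length ps\<close> is \<open>index_weight r lam + n\<close>, so only the
      parity of \<open>n\<close> remains, and (n choose 2) + n = (n + 1) choose 2.\<close>
    also have "(- 1) ^ (length ps + index_weight r lam) * (- 1) ^ (n choose 2) = ((- 1) ^ (Suc n choose 2) :: real)"
      by (simp add: len choose_Suc_2 power_add)
    also have "(\<Prod>j = 1..r. (\<rho> (Suc r) - \<rho> j) ^ lam j * (\<rho> (Suc r) - \<rho> j) ^ (lam j * n))
       = (\<Prod>j = 1..r. (\<rho> (Suc r) - \<rho> j) ^ (lam j * Suc n))"
      by (simp add: power_add)
    finally show ?case .
  qed
  from this[of "lam (Suc r)"] Suc.IH[of lam] show ?case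
    by (simp add: atLeastLessThanSuc_atLeastAtMost)
qed

text \<open>Each z^k D is monic of degree \<open>index_weight r lam + k\<close>, which equals the
  number of polynomials already listed, so appending these columns leaves the determinant of the
  poles unchanged.\<close>

lemma poly_list_det_pf_basis:
  "poly_list_det (map (pf_basis r \<rho> lam) (lex_index (r + 1) lam))
    = (\<Prod>h\<in>{1..r}. (- 1) ^ (lam h choose 2)) * (\<Prod>h\<in>{1..r}. \<Prod>j\<in>{1..<h}. (\<rho> h - \<rho> j) ^ (lam j * lam h))"
proof -
  have "poly_list_det (map (pf_basis r \<rho> lam) (lex_index r lam @ map (Pair (Suc r)) [0..<n]))
      = poly_list_det (map (pf_basis r \<rho> lam) (lex_index r lam))" for n
  proof (induction n)
    case (Suc n)
    define ps where "ps = map (pf_basis r \<rho> lam) (lex_index r lam @ map (Pair (Suc r)) [0..<n])"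
    have len: "length ps = index_weight r lam + n" by (simp add: ps_def length_lex_index)
    have mon: "Polynomial.coeff (pf_basis r \<rho> lam (Suc r, k)) (index_weight r lam + k) = 1"
      "Polynomial.degree (pf_basis r \<rho> lam (Suc r, k)) = index_weight r lam + k" for k
    proof -
      show deg: "Polynomial.degree (pf_basis r \<rho> lam (Suc r, k)) = index_weight r lam + k"
        by (subst pf_basis_def, simp, subst degree_mult_eq)
          (simp_all add: degree_monom_eq degree_rate_product monom_eq_0_iff)
      show "Polynomial.coeff (pf_basis r \<rho> lam (Suc r, k)) (index_weight r lam + k) = 1"
        using lead_coeff_rate_product[of r \<rho> lam]
        by (simp add: pf_basis_def coeff_monom_mult degree_rate_product)
    qed
    have "poly_list_det (ps @ [pf_basis r \<rho> lam (Suc r, n)]) = poly_list_det ps"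
    proof (rule poly_list_det_snoc_monic)
      fix q assume "q \<in> set ps"
      then obtain j k where q: "q = pf_basis r \<rho> lam (j, k)" and
        jk: "(1 \<le> j \<and> j \<le> r \<and> k < lam j) \<or> (j = Suc r \<and> k < n)"
        by (auto simp: ps_def set_lex_index)
      have "Polynomial.degree q < length ps"
        using jk degree_pf_basis_pole[of j r k lam \<rho>] mon(2)[of k] by (auto simp: q len)
      then show "Polynomial.coeff q (length ps) = 0" by (simp add: coeff_eq_0)
    qed (simp add: len mon)
    with Suc show ?case by (simp add: ps_def)
  qed simp
  from this[of "lam (Suc r)"] show ?thesis
    by (simp add: lex_index_Suc poly_list_det_poles)
qed

section \<open>Bilateral transforms of exponentially decaying functions\<close>
lemma integrable_exp_neg_abs:
  fixes \<delta> :: real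
  assumes "0 < \<delta>"
  shows "integrable lborel (\<lambda>t. exp (- \<delta> * \<bar>t\<bar>))"
proof -
  interpret prob_space "density lborel (exponential_density \<delta>)"
    using assms by (rule prob_space_exponential_density)
  have "integrable (density lborel (exponential_density \<delta>)) (\<lambda>_. 1 :: real)"
    by simp
  then have e: "integrable lborel (exponential_density \<delta>)"
    using assms by (subst (asm) integrable_density) (auto simp: exponential_density_nonneg)
  have "integrable lborel (\<lambda>t. (exponential_density \<delta> t + exponential_density \<delta> (0 + (- 1) * t)) / \<delta>)"
    using e lborel_integrable_real_affine[OF e, of "- 1" 0] by (intro integrable_divide_zero integrable_add) auto
  then show ?thesis
    by (rule Bochner_Integration.integrable_bound)
      (use assms in \<open>auto intro!: AE_I2 simp: exponential_density_def field_simps abs_if\<close>)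
qed

text \<open>The set of arguments where transforms converge. Openness leaves room on both sides of
  each point, membership of 0 gives boundedness and plain integrability, and upward closure gives
  convexity of the strip over \<open>S\<close>, needed for analytic continuation.\<close>

locale half_line =
  fixes S :: "real set"
  assumes open_S: "open S" and zero_S: "0 \<in> S"
    and up_S: "\<lbrakk>z \<in> S; z \<le> w\<rbrakk> \<Longrightarrow> w \<in> S"
begin

text \<open>Only one exponential bound per point is demanded, which passes easily through the
  averaging operators; openness of \<open>S\<close> upgrades it to decay on both sides. Continuity
  is included so that the transform determines the function at every point and not just almost
  everywhere.\<close>

definition tame :: "(real \<Rightarrow> real) \<Rightarrow> bool" where
  "tame f \<longleftrightarrow> continuous_on UNIV f \<and> (\<forall>z\<in>S. \<exists>C. \<forall>t. \<bar>f t\<bar> \<le> C * exp (- z * t))"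

lemma tame_measurable: "tame f \<Longrightarrow> f \<in> borel_measurable borel"
  by (simp add: tame_def borel_measurable_continuous_onI)

lemma tame_isCont: "tame f \<Longrightarrow> isCont f x"
  by (simp add: tame_def continuous_on_eq_continuous_at)

text \<open>The bound at a point slightly left of \<open>z\<close> controls negative t, the bound at
  a point slightly right of it controls positive t.\<close>

lemma tame_two_sided:
  assumes "tame f" "z \<in> S"
  obtains C \<delta> where "0 < \<delta>" "0 \<le> C" "\<And>t. exp (z * t) * \<bar>f t\<bar> \<le> C * exp (- \<delta> * \<bar>t\<bar>)"
proof -
  obtain e where e: "0 < e" "\<And>w. dist w z < e \<Longrightarrow> w \<in> S"
    using open_S assms(2) by (auto simp: open_dist)
  have "z - e / 2 \<in> S" "z + e / 2 \<in> S" using e by (auto simp: dist_real_def)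
  then obtain C1 C2 where C: "\<And>t. \<bar>f t\<bar> \<le> C1 * exp (- (z - e / 2) * t)"
      "\<And>t. \<bar>f t\<bar> \<le> C2 * exp (- (z + e / 2) * t)"
    using assms(1) unfolding tame_def by metis
  have pos: "0 \<le> C1" "0 \<le> C2"
    using order_trans[OF abs_ge_zero C(1), of 0] order_trans[OF abs_ge_zero C(2), of 0] by simp_all
  show thesis
  proof
    fix t
    have 1: "exp (z * t) * \<bar>f t\<bar> \<le> C1 * exp (e / 2 * t)"
      using mult_left_mono[OF C(1), of "exp (z * t)" t] by (simp add: mult_ac flip: exp_add) (simp add: algebra_simps)
    have 2: "exp (z * t) * \<bar>f t\<bar> \<le> C2 * exp (- (e / 2) * t)"
      using mult_left_mono[OF C(2), of "exp (z * t)" t] by (simp add: mult_ac flip: exp_add) (simp add: algebra_simps)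
    show "exp (z * t) * \<bar>f t\<bar> \<le> (C1 + C2) * exp (- (e / 2) * \<bar>t\<bar>)"
    proof (cases "0 \<le> t")
      case True
      then show ?thesis using 2 pos by (simp add: distrib_right add_increasing)
    next
      case False
      then show ?thesis using 1 pos by (simp add: distrib_right add_increasing2)
    qed
  qed (use e pos in auto)
qed

lemma tame_integrable:
  assumes "tame f" "z \<in> S"
  shows "integrable lborel (\<lambda>t. exp (z * t) * f t)"
proof -
  obtain C \<delta> where C: "0 < \<delta>" "0 \<le> C" "\<And>t. exp (z * t) * \<bar>f t\<bar> \<le> C * exp (- \<delta> * \<bar>t\<bar>)"
    using tame_two_sided[OF assms] by metis
  have [measurable]: "f \<in> borel_measurable borel" using assms by (simp add: tame_measurable)
  have "integrable lborel (\<lambda>t. C * exp (- \<delta> * \<bar>t\<bar>))"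
    using integrable_exp_neg_abs[OF C(1)] by simp
  then show ?thesis
    by (rule Bochner_Integration.integrable_bound) (use C in \<open>auto simp: abs_mult\<close>)
qed

lemma tame_bounded: "tame f \<Longrightarrow> \<exists>C. \<forall>t. \<bar>f t\<bar> \<le> C"
  using zero_S unfolding tame_def by (metis exp_zero mult.right_neutral mult_zero_left minus_zero)

lemma tame_zero [simp]: "tame (\<lambda>t. 0)"
  unfolding tame_def by (auto intro!: exI[of _ 0])

lemma tame_add:
  assumes "tame f" "tame g"
  shows "tame (\<lambda>t. f t + g t)"
  unfolding tame_def
proof (intro conjI ballI)
  fix z assume "z \<in> S"
  then obtain C1 C2 where "\<And>t. \<bar>f t\<bar> \<le> C1 * exp (- z * t)" "\<And>t. \<bar>g t\<bar> \<le> C2 * exp (- z * t)"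
    using assms unfolding tame_def by metis
  then have "\<bar>f t + g t\<bar> \<le> (C1 + C2) * exp (- z * t)" for t
    unfolding distrib_right by (meson abs_triangle_ineq add_mono order_trans)
  then show "\<exists>C. \<forall>t. \<bar>f t + g t\<bar> \<le> C * exp (- z * t)" by blast
qed (use assms in \<open>auto simp: tame_def intro!: continuous_intros\<close>)

lemma tame_cmult:
  assumes "tame f"
  shows "tame (\<lambda>t. c * f t)"
  unfolding tame_def
proof (intro conjI ballI)
  fix z assume "z \<in> S"
  then obtain C where "\<And>t. \<bar>f t\<bar> \<le> C * exp (- z * t)"
    using assms unfolding tame_def by metis
  then have "\<bar>c * f t\<bar> \<le> (\<bar>c\<bar> * C) * exp (- z * t)" for t
    unfolding abs_mult mult.assoc by (intro mult_left_mono) auto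
  then show "\<exists>C. \<forall>t. \<bar>c * f t\<bar> \<le> C * exp (- z * t)" by blast
qed (use assms in \<open>auto simp: tame_def intro!: continuous_intros\<close>)

lemma tame_sum: "(\<And>i. i \<in> I \<Longrightarrow> tame (f i)) \<Longrightarrow> tame (\<lambda>t. \<Sum>i\<in>I. f i t)"
  by (induction I rule: infinite_finite_induct) (auto intro: tame_add)

text \<open>The inequality x exp (- x) <= 1 at x = delta |t| lets the two-sided decay absorb the
  factor t.\<close>

lemma tame_times_id:
  assumes "tame f"
  shows "tame (\<lambda>t. t * f t)"
  unfolding tame_def
proof (intro conjI ballI)
  fix z assume "z \<in> S"
  obtain C \<delta> where C: "0 < \<delta>" "0 \<le> C" "\<And>t. exp (z * t) * \<bar>f t\<bar> \<le> C * exp (- \<delta> * \<bar>t\<bar>)"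
    using tame_two_sided[OF assms \<open>z \<in> S\<close>] by metis
  have "\<bar>t * f t\<bar> \<le> C / \<delta> * exp (- z * t)" for t
  proof -
    have "\<delta> * \<bar>t\<bar> * exp (- (\<delta> * \<bar>t\<bar>)) \<le> 1"
      using exp_ge_add_one_self[of "\<delta> * \<bar>t\<bar>"] by (simp add: exp_minus divide_simps del: exp_ge_add_one_self)
    then have b: "\<bar>t\<bar> * exp (- \<delta> * \<bar>t\<bar>) \<le> 1 / \<delta>"
      using C(1) by (simp add: field_simps)
    have "exp (z * t) * \<bar>t * f t\<bar> = \<bar>t\<bar> * (exp (z * t) * \<bar>f t\<bar>)" by (simp add: abs_mult)
    also have "\<dots> \<le> \<bar>t\<bar> * (C * exp (- \<delta> * \<bar>t\<bar>))" by (intro mult_left_mono C) auto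
    also have "\<dots> = C * (\<bar>t\<bar> * exp (- \<delta> * \<bar>t\<bar>))" by simp
    also have "\<dots> \<le> C * (1 / \<delta>)" by (intro mult_left_mono b C)
    finally have "exp (- z * t) * (exp (z * t) * \<bar>t * f t\<bar>) \<le> exp (- z * t) * (C / \<delta>)"
      by (intro mult_left_mono) auto
    moreover have "exp (- z * t) * (exp (z * t) * \<bar>t * f t\<bar>) = \<bar>t * f t\<bar>"
      by (simp add: exp_minus)
    ultimately show ?thesis by (simp only: mult.commute)
  qed
  then show "\<exists>C. \<forall>t. \<bar>t * f t\<bar> \<le> C * exp (- z * t)" by blast
qed (use assms in \<open>auto simp: tame_def intro!: continuous_intros\<close>)

lemma tame_times_power: "tame f \<Longrightarrow> tame (\<lambda>t. t ^ k * f t)"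
  by (induction k) (auto dest: tame_times_id simp: mult.assoc)

lemma tame_times_poly: "tame f \<Longrightarrow> tame (\<lambda>t. poly P t * f t)"
  unfolding poly_altdef sum_distrib_right mult.assoc
  by (intro tame_sum tame_cmult tame_times_power)

text \<open>The complex argument serves two ends: the real derivative is a restriction of the
  holomorphic one, and injectivity needs continuation to the imaginary axis.\<close>

definition bilateral_complex :: "(real \<Rightarrow> real) \<Rightarrow> complex \<Rightarrow> complex" where
  "bilateral_complex f z = (LINT t|lborel. exp (z * of_real t) * of_real (f t))"

lemma tame_integrable_complex:
  assumes "tame f" "Re z \<in> S"
  shows "integrable lborel (\<lambda>t. exp (z * of_real t) * complex_of_real (f t))"
proof -
  have [measurable]: "f \<in> borel_measurable borel" using assms by (simp add: tame_measurable)
  have [measurable]: "(\<lambda>t. exp (z * complex_of_real t)) \<in> borel_measurable borel"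
    by (intro borel_measurable_continuous_onI continuous_intros)
  show ?thesis
    by (rule Bochner_Integration.integrable_bound[OF tame_integrable[OF assms]])
      (auto simp: norm_mult)
qed

lemma bilateral_complex_of_real: "bilateral_complex f (of_real z) = of_real (bilateral f z)"
  unfolding bilateral_complex_def bilateral_def
  by (subst integral_complex_of_real[symmetric]) (simp add: exp_of_real flip: of_real_mult)

text \<open>Differentiation under the integral, with the remainder exp (h t) - 1 - h t bounded by
  |h|^2 times a fixed function. The decay rate delta is spent in three portions: delta/2 on exp (|h
  t|), delta/4 on t^2, and delta/4 is kept for integrability.\<close>

lemma has_field_derivative_bilateral_complex:
  assumes f: "tame f" and z: "Re z \<in> S"
  shows "(bilateral_complex f has_field_derivative bilateral_complex (\<lambda>t. t * f t) z) (at z)"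
proof -
  obtain C \<delta> where C: "0 < \<delta>" "0 \<le> C" "\<And>t. exp (Re z * t) * \<bar>f t\<bar> \<le> C * exp (- \<delta> * \<bar>t\<bar>)"
    using tame_two_sided[OF f z] by metis
  have [measurable]: "f \<in> borel_measurable borel" using f by (simp add: tame_measurable)
  obtain e where e: "0 < e" "\<And>w. dist w (Re z) < e \<Longrightarrow> w \<in> S"
    using open_S z by (auto simp: open_dist)
  \<comment> \<open>The constant 32 / delta^2 comes from x^2 / 2 <= exp x at x = delta |t| /
    4.\<close>
  define M where "M = (LINT t|lborel. 32 * C / \<delta>\<^sup>2 * exp (- (\<delta> / 4) * \<bar>t\<bar>))"
  have intM: "integrable lborel (\<lambda>t. 32 * C / \<delta>\<^sup>2 * exp (- (\<delta> / 4) * \<bar>t\<bar>))"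
    using integrable_exp_neg_abs[of "\<delta> / 4"] C(1) by simp
  let ?q = "\<lambda>h. (bilateral_complex f (z + h) - bilateral_complex f z) / h"
  let ?D = "bilateral_complex (\<lambda>t. t * f t) z"
  have bound: "norm (?q h - ?D) \<le> M * norm h" if h: "h \<noteq> 0" "norm h < min e (\<delta> / 2)" for h
  proof -
    have zh: "Re (z + h) \<in> S"
      using h abs_Re_le_cmod[of h] by (intro e(2)) (simp add: dist_real_def)
    let ?r = "\<lambda>t. exp (z * of_real t) * of_real (f t) * (exp (h * of_real t) - (1 + h * of_real t))"
    let ?A = "\<lambda>w t. exp (w * of_real t) * complex_of_real (f t)"
    let ?E = "\<lambda>t. exp (z * of_real t) * complex_of_real (t * f t)"
    note intA = tame_integrable_complex[OF f zh] tame_integrable_complex[OF f z]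
    note intE = integrable_mult_right[OF tame_integrable_complex[OF tame_times_id[OF f] z], of h]
    have r: "?r = (\<lambda>t. ?A (z + h) t - ?A z t - h * ?E t)"
      by (simp add: fun_eq_iff algebra_simps exp_add)
    have "bilateral_complex f (z + h) - bilateral_complex f z - h * ?D = (LINT t|lborel. ?r t)"
      unfolding r bilateral_complex_def using intA intE
      by (simp only: Bochner_Integration.integral_diff Bochner_Integration.integrable_diff
          integral_mult_right_zero)
    also have "norm (LINT t|lborel. ?r t) \<le> (LINT t|lborel. (norm h)\<^sup>2 * (32 * C / \<delta>\<^sup>2 * exp (- (\<delta> / 4) * \<bar>t\<bar>)))"
    proof (rule Bochner_Integration.integral_norm_bound_integral)
      show "integrable lborel ?r"
        unfolding r using intA intE by (intro Bochner_Integration.integrable_diff)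
      show "integrable lborel (\<lambda>t. (norm h)\<^sup>2 * (32 * C / \<delta>\<^sup>2 * exp (- (\<delta> / 4) * \<bar>t\<bar>)))"
        using intM by (rule integrable_mult_right)
      fix t :: real
      let ?a = "norm h * \<bar>t\<bar>"
      have "norm (exp (h * of_real t) - (1 + h * of_real t)) \<le> exp ?a * ?a\<^sup>2"
        using Taylor_exp_field[of "h * of_real t" 1] by (simp add: norm_mult numeral_2_eq_2)
      also have "\<dots> \<le> exp (\<delta> / 2 * \<bar>t\<bar>) * ?a\<^sup>2"
        using h mult_right_mono[of "norm h" "\<delta> / 2" "\<bar>t\<bar>"] by (intro mult_right_mono) auto
      also have "\<dots> = (norm h)\<^sup>2 * (exp (\<delta> / 2 * \<bar>t\<bar>) * t\<^sup>2)"
        by (simp add: power_mult_distrib)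
      also have "t\<^sup>2 \<le> 32 / \<delta>\<^sup>2 * exp (\<delta> / 4 * \<bar>t\<bar>)"
      proof -
        have "(\<delta> / 4 * \<bar>t\<bar>)\<^sup>2 / 2 \<le> exp (\<delta> / 4 * \<bar>t\<bar>)"
          using exp_lower_Taylor_quadratic[of "\<delta> / 4 * \<bar>t\<bar>"] C(1)
          by (smt (verit) mult_nonneg_nonneg divide_nonneg_nonneg abs_ge_zero)
        then show ?thesis using C(1) by (simp add: field_simps power2_eq_square)
      qed
      finally have a: "norm (exp (h * of_real t) - (1 + h * of_real t))
          \<le> (norm h)\<^sup>2 * (exp (\<delta> / 2 * \<bar>t\<bar>) * (32 / \<delta>\<^sup>2 * exp (\<delta> / 4 * \<bar>t\<bar>)))"
        by (simp add: mult_left_mono)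
      have "norm (?r t) = (exp (Re z * t) * \<bar>f t\<bar>) * norm (exp (h * of_real t) - (1 + h * of_real t))"
        by (simp add: norm_mult)
      also have "\<dots> \<le> (C * exp (- \<delta> * \<bar>t\<bar>)) * ((norm h)\<^sup>2 * (exp (\<delta> / 2 * \<bar>t\<bar>) * (32 / \<delta>\<^sup>2 * exp (\<delta> / 4 * \<bar>t\<bar>))))"
        by (intro mult_mono C a) (use C in auto)
      also have "\<dots> = (norm h)\<^sup>2 * (32 * C / \<delta>\<^sup>2) * (exp (- \<delta> * \<bar>t\<bar>) * exp (\<delta> / 2 * \<bar>t\<bar>) * exp (\<delta> / 4 * \<bar>t\<bar>))"
        by simp
      also have "exp (- \<delta> * \<bar>t\<bar>) * exp (\<delta> / 2 * \<bar>t\<bar>) * exp (\<delta> / 4 * \<bar>t\<bar>) = exp (- (\<delta> / 4) * \<bar>t\<bar>)"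
        by (simp flip: exp_add)
      finally show "norm (?r t) \<le> (norm h)\<^sup>2 * (32 * C / \<delta>\<^sup>2 * exp (- (\<delta> / 4) * \<bar>t\<bar>))"
        by (simp add: mult.assoc)
    qed
    also have "\<dots> = (norm h)\<^sup>2 * M" by (simp add: M_def)
    finally have "norm (bilateral_complex f (z + h) - bilateral_complex f z - h * ?D) \<le> (norm h)\<^sup>2 * M" .
    moreover have "?q h - ?D = (bilateral_complex f (z + h) - bilateral_complex f z - h * ?D) / h"
      using h by (simp add: field_simps)
    ultimately show ?thesis
      using h by (simp add: norm_divide divide_le_eq power2_eq_square mult_ac)
  qed
  have "((\<lambda>h. ?q h - ?D) \<longlongrightarrow> 0) (at 0)"
  proof (rule Lim_null_comparison)
    have "\<forall>\<^sub>F h in at 0. h \<noteq> 0 \<and> norm h < min e (\<delta> / 2)"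
      using C(1) e(1) by (auto simp: eventually_at dist_norm intro!: exI[of _ "min e (\<delta> / 2)"])
    then show "\<forall>\<^sub>F h in at 0. norm (?q h - ?D) \<le> M * norm h"
      by eventually_elim (rule bound, auto)
    show "((\<lambda>h. M * norm h) \<longlongrightarrow> 0) (at (0 :: complex))"
      by (auto intro!: tendsto_eq_intros)
  qed
  then show ?thesis unfolding DERIV_def by (rule LIM_zero_cancel)
qed

lemma has_real_derivative_bilateral:
  assumes "tame f" "z \<in> S"
  shows "(bilateral f has_real_derivative bilateral (\<lambda>t. t * f t) z) (at z)"
proof -
  have "((\<lambda>x. bilateral_complex f (of_real x)) has_vector_derivative
      bilateral_complex (\<lambda>t. t * f t) (of_real z)) (at z)"
    by (rule has_vector_derivative_real_field) (use assms has_field_derivative_bilateral_complex in auto)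
  from bounded_linear.has_vector_derivative[OF bounded_linear_Re this]
  show ?thesis by (simp add: bilateral_complex_of_real has_real_derivative_iff_has_vector_derivative)
qed

lemma higher_deriv_bilateral:
  assumes "tame f" "z \<in> S"
  shows "(deriv ^^ k) (bilateral f) z = bilateral (\<lambda>t. t ^ k * f t) z"
  using assms(2)
proof (induction k arbitrary: z)
  case (Suc k)
  have ev: "\<forall>\<^sub>F w in nhds z. (deriv ^^ k) (bilateral f) w = bilateral (\<lambda>t. t ^ k * f t) w"
    using Suc open_S by (auto simp: eventually_nhds)
  have "(deriv ^^ Suc k) (bilateral f) z = deriv (bilateral (\<lambda>t. t ^ k * f t)) z"
    using deriv_cong_ev[OF ev refl] by simp
  also have "\<dots> = bilateral (\<lambda>t. t * (t ^ k * f t)) z"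
    using has_real_derivative_bilateral[OF tame_times_power[OF assms(1)] Suc.prems]
    by (rule DERIV_imp_deriv)
  finally show ?case by (simp add: mult.assoc)
qed simp

lemma bilateral_add:
  "\<lbrakk>tame f; tame g; z \<in> S\<rbrakk> \<Longrightarrow> bilateral (\<lambda>t. f t + g t) z = bilateral f z + bilateral g z"
  unfolding bilateral_def using tame_integrable[of f z] tame_integrable[of g z]
  by (simp add: distrib_left)

lemma bilateral_cmult: "bilateral (\<lambda>t. c * f t) z = c * bilateral f z"
  unfolding bilateral_def by (simp add: mult.left_commute[of _ c])

lemma bilateral_sum:
  assumes "\<And>i. i \<in> I \<Longrightarrow> tame (f i)" "z \<in> S"
  shows "bilateral (\<lambda>t. \<Sum>i\<in>I. f i t) z = (\<Sum>i\<in>I. bilateral (f i) z)"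
  unfolding bilateral_def sum_distrib_left using assms
  by (intro Bochner_Integration.integral_sum tame_integrable)

lemma poly_deriv_op_bilateral:
  assumes "tame f" "z \<in> S"
  shows "poly_deriv_op P (bilateral f) z = bilateral (\<lambda>t. poly P t * f t) z"
  unfolding poly_deriv_op_def poly_altdef sum_distrib_right mult.assoc
  using assms by (subst bilateral_sum) (auto intro!: tame_cmult tame_times_power
      simp: bilateral_cmult higher_deriv_bilateral)

end

text \<open>The set where \<open>f\<close> is nonzero is open and null, while a nonempty open set
  contains a ball of positive measure.\<close>

lemma continuous_AE_eq_0:
  fixes f :: "real \<Rightarrow> real"
  assumes cont: "continuous_on UNIV f" and ae: "AE t in lborel. f t = 0"
  shows "f t = 0"
proof (rule ccontr)
  assume "f t \<noteq> 0"
  let ?U = "f -` (- {0})"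
  have "open ?U" using cont by (intro open_vimage) auto
  moreover have "t \<in> ?U" using \<open>f t \<noteq> 0\<close> by simp
  ultimately obtain e where e: "0 < e" "ball t e \<subseteq> ?U" by (meson open_contains_ball)
  have "?U \<in> null_sets lborel"
    using ae \<open>open ?U\<close> by (subst (asm) AE_iff_null) (auto simp: vimage_def Compl_eq)
  then have "emeasure lborel (ball t e) = 0"
    using null_sets_subset[of ?U lborel "ball t e"] e(2) by auto
  then show False using e(1) by (simp add: ball_eq_greaterThanLessThan)
qed

context half_line
begin

lemma convex_S: "convex S"
  using up_S by (intro is_interval_convex) (auto simp: is_interval_1)

text \<open>The transform continues holomorphically to the strip over \<open>S\<close>, hence vanishes on the imaginary
  axis: the normalised positive and negative parts of \<open>f\<close> have the same characteristic function.\<close>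
lemma bilateral_eq_0_imp_eq_0:
  assumes f: "tame f" and z: "\<And>z. z \<in> S \<Longrightarrow> bilateral f z = 0"
  shows "f t = 0"
proof -
  define H where "H = {w :: complex. Re w \<in> S}"
  have "open H" unfolding H_def using open_S
    by (intro open_vimage[of S Re, unfolded vimage_def]) (auto intro: continuous_intros)
  have "convex H"
    using convex_linear_vimage[OF bounded_linear.linear[OF bounded_linear_Re] convex_S] by (simp add: H_def vimage_def)
  have holo: "bilateral_complex f holomorphic_on H"
    unfolding holomorphic_on_def field_differentiable_def H_def
    using has_field_derivative_bilateral_complex[OF f] by (blast intro: has_field_derivative_at_within)
  \<comment> \<open>The real points of \<open>S\<close> accumulate at 0, which lies in the connected
    open strip \<open>H\<close>; the identity theorem does the rest.\<close>
  have zero: "bilateral_complex f w = 0" if "w \<in> H" for w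
  proof (rule analytic_continuation[OF holo \<open>open H\<close> convex_connected[OF \<open>convex H\<close>], of "of_real ` S" 0])
    obtain e where e: "0 < e" "\<And>w. dist w 0 < e \<Longrightarrow> w \<in> S"
      using open_S zero_S by (auto simp: open_dist)
    show "(0 :: complex) islimpt of_real ` S"
      unfolding islimpt_approachable
    proof (intro allI impI)
      fix d :: real assume "0 < d"
      then have "complex_of_real (min d e / 2) \<in> of_real ` S"
        using e by (intro imageI e(2)) (simp add: dist_real_def)
      then show "\<exists>x\<in>of_real ` S. x \<noteq> (0 :: complex) \<and> dist x 0 < d"
        using \<open>0 < d\<close> e(1) by (rule_tac bexI) (auto simp: norm_divide)
    qed
    next
    show "bilateral_complex f v = 0" if "v \<in> of_real ` S" for v
      using that by (auto simp: bilateral_complex_of_real z)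
  qed (use that zero_S in \<open>auto simp: H_def\<close>)
  have char0: "(LINT t|lborel. exp (\<i> * of_real (s * t)) * complex_of_real (f t)) = 0" for s
    using zero[of "\<i> * of_real s"] zero_S by (simp add: H_def bilateral_complex_def mult.assoc)
  define fp fn where "fp t = max (f t) 0" and "fn t = max (- f t) 0" for t
  have f_eq: "f t = fp t - fn t" for t by (simp add: fp_def fn_def)
  have nn: "0 \<le> fp t" "0 \<le> fn t" for t by (simp_all add: fp_def fn_def)
  have [measurable]: "f \<in> borel_measurable borel" using f by (rule tame_measurable)
  have [measurable]: "fp \<in> borel_measurable borel" "fn \<in> borel_measurable borel"
    unfolding fp_def fn_def by measurable
  have intf: "integrable lborel f" using tame_integrable[OF f zero_S] by simp
  have intp: "integrable lborel fp" and intn: "integrable lborel fn"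
    using intf unfolding fp_def fn_def by auto
  define c where "c = (LINT t|lborel. fp t)"
  \<comment> \<open>The case s = 0: both parts have the same mass, so the same \<open>c\<close>
    normalises them.\<close>
  have cn: "(LINT t|lborel. fn t) = c"
    using char0[of 0] Bochner_Integration.integral_diff[OF intp intn]
    by (simp add: c_def flip: f_eq)
  have "AE t in lborel. f t = 0"
  \<comment> \<open>Zero mass cannot be normalised, but then both parts vanish almost
    everywhere.\<close>
  proof (cases "c = 0")
    case True
    then have "AE t in lborel. fp t = 0" "AE t in lborel. fn t = 0"
      using integral_nonneg_eq_0_iff_AE[OF intp] integral_nonneg_eq_0_iff_AE[OF intn] nn cn
      by (simp_all add: c_def)
    then show ?thesis by eventually_elim (simp add: f_eq)
  next
    case False
    moreover have "0 \<le> c" unfolding c_def using nn by (intro integral_nonneg_AE) auto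
    ultimately have c: "0 < c" by simp
    define P N where "P = density lborel (\<lambda>t. ennreal (fp t / c))"
      and "N = density lborel (\<lambda>t. ennreal (fn t / c))"
    have dist: "real_distribution (density lborel (\<lambda>t. ennreal (g t / c)))"
      if [measurable]: "g \<in> borel_measurable borel" and "integrable lborel g" "\<And>t. 0 \<le> g t" "(LINT t|lborel. g t) = c" for g
    proof -
      have "emeasure (density lborel (\<lambda>t. ennreal (g t / c))) UNIV = (\<integral>\<^sup>+ t. ennreal (g t / c) \<partial>lborel)"
        by (subst emeasure_density) auto
      also have "\<dots> = ennreal (LINT t|lborel. g t / c)"
        using that c by (intro nn_integral_eq_integral) auto
      finally have "prob_space (density lborel (\<lambda>t. ennreal (g t / c)))"
        using that c by (intro prob_spaceI) simp
      then show ?thesis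
        by (intro real_distribution.intro real_distribution_axioms.intro) auto
    qed
    have char: "char (density lborel (\<lambda>t. ennreal (g t / c))) s
        = (LINT t|lborel. exp (\<i> * of_real (s * t)) * complex_of_real (g t)) / c"
      if [measurable]: "g \<in> borel_measurable borel" and "\<And>t. 0 \<le> g t" for g s
    proof -
      have "(LINT t|density lborel (\<lambda>t. ennreal (g t / c)). exp (\<i> * of_real (s * t)))
          = (LINT t|lborel. (g t / c) *\<^sub>R exp (\<i> * complex_of_real (s * t)))"
        using that c by (intro integral_density) auto
      also have "(\<lambda>t. (g t / c) *\<^sub>R exp (\<i> * complex_of_real (s * t)))
          = (\<lambda>t. exp (\<i> * of_real (s * t)) * complex_of_real (g t) / complex_of_real c)"
        by (simp add: scaleR_conv_of_real fun_eq_iff)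
      finally show ?thesis by (simp add: char_def)
    qed
    have "P = N"
    proof (rule Levy_uniqueness)
      show "real_distribution P" "real_distribution N"
        unfolding P_def N_def by (rule dist; use intp intn nn cn c_def in simp)+
      have exp_int: "integrable lborel (\<lambda>t. exp (\<i> * of_real (s * t)) * complex_of_real (g t))"
        if "integrable lborel g" for g and s :: real
      proof -
        have [measurable]: "g \<in> borel_measurable borel"
          using borel_measurable_integrable[OF that] by simp
        show ?thesis
          by (rule Bochner_Integration.integrable_bound[OF that]) (auto simp: norm_mult)
      qed
      show "char P = char N"
      proof
        fix s
        have "(LINT t|lborel. exp (\<i> * of_real (s * t)) * complex_of_real (fp t))
            - (LINT t|lborel. exp (\<i> * of_real (s * t)) * complex_of_real (fn t)) = 0"
          using char0[of s] Bochner_Integration.integral_diff[OF exp_int[OF intp, of s] exp_int[OF intn, of s]]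
          by (simp add: f_eq right_diff_distrib)
        then show "char P s = char N s"
          unfolding P_def N_def using nn by (simp add: char)
      qed
    qed
    then have "AE t in lborel. ennreal (fp t / c) = ennreal (fn t / c)"
      unfolding P_def N_def by (rule sigma_finite_lborel[THEN sigma_finite_measure.density_unique, rotated 2]) auto
    then show ?thesis
    proof eventually_elim
      case (elim t)
      then have "fp t / c = fn t / c" using c nn[of t] by (subst (asm) ennreal_inj) auto
      then show ?case using c by (simp add: f_eq)
    qed
  qed
  moreover have "continuous_on UNIV f" using f by (simp add: tame_def)
  ultimately show ?thesis by (rule continuous_AE_eq_0[rotated])
qed

lemma bilateral_inject:
  assumes f: "tame f" and g: "tame g" and "\<And>z. z \<in> S \<Longrightarrow> bilateral f z = bilateral g z"
  shows "f t = g t"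
proof -
  have m: "tame (\<lambda>t. - 1 * g t)" using g by (rule tame_cmult)
  have "f t + - 1 * g t = 0"
  proof (rule bilateral_eq_0_imp_eq_0[OF tame_add[OF f m]])
    fix z assume "z \<in> S"
    then show "bilateral (\<lambda>t. f t + - 1 * g t) z = 0"
      unfolding bilateral_add[OF f m \<open>z \<in> S\<close>] bilateral_cmult using assms(3) by simp
  qed
  then show ?thesis by simp
qed

end

section \<open>Gamma averaging operators\<close>
definition gamma_density :: "real \<Rightarrow> real \<Rightarrow> real \<Rightarrow> real" where
  "gamma_density \<rho> d u
    = indicator {0<..} u * (\<rho> powr d / Gamma d * u powr (d - 1) * exp (- \<rho> * u))"

lemma gamma_density_measurable [measurable]: "gamma_density \<rho> d \<in> borel_measurable borel"
  unfolding gamma_density_def by measurable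

lemma gamma_density_nonneg: "0 < d \<Longrightarrow> 0 \<le> gamma_density \<rho> d u"
  by (simp add: gamma_density_def Gamma_real_nonneg indicator_def)

text \<open>Euler's integral for \<open>Gamma d\<close> after rescaling by rho + z: the factor exp
  (- z u) merely shifts the rate from rho to rho + z.\<close>

lemma has_bochner_integral_gamma_density:
  assumes d: "0 < d" and "0 < \<rho>" and z: "0 < \<rho> + z"
  shows "has_bochner_integral lborel (\<lambda>u. gamma_density \<rho> d u * exp (- z * u)) ((\<rho> / (\<rho> + z)) powr d)"
proof -
  let ?g = "\<lambda>t::real. indicator {0..} t * (t powr (d - 1) / exp t)"
  have "(?g has_integral Gamma d) UNIV"
    using Gamma_integral_real[OF d] unfolding has_integral_restrict_UNIV[of "{0..}", symmetric]
    by (rule has_integral_eq[rotated]) (simp add: indicator_def)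
  then have "(\<integral>\<^sup>+ t. ennreal (?g t) \<partial>lborel) = ennreal (Gamma d)"
    by (intro nn_integral_has_integral_lborel) auto
  then have "has_bochner_integral lborel ?g (Gamma d)"
    using d by (intro has_bochner_integral_nn_integral) (auto simp: less_imp_le Gamma_real_pos)
  then have "has_bochner_integral lborel (\<lambda>u. ?g (0 + (\<rho> + z) * u)) (Gamma d /\<^sub>R \<bar>\<rho> + z\<bar>)"
    using z by (subst lborel_has_bochner_integral_real_affine_iff[symmetric]) auto
  then have "has_bochner_integral lborel
      (\<lambda>u. \<rho> powr d / Gamma d / (\<rho> + z) powr (d - 1) * ?g (0 + (\<rho> + z) * u))
      (\<rho> powr d / Gamma d / (\<rho> + z) powr (d - 1) * (Gamma d /\<^sub>R \<bar>\<rho> + z\<bar>))"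
    by (rule has_bochner_integral_mult_right)
  also have "(\<lambda>u. \<rho> powr d / Gamma d / (\<rho> + z) powr (d - 1) * ?g (0 + (\<rho> + z) * u))
      = (\<lambda>u. gamma_density \<rho> d u * exp (- z * u))"
  proof
    fix u :: real
    consider "u < 0" | "u = 0" | "0 < u" by linarith
    then show "\<rho> powr d / Gamma d / (\<rho> + z) powr (d - 1) * ?g (0 + (\<rho> + z) * u)
        = gamma_density \<rho> d u * exp (- z * u)"
    proof cases
      case 3
      have "exp ((\<rho> + z) * u) = exp (\<rho> * u) * exp (z * u)" by (simp add: distrib_right exp_add)
      then have g: "?g (0 + (\<rho> + z) * u) = (\<rho> + z) powr (d - 1) * u powr (d - 1) / (exp (\<rho> * u) * exp (z * u))"
        using z 3 by (simp add: powr_mult)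
      show ?thesis unfolding g using z 3
        by (simp add: gamma_density_def exp_minus field_simps)
    qed (use z in \<open>auto simp: gamma_density_def mult_less_0_iff not_less indicator_def zero_le_mult_iff\<close>)
  qed
  also have "\<rho> powr d / Gamma d / w powr (d - 1) * (Gamma d /\<^sub>R \<bar>w\<bar>) = (\<rho> / w) powr d" if "0 < w" for w
    using assms(2) that Gamma_real_pos[OF d] by (simp add: powr_divide powr_diff field_simps)
  note this[OF z]
  finally show ?thesis .
qed

lemma gamma_op_eq_gamma_density:
  "d \<noteq> 0 \<Longrightarrow> gamma_op \<rho> d f t = (LINT u|lborel. gamma_density \<rho> d u * f (t + u))"
  by (simp add: gamma_op_def set_lebesgue_integral_def gamma_density_def mult_ac)

lemma gamma_op_0 [simp]: "gamma_op \<rho> 0 f = f"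
  by (simp add: gamma_op_def fun_eq_iff)

locale half_line_rate = half_line +
  fixes \<rho> d :: real
  assumes rate_pos: "0 < \<rho>" and rate: "z \<in> S \<Longrightarrow> 0 < \<rho> + z" and d_nonneg: "0 \<le> d"
begin

lemma integrable_gamma_density:
  "\<lbrakk>d \<noteq> 0; z \<in> S\<rbrakk> \<Longrightarrow> integrable lborel (\<lambda>u. gamma_density \<rho> d u * exp (- z * u))"
  using has_bochner_integral_gamma_density[OF _ rate_pos rate, of d z] d_nonneg
  by (auto intro: integrable.intros)

lemma integral_gamma_density:
  "\<lbrakk>d \<noteq> 0; z \<in> S\<rbrakk> \<Longrightarrow> (LINT u|lborel. gamma_density \<rho> d u * exp (- z * u)) = (\<rho> / (\<rho> + z)) powr d"
  using has_bochner_integral_gamma_density[OF _ rate_pos rate, of d z] d_nonneg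
  by (auto intro: has_bochner_integral_integral_eq)

lemma gamma_density_ge_0: "d \<noteq> 0 \<Longrightarrow> 0 \<le> gamma_density \<rho> d u"
  using d_nonneg by (simp add: gamma_density_nonneg)

lemma integrable_gamma_density_bounded:
  assumes "d \<noteq> 0" and [measurable]: "g \<in> borel_measurable borel" and "\<And>u. \<bar>g u\<bar> \<le> C"
  shows "integrable lborel (\<lambda>u. gamma_density \<rho> d u * g u)"
proof (rule Bochner_Integration.integrable_bound)
  show "integrable lborel (\<lambda>u. C * gamma_density \<rho> d u)"
    using integrable_gamma_density[OF assms(1) zero_S] by simp
  show "AE u in lborel. norm (gamma_density \<rho> d u * g u) \<le> norm (C * gamma_density \<rho> d u)"
    using assms(3) gamma_density_ge_0[OF assms(1)] order_trans[OF abs_ge_zero assms(3)]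
    by (intro AE_I2) (auto simp: abs_mult mult.commute[of C] intro!: mult_left_mono)
qed measurable

lemma tame_shift_measurable [measurable (raw)]:
  "tame f \<Longrightarrow> (\<lambda>u. f (t + u)) \<in> borel_measurable borel"
  using measurable_compose[OF _ tame_measurable, of "\<lambda>u. t + u" borel f] by simp

lemma integrable_gamma_density_tame:
  assumes "d \<noteq> 0" "tame f"
  shows "integrable lborel (\<lambda>u. gamma_density \<rho> d u * f (t + u))"
  using tame_bounded[OF assms(2)] assms
  by (auto intro!: integrable_gamma_density_bounded tame_shift_measurable)

text \<open>Averaging multiplies a bound C exp (- z t) by the Laplace transform of the density at
  \<open>z\<close>, so the bound survives at the same \<open>z\<close>; continuity follows by
  dominated convergence, \<open>f\<close> being bounded.\<close>

lemma tame_gamma_op: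
  assumes f: "tame f"
  shows "tame (gamma_op \<rho> d f)"
proof (cases "d = 0")
  case False
  note eq = gamma_op_eq_gamma_density[OF False, of \<rho> f]
  have bound: "\<bar>gamma_op \<rho> d f t\<bar> \<le> C * (\<rho> / (\<rho> + z)) powr d * exp (- z * t)"
    if z: "z \<in> S" and C: "\<And>t. \<bar>f t\<bar> \<le> C * exp (- z * t)" for z C t
  proof -
    have "norm (LINT u|lborel. gamma_density \<rho> d u * f (t + u))
        \<le> (LINT u|lborel. C * exp (- z * t) * (gamma_density \<rho> d u * exp (- z * u)))"
    proof (rule Bochner_Integration.integral_norm_bound_integral[OF integrable_gamma_density_tame[OF False f]])
      show "integrable lborel (\<lambda>u. C * exp (- z * t) * (gamma_density \<rho> d u * exp (- z * u)))"
        using integrable_gamma_density[OF False z] by (rule integrable_mult_right)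
      fix u
      have "\<bar>f (t + u)\<bar> \<le> C * exp (- z * t) * exp (- z * u)"
        using C[of "t + u"] by (simp add: distrib_left exp_diff exp_minus divide_inverse mult.assoc)
      from mult_left_mono[OF this gamma_density_ge_0[OF False, of u]]
      show "norm (gamma_density \<rho> d u * f (t + u)) \<le> C * exp (- z * t) * (gamma_density \<rho> d u * exp (- z * u))"
        using gamma_density_ge_0[OF False, of u] by (simp add: abs_mult mult_ac)
    qed
    also have "\<dots> = C * exp (- z * t) * (\<rho> / (\<rho> + z)) powr d"
      using integral_gamma_density[OF False z] by (simp del: mult_minus_left)
    finally show ?thesis by (simp add: eq mult_ac)
  qed
  obtain C where C: "\<And>t. \<bar>f t\<bar> \<le> C" using tame_bounded[OF f] by blast
  have "isCont (gamma_op \<rho> d f) t" for t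
    unfolding continuous_at_sequentially
  proof (intro allI impI)
    fix x :: "nat \<Rightarrow> real" assume x: "x \<longlonglongrightarrow> t"
    have "(\<lambda>n. LINT u|lborel. gamma_density \<rho> d u * f (x n + u)) \<longlonglongrightarrow> (LINT u|lborel. gamma_density \<rho> d u * f (t + u))"
    proof (rule integral_dominated_convergence[where w = "\<lambda>u. C * gamma_density \<rho> d u"])
      show "integrable lborel (\<lambda>u. C * gamma_density \<rho> d u)"
        using integrable_gamma_density[OF False zero_S] by simp
      show "AE u in lborel. (\<lambda>n. gamma_density \<rho> d u * f (x n + u)) \<longlonglongrightarrow> gamma_density \<rho> d u * f (t + u)"
        using x by (intro AE_I2 tendsto_intros isCont_tendsto_compose[OF tame_isCont[OF f]])
      show "AE u in lborel. norm (gamma_density \<rho> d u * f (x n + u)) \<le> C * gamma_density \<rho> d u" for n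
        using C gamma_density_ge_0[OF False]
        by (intro AE_I2) (auto simp: abs_mult mult.commute[of C] intro!: mult_left_mono)
    qed (use integrable_gamma_density_tame[OF False f] in auto)
    then show "((gamma_op \<rho> d f) \<circ> x) \<longlonglongrightarrow> gamma_op \<rho> d f t" by (simp add: eq o_def)
  qed
  then show ?thesis
    using f bound unfolding tame_def by (auto simp: continuous_on_eq_continuous_at) metis
qed (use f in simp)

text \<open>Fubini: shifting the argument of \<open>f\<close> by u multiplies its transform by exp
  (- z u), and integrating this against the density gives the power.\<close>

lemma bilateral_gamma_op:
  assumes f: "tame f" and z: "z \<in> S"
  shows "bilateral (gamma_op \<rho> d f) z = (\<rho> / (\<rho> + z)) powr d * bilateral f z"
proof (cases "d = 0")
  case True
  then show ?thesis using rate[OF z] rate_pos by simp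
next
  case False
  have [measurable]: "f \<in> borel_measurable borel" using f by (rule tame_measurable)
  \<comment> \<open>The shape \<open>u + 1 * t\<close> is kept to match the affine change of
    variables.\<close>
  let ?h = "\<lambda>u t. gamma_density \<rho> d u * exp (- z * u) * (exp (z * (u + 1 * t)) * f (u + 1 * t))"
  have int1: "integrable lborel (\<lambda>t. exp (z * (u + 1 * t)) * f (u + 1 * t))" for u
    using lborel_integrable_real_affine[OF tame_integrable[OF f z], of 1 u] by simp
  have shift: "(LINT t|lborel. g (u + 1 * t)) = (LINT t|lborel. g t)" for u and g :: "real \<Rightarrow> real"
    using lborel_integral_real_affine[of 1 g u] by simp
  have "integrable (lborel \<Otimes>\<^sub>M lborel) (case_prod ?h)"
  proof (rule lborel_pair.Fubini_integrable)
    have "(\<lambda>u. LINT t|lborel. norm (case_prod ?h (u, t)))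
        = (\<lambda>u. gamma_density \<rho> d u * exp (- z * u) * (LINT t|lborel. exp (z * t) * \<bar>f t\<bar>))"
    proof
      fix u
      have "(LINT t|lborel. norm (case_prod ?h (u, t)))
          = gamma_density \<rho> d u * exp (- z * u) * (LINT t|lborel. exp (z * (u + 1 * t)) * \<bar>f (u + 1 * t)\<bar>)"
        using gamma_density_ge_0[OF False] by (simp add: abs_mult)
      then show "(LINT t|lborel. norm (case_prod ?h (u, t)))
          = gamma_density \<rho> d u * exp (- z * u) * (LINT t|lborel. exp (z * t) * \<bar>f t\<bar>)"
        by (simp only: shift[of "\<lambda>t. exp (z * t) * \<bar>f t\<bar>"])
    qed
    then show "integrable lborel (\<lambda>u. LINT t|lborel. norm (case_prod ?h (u, t)))"
      using integrable_gamma_density[OF False z] by (simp del: mult_minus_left)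
    show "AE u in lborel. integrable lborel (\<lambda>t. case_prod ?h (u, t))"
      using int1 by (intro AE_I2) (simp del: mult_1_left)
  qed measurable
  from lborel_pair.Fubini_integral[OF this]
  have "(LINT t|lborel. LINT u|lborel. ?h u t) = (LINT u|lborel. LINT t|lborel. ?h u t)" .
  also have "(\<lambda>u. LINT t|lborel. ?h u t) = (\<lambda>u. gamma_density \<rho> d u * exp (- z * u) * bilateral f z)"
  proof
    fix u
    have "(LINT t|lborel. ?h u t) = gamma_density \<rho> d u * exp (- z * u) * (LINT t|lborel. exp (z * (u + 1 * t)) * f (u + 1 * t))"
      by (rule integral_mult_right_zero)
    then show "(LINT t|lborel. ?h u t) = gamma_density \<rho> d u * exp (- z * u) * bilateral f z"
      by (simp only: shift[of "\<lambda>t. exp (z * t) * f t"] bilateral_def)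
  qed
  also have "(LINT u|lborel. gamma_density \<rho> d u * exp (- z * u) * bilateral f z) = (\<rho> / (\<rho> + z)) powr d * bilateral f z"
    using integral_gamma_density[OF False z] by (simp del: mult_minus_left)
  also have "(\<lambda>t. LINT u|lborel. ?h u t) = (\<lambda>t. exp (z * t) * gamma_op \<rho> d f t)"
  proof
    fix t
    have "?h u t = exp (z * t) * (gamma_density \<rho> d u * f (t + u))" for u
      by (simp add: distrib_left exp_add exp_minus add.commute)
    then show "(LINT u|lborel. ?h u t) = exp (z * t) * gamma_op \<rho> d f t"
      using gamma_op_eq_gamma_density[OF False, of \<rho> f t] by (simp only: integral_mult_right_zero)
  qed
  finally show ?thesis by (simp add: bilateral_def)
qed

text \<open>By the mean value theorem \<open>f\<close> is Lipschitz with the bound of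
  \<open>g\<close>, so all difference quotients under the integral are dominated by one multiple of
  the density.\<close>

lemma has_real_derivative_gamma_op:
  assumes f: "tame f" and g: "tame g" and deriv: "\<And>t. (f has_real_derivative g t) (at t)"
  shows "(gamma_op \<rho> d f has_real_derivative gamma_op \<rho> d g t) (at t)"
proof (cases "d = 0")
  case False
  note eq = gamma_op_eq_gamma_density[OF False, of \<rho>]
  obtain C where C: "\<And>t. \<bar>g t\<bar> \<le> C" using tame_bounded[OF g] by blast
  have lip: "\<bar>f x - f y\<bar> \<le> C * \<bar>x - y\<bar>" for x y
    using field_differentiable_bound[of UNIV f g C x y] deriv C by simp
  let ?q = "\<lambda>h u. gamma_density \<rho> d u * ((f (t + h + u) - f (t + u)) / h)"
  have int: "integrable lborel (\<lambda>u. gamma_density \<rho> d u * f (s + u))" for s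
    by (rule integrable_gamma_density_tame[OF False f])
  have q: "(gamma_op \<rho> d f (t + h) - gamma_op \<rho> d f t) / h = (LINT u|lborel. ?q h u)" for h
    unfolding eq using int[of "t + h"] int[of t]
    by (simp add: right_diff_distrib diff_divide_distrib)
  show ?thesis
    unfolding DERIV_def tendsto_at_iff_sequentially
  proof (intro allI impI)
      fix X :: "nat \<Rightarrow> real" assume X: "\<forall>i. X i \<in> UNIV - {0}" "X \<longlonglongrightarrow> 0"
      have "(\<lambda>n. LINT u|lborel. ?q (X n) u) \<longlonglongrightarrow> (LINT u|lborel. gamma_density \<rho> d u * g (t + u))"
      proof (rule integral_dominated_convergence[where w = "\<lambda>u. C * gamma_density \<rho> d u"])
        show "integrable lborel (\<lambda>u. C * gamma_density \<rho> d u)"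
          using integrable_gamma_density[OF False zero_S] by simp
        show "AE u in lborel. (\<lambda>n. ?q (X n) u) \<longlonglongrightarrow> gamma_density \<rho> d u * g (t + u)"
        proof (intro AE_I2 tendsto_mult tendsto_const)
          fix u
          have "((\<lambda>h. (f (t + u + h) - f (t + u)) / h) \<longlongrightarrow> g (t + u)) (at 0)"
            using deriv[of "t + u"] by (simp add: DERIV_def)
          moreover have "filterlim X (at 0) sequentially"
            using X by (auto simp: filterlim_at)
          ultimately have "(\<lambda>n. (f (t + u + X n) - f (t + u)) / X n) \<longlonglongrightarrow> g (t + u)"
            by (rule filterlim_compose)
          then show "(\<lambda>n. (f (t + X n + u) - f (t + u)) / X n) \<longlonglongrightarrow> g (t + u)"
            by (simp add: add_ac)
        qed
        show "AE u in lborel. norm (?q (X n) u) \<le> C * gamma_density \<rho> d u" for n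
        proof (intro AE_I2)
          fix u
          have "\<bar>(f (t + X n + u) - f (t + u)) / X n\<bar> \<le> C"
            using lip[of "t + X n + u" "t + u"] X(1) by (simp add: abs_divide divide_le_eq)
          from mult_left_mono[OF this gamma_density_ge_0[OF False, of u]]
          show "norm (?q (X n) u) \<le> C * gamma_density \<rho> d u"
            using gamma_density_ge_0[OF False, of u] by (simp add: abs_mult mult.commute)
        qed
      qed (use integrable_gamma_density_tame[OF False g] f in \<open>auto intro!: borel_measurable_times borel_measurable_divide borel_measurable_diff tame_shift_measurable\<close>)
      then show "((\<lambda>h. (gamma_op \<rho> d f (t + h) - gamma_op \<rho> d f t) / h) \<circ> X) \<longlonglongrightarrow> gamma_op \<rho> d g t"
        by (simp only: o_def q eq[of g])
  qed
qed (use deriv in simp)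

end

text \<open>Completing the square. It yields both the transform of the Gaussian and, with
  \<open>gauss_bounds\<close>, its decay at every exponential rate.\<close>

lemma exp_times_gauss: "exp (z * t) * gauss a t = exp (a * z + z\<^sup>2 / 4) * gauss (a + z / 2) t"
proof -
  have "z * t + - ((t - a)\<^sup>2) = a * z + z\<^sup>2 / 4 + - ((t - (a + z / 2))\<^sup>2)"
    by (simp add: power2_eq_square field_simps)
  then have "exp (z * t) * exp (- ((t - a)\<^sup>2)) = exp (a * z + z\<^sup>2 / 4) * exp (- ((t - (a + z / 2))\<^sup>2))"
    by (simp only: flip: exp_add)
  then show ?thesis by (simp add: gauss_def)
qed

lemma gauss_eq_normal_density: "gauss a = normal_density a (1 / sqrt 2)"
  by (simp add: fun_eq_iff gauss_def normal_density_def power_divide real_sqrt_mult real_sqrt_divide)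

lemma bilateral_gauss: "bilateral (gauss a) z = exp (a * z + z\<^sup>2 / 4)"
  unfolding bilateral_def exp_times_gauss by (simp add: gauss_eq_normal_density)

lemma gauss_bounds: "0 \<le> gauss a t" "gauss a t \<le> 1"
proof -
  have "exp (- ((t - a)\<^sup>2)) \<le> 1" by simp
  also have "1 \<le> sqrt pi" using pi_gt3 by simp
  finally show "0 \<le> gauss a t" "gauss a t \<le> 1"
    using pi_gt_zero by (simp_all add: gauss_def divide_le_eq_1_pos)
qed

lemma has_real_derivative_gauss_poly:
  "((\<lambda>t. poly P t * gauss a t) has_real_derivative
     poly (pderiv P - [:- 2 * a, 2:] * P) t * gauss a t) (at t)"
proof -
  have "((\<lambda>t. exp (- ((t - a)\<^sup>2))) has_real_derivative - 2 * (t - a) * exp (- ((t - a)\<^sup>2))) (at t)"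
    by (auto intro!: derivative_eq_intros)
  from DERIV_cdivide[OF this, of "sqrt pi"]
  have "(gauss a has_real_derivative - 2 * (t - a) * gauss a t) (at t)"
    by (simp add: gauss_def[abs_def])
  from DERIV_mult[OF poly_DERIV[of P t] this] show ?thesis
    by (rule DERIV_cong) (simp add: algebra_simps)
qed

section \<open>Smooth functions all of whose derivatives decay\<close>

context half_line
begin

text \<open>The chain of derivatives is an explicit sequence, so that closure under sums, multiples
  and averaging is checked member by member, without identifying iterated
  \<open>deriv\<close>.\<close>

definition smooth_tame :: "(real \<Rightarrow> real) \<Rightarrow> bool" where
  "smooth_tame f \<longleftrightarrow> (\<exists>g. g 0 = f \<and> (\<forall>n. tame (g n) \<and>
     (\<forall>t. (g n has_real_derivative g (Suc n) t) (at t))))"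

lemma tame_gauss: "tame (gauss a)"
  unfolding tame_def
proof (intro conjI ballI)
  show "continuous_on UNIV (gauss a)" unfolding gauss_def by (intro continuous_intros) auto
  fix z
  have "\<bar>gauss a t\<bar> \<le> exp (a * z + z\<^sup>2 / 4) * exp (- z * t)" for t
  proof -
    have "\<bar>gauss a t\<bar> = exp (- z * t) * (exp (z * t) * gauss a t)"
      using gauss_bounds by (simp add: exp_minus)
    also have "\<dots> = exp (a * z + z\<^sup>2 / 4) * exp (- z * t) * gauss (a + z / 2) t"
      unfolding exp_times_gauss by simp
    also have "\<dots> \<le> exp (a * z + z\<^sup>2 / 4) * exp (- z * t)"
      by (intro mult_left_le gauss_bounds) simp
    finally show ?thesis .
  qed
  then show "\<exists>C. \<forall>t. \<bar>gauss a t\<bar> \<le> C * exp (- z * t)" by blast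
qed

lemma smooth_tame_gauss: "smooth_tame (gauss a)"
proof -
  \<comment> \<open>Every derivative of the Gaussian is a polynomial times it; one differentiation
    takes P to P' - 2 (t - a) P.\<close>
  define P where "P n = ((\<lambda>p. pderiv p - [:- 2 * a, 2:] * p) ^^ n) 1" for n :: nat
  show ?thesis
    unfolding smooth_tame_def
  proof (intro exI[of _ "\<lambda>n t. poly (P n) t * gauss a t"] conjI allI)
    show "((\<lambda>t. poly (P n) t * gauss a t) has_real_derivative poly (P (Suc n)) t * gauss a t) (at t)" for n t
      using has_real_derivative_gauss_poly[of "P n" a t] by (simp add: P_def)
  qed (auto simp: P_def intro: tame_times_poly tame_gauss)
qed

lemma smooth_tame_imp_tame: "smooth_tame f \<Longrightarrow> tame f"
  unfolding smooth_tame_def by blast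

lemma smooth_tame_deriv:
  assumes "smooth_tame f"
  shows "smooth_tame (deriv f)" "(f has_real_derivative deriv f t) (at t)"
proof -
  obtain g where g: "g 0 = f" "\<And>n. tame (g n)" "\<And>n t. (g n has_real_derivative g (Suc n) t) (at t)"
    using assms unfolding smooth_tame_def by blast
  have d: "deriv f = g 1" using g(3)[of 0] g(1) by (auto intro!: ext DERIV_imp_deriv)
  then show "(f has_real_derivative deriv f t) (at t)" using g(3)[of 0 t] g(1) by simp
  show "smooth_tame (deriv f)" unfolding smooth_tame_def
    by (rule exI[of _ "\<lambda>n. g (Suc n)"]) (use g d in auto)
qed

lemma smooth_tame_add:
  assumes "smooth_tame f" "smooth_tame g"
  shows "smooth_tame (\<lambda>t. f t + g t)"
proof -
  obtain f' where f': "f' 0 = f" "\<And>n. tame (f' n)" "\<And>n t. (f' n has_real_derivative f' (Suc n) t) (at t)"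
    using assms(1) unfolding smooth_tame_def by blast
  obtain g' where g': "g' 0 = g" "\<And>n. tame (g' n)" "\<And>n t. (g' n has_real_derivative g' (Suc n) t) (at t)"
    using assms(2) unfolding smooth_tame_def by blast
  show ?thesis unfolding smooth_tame_def
    by (rule exI[of _ "\<lambda>n t. f' n t + g' n t"]) (use f' g' in \<open>auto intro: tame_add DERIV_add\<close>)
qed

lemma smooth_tame_cmult:
  assumes "smooth_tame f"
  shows "smooth_tame (\<lambda>t. c * f t)"
proof -
  obtain f' where f': "f' 0 = f" "\<And>n. tame (f' n)" "\<And>n t. (f' n has_real_derivative f' (Suc n) t) (at t)"
    using assms(1) unfolding smooth_tame_def by blast
  show ?thesis unfolding smooth_tame_def
    by (rule exI[of _ "\<lambda>n t. c * f' n t"]) (use f' in \<open>auto intro: tame_cmult DERIV_cmult\<close>)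
qed

text \<open>Integration by parts: \<open>g\<close> is the derivative of exp (z t) f(t), whose limits
  at both infinities are zero by two-sided decay.\<close>

lemma bilateral_deriv:
  assumes f: "smooth_tame f" and z: "z \<in> S"
  shows "bilateral (deriv f) z = - z * bilateral f z"
proof -
  define g where "g t = z * (exp (z * t) * f t) + exp (z * t) * deriv f t" for t
  have tame: "tame f" "tame (deriv f)"
    using f by (auto intro: smooth_tame_imp_tame smooth_tame_deriv)
  note int = tame_integrable[OF tame(1) z] tame_integrable[OF tame(2) z]
  have intg: "integrable lborel g"
    unfolding g_def using int by (intro Bochner_Integration.integrable_add integrable_mult_right)
  have der: "((\<lambda>t. exp (z * t) * f t) has_real_derivative g t) (at t)" for t
    unfolding g_def using smooth_tame_deriv(2)[OF f, of t]
    by (auto intro!: derivative_eq_intros)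
  obtain C \<delta> where C: "0 < \<delta>" "0 \<le> C" "\<And>t. exp (z * t) * \<bar>f t\<bar> \<le> C * exp (- \<delta> * \<bar>t\<bar>)"
    using tame_two_sided[OF tame(1) z] by metis
  have lim: "((\<lambda>t. exp (z * t) * f t) \<longlongrightarrow> 0) F" if F: "filterlim (\<lambda>t::real. \<bar>t\<bar>) at_top F" for F
  proof (rule Lim_null_comparison)
    show "\<forall>\<^sub>F t in F. norm (exp (z * t) * f t) \<le> C * exp (- \<delta> * \<bar>t\<bar>)"
      using C(3) by (simp add: abs_mult)
    have "filterlim (\<lambda>t. - \<delta> * \<bar>t\<bar>) at_bot F"
      using F C(1) by (intro filterlim_tendsto_neg_mult_at_bot[OF tendsto_const]) auto
    from filterlim_compose[OF exp_at_bot this]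
    show "((\<lambda>t. C * exp (- \<delta> * \<bar>t\<bar>)) \<longlongrightarrow> 0) F"
      by (auto intro: tendsto_mult_right_zero)
  qed
  have abs_bot: "filterlim (\<lambda>t::real. \<bar>t\<bar>) at_top at_bot"
  proof (rule filterlim_mono_eventually[OF filterlim_uminus_at_top_at_bot order_refl order_refl])
    show "\<forall>\<^sub>F t::real in at_bot. - t = \<bar>t\<bar>"
      using eventually_le_at_bot[of 0] by eventually_elim simp
  qed
  have "(LBINT t=-\<infinity>..\<infinity>. g t) = 0 - 0"
  proof (rule interval_integral_FTC_integrable[where F = "\<lambda>t. exp (z * t) * f t"])
    show "((\<lambda>t. exp (z * t) * f t) has_vector_derivative g x) (at x)" for x
      using der[of x] by (simp add: has_real_derivative_iff_has_vector_derivative)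
    show "isCont g x" for x
      unfolding g_def using tame by (intro continuous_intros tame_isCont)
    show "set_integrable lborel (einterval (- \<infinity>) \<infinity>) g"
      using intg by (simp add: set_integrable_def)
    show "(((\<lambda>t. exp (z * t) * f t) \<circ> real_of_ereal) \<longlongrightarrow> 0) (at_right (- \<infinity>))"
      by (simp add: ereal_tendsto_simps) (rule lim[OF abs_bot])
    show "(((\<lambda>t. exp (z * t) * f t) \<circ> real_of_ereal) \<longlongrightarrow> 0) (at_left \<infinity>)"
      by (simp add: ereal_tendsto_simps) (rule lim[OF filterlim_abs_real])
  qed simp
  then have "(LINT t|lborel. g t) = 0"
    by (simp add: interval_lebesgue_integral_def set_lebesgue_integral_def)
  moreover have "(LINT t|lborel. g t) = z * bilateral f z + bilateral (deriv f) z"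
    unfolding g_def bilateral_def using int by (simp add: Bochner_Integration.integral_add)
  ultimately show ?thesis by simp
qed

end

context half_line_rate
begin

lemma smooth_tame_gamma_op:
  assumes "smooth_tame f"
  shows "smooth_tame (gamma_op \<rho> d f)"
proof -
  obtain f' where f': "f' 0 = f" "\<And>n. tame (f' n)" "\<And>n t. (f' n has_real_derivative f' (Suc n) t) (at t)"
    using assms(1) unfolding smooth_tame_def by blast
  show ?thesis unfolding smooth_tame_def
    by (rule exI[of _ "\<lambda>n. gamma_op \<rho> d (f' n)"])
      (use f' in \<open>auto intro: tame_gamma_op has_real_derivative_gamma_op\<close>)
qed

end

section \<open>Monic Hermite polynomials\<close>
text \<open>The power series coefficients of exp (- z^2 / 4).\<close>

definition gauss_coeff :: "nat \<Rightarrow> real" where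
  "gauss_coeff n = (if even n then (- 1 / 4) ^ (n div 2) / fact (n div 2) else 0)"

lemma gauss_coeff_sums:
  "(\<lambda>n. gauss_coeff n * z ^ n) sums exp (- (z\<^sup>2) / 4)"
proof -
  have "(\<lambda>n. x ^ n / fact n) sums exp x" for x :: real
    using exp_converges[of x] by (simp add: divide_inverse mult.commute)
  from sums_if[OF sums_zero this[of "- (z\<^sup>2) / 4"]]
  have "(\<lambda>n. if even n then (- (z\<^sup>2) / 4) ^ (n div 2) / fact (n div 2) else 0) sums exp (- (z\<^sup>2) / 4)"
    by simp
  also have "(\<lambda>n. if even n then (- (z\<^sup>2) / 4) ^ (n div 2) / fact (n div 2) else 0) = (\<lambda>n. gauss_coeff n * z ^ n)"
  proof
    fix n
    have eq: "- (z\<^sup>2) / 4 = (- 1 / 4) * z\<^sup>2" by simp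
    have "(- (z\<^sup>2) / 4) ^ m = (- 1 / 4) ^ m * z ^ (2 * m)" for m
      unfolding eq power_mult_distrib power_mult ..
    then show "(if even n then (- (z\<^sup>2) / 4) ^ (n div 2) / fact (n div 2) else 0) = gauss_coeff n * z ^ n"
      by (simp add: gauss_coeff_def)
  qed
  finally show "(\<lambda>n. gauss_coeff n * z ^ n) sums exp (- (z\<^sup>2) / 4)" .
qed

lemma summable_norm_gauss_coeff: "summable (\<lambda>n. norm (gauss_coeff n * z ^ n))"
  by (rule powser_insidea[of _ "\<bar>z\<bar> + 1"]) (use gauss_coeff_sums in \<open>auto intro: sums_summable\<close>)

text \<open>Read off from the Cauchy product of exp (u z) and exp (- z^2 / 4); an explicit candidate
  for the definite description in \<open>monic_hermite\<close>.\<close>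

definition hermite_poly :: "nat \<Rightarrow> real poly" where
  "hermite_poly l = (\<Sum>i\<le>l. Polynomial.monom (fact l / fact i * gauss_coeff (l - i)) i)"

lemma coeff_hermite_poly:
  "Polynomial.coeff (hermite_poly l) i = (if i \<le> l then fact l / fact i * gauss_coeff (l - i) else 0)"
  by (simp add: hermite_poly_def coeff_sum if_distrib cong: if_cong)

lemma hermite_poly_sums: "(\<lambda>l. poly (hermite_poly l) u * z ^ l / fact l) sums exp (u * z - z\<^sup>2 / 4)"
proof -
  have "(\<lambda>k. \<Sum>i\<le>k. ((u * z) ^ i /\<^sub>R fact i) * (gauss_coeff (k - i) * z ^ (k - i))) sums
      ((\<Sum>k. (u * z) ^ k /\<^sub>R fact k) * (\<Sum>k. gauss_coeff k * z ^ k))"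
    using summable_norm_exp[of "u * z"] summable_norm_gauss_coeff
    by (intro Cauchy_product_sums) auto
  also have "(\<Sum>k. (u * z) ^ k /\<^sub>R fact k) = exp (u * z)"
    by (simp add: exp_def)
  also have "(\<Sum>k. gauss_coeff k * z ^ k) = exp (- (z\<^sup>2) / 4)"
    using gauss_coeff_sums by (rule sums_unique[symmetric])
  also have "exp (u * z) * exp (- (z\<^sup>2) / 4) = exp (u * z - z\<^sup>2 / 4)"
    by (simp flip: exp_add)
  also have "(\<lambda>k. \<Sum>i\<le>k. ((u * z) ^ i /\<^sub>R fact i) * (gauss_coeff (k - i) * z ^ (k - i)))
      = (\<lambda>l. poly (hermite_poly l) u * z ^ l / fact l)"
  proof
    fix k
    have "((u * z) ^ i /\<^sub>R fact i) * (gauss_coeff (k - i) * z ^ (k - i))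
        = poly (Polynomial.monom (fact k / fact i * gauss_coeff (k - i)) i) u * z ^ k / fact k" if "i \<le> k" for i
    proof -
      have "z ^ k = z ^ i * z ^ (k - i)" using that by (simp flip: power_add)
      then show ?thesis by (simp add: poly_monom power_mult_distrib divide_inverse)
    qed
    then show "(\<Sum>i\<le>k. ((u * z) ^ i /\<^sub>R fact i) * (gauss_coeff (k - i) * z ^ (k - i)))
        = poly (hermite_poly k) u * z ^ k / fact k"
      by (simp add: hermite_poly_def poly_sum sum_distrib_right sum_divide_distrib)
  qed
  finally show ?thesis .
qed

lemma powser_sums_0_imp_0:
  fixes a :: "nat \<Rightarrow> real"
  assumes s: "\<And>z. (\<lambda>n. a n * z ^ n) sums 0"
  shows "a = (\<lambda>_. 0)"
proof
  fix n
  show "a n = 0"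
  proof (cases "n = 0")
    case True
    then show ?thesis using s[of 0] powser_sums_zero_iff[of a 0] by simp
  next
    case False
    show ?thesis
    proof (rule ccontr)
      assume "a n \<noteq> 0"
      then obtain e where "0 < e" "\<And>z. z \<in> cball (0 :: real) e - {0} \<Longrightarrow> (0 :: real) \<noteq> 0"
        using powser_0_nonzero[of 1 0 a "\<lambda>_. 0" n] s False by auto
      from this(2)[of e] this(1) show False by simp
    qed
  qed
qed

text \<open>For fixed u the generating function determines its coefficients as a power series in z,
  and their values at all u determine the polynomials.\<close>

lemma monic_hermite_eq: "monic_hermite = hermite_poly"
  unfolding monic_hermite_def
proof (rule the_equality)
  fix H :: "nat \<Rightarrow> real poly"
  assume H: "\<forall>u z. (\<lambda>l. poly (H l) u * z ^ l / fact l) sums exp (u * z - z\<^sup>2 / 4)"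
  have "poly (H l) u = poly (hermite_poly l) u" for l u
  proof -
    have s1: "(\<lambda>l. poly (H l) u / fact l * z ^ l) sums exp (u * z - z\<^sup>2 / 4)" for z
      using H by simp
    have s2: "(\<lambda>l. poly (hermite_poly l) u / fact l * z ^ l) sums exp (u * z - z\<^sup>2 / 4)" for z
      using hermite_poly_sums[of u z] by simp
    have s: "(\<lambda>l. (poly (H l) u / fact l - poly (hermite_poly l) u / fact l) * z ^ l) sums 0" for z
      using sums_diff[OF s1[of z] s2[of z]] unfolding left_diff_distrib by simp
    have "(\<lambda>l. poly (H l) u / fact l - poly (hermite_poly l) u / fact l) = (\<lambda>l. 0)"
      by (rule powser_sums_0_imp_0[OF s])
    then show ?thesis by (simp add: fun_eq_iff)
  qed
  then show "H = hermite_poly" by (intro ext poly_eq_poly_eq_iff[THEN iffD1])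
qed (intro allI hermite_poly_sums)

text \<open>Coefficient form of g' = - (z / 2) g for g(z) = exp (- z^2 / 4).\<close>

lemma gauss_coeff_Suc_Suc: "real (n + 2) * gauss_coeff (n + 2) = - gauss_coeff n / 2"
proof (cases "even n")
  case True
  then obtain m where "n = 2 * m" by (auto elim: evenE)
  then show ?thesis by (simp add: gauss_coeff_def divide_simps)
qed (simp add: gauss_coeff_def)

lemma hermite_poly_0: "hermite_poly 0 = 1"
  by (simp add: hermite_poly_def gauss_coeff_def)

lemma hermite_poly_1: "hermite_poly 1 = [:0, 1:]"
proof (rule poly_eqI)
  fix i
  consider "i = 0" | "i = 1" | j where "i = Suc (Suc j)" by (metis One_nat_def not0_implies_Suc)
  then show "Polynomial.coeff (hermite_poly 1) i = Polynomial.coeff [:0, 1:] i"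
    by cases (simp_all add: coeff_hermite_poly gauss_coeff_def)
qed

lemma degree_hermite_poly: "Polynomial.degree (hermite_poly l) = l"
proof (rule antisym)
  show "Polynomial.degree (hermite_poly l) \<le> l"
    by (rule degree_le) (simp add: coeff_hermite_poly)
  show "l \<le> Polynomial.degree (hermite_poly l)"
    by (rule le_degree) (simp add: coeff_hermite_poly gauss_coeff_def)
qed

lemma coeff_hermite_poly_self: "Polynomial.coeff (hermite_poly l) l = 1"
  by (simp add: coeff_hermite_poly gauss_coeff_def)

lemma hermite_poly_Suc_Suc:
  "hermite_poly (Suc (Suc k))
    = [:0, 1:] * hermite_poly (Suc k) - Polynomial.smult (real (Suc k) / 2) (hermite_poly k)"
proof (rule poly_eqI)
  fix i
  have X: "Polynomial.coeff ([:0, 1:] * hermite_poly (Suc k)) i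
      = (case i of 0 \<Rightarrow> 0 | Suc j \<Rightarrow> Polynomial.coeff (hermite_poly (Suc k)) j)"
    by (simp add: coeff_pCons split: nat.splits)
  consider "i \<le> k" | "i = Suc k" | "i = Suc (Suc k)" | "Suc (Suc k) < i" by linarith
  then show "Polynomial.coeff (hermite_poly (Suc (Suc k))) i
    = Polynomial.coeff ([:0, 1:] * hermite_poly (Suc k) - Polynomial.smult (real (Suc k) / 2) (hermite_poly k)) i"
  proof cases
    case 1
    then obtain m where m: "k = i + m" using le_Suc_ex by blast
    \<comment> \<open>Once the common factor \<open>P * b\<close> is taken out, the identity with k
      = i + m reads (k + 2) (k + 1) = (k + 1) i + (k + 1) (m + 2).\<close>
    define P :: real where "P = fact k / fact i"
    define b where "b = gauss_coeff (m + 2)"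
    have "real (m + 2) * b = - gauss_coeff m / 2"
      using gauss_coeff_Suc_Suc[of m] unfolding b_def .
    then have b: "gauss_coeff m = - 2 * (real m + 2) * b" by (simp add: algebra_simps)
    have lhs: "Polynomial.coeff (hermite_poly (Suc (Suc k))) i = (real k + 2) * (real k + 1) * P * b"
    proof -
      have "Suc (Suc k) - i = m + 2" using m by simp
      moreover have "fact (Suc (Suc k)) / fact i = (real k + 2) * (real k + 1) * P"
        by (simp add: P_def add.commute)
      ultimately show ?thesis using 1 by (simp only: coeff_hermite_poly b_def) simp
    qed
    have mid: "Polynomial.coeff ([:0, 1:] * hermite_poly (Suc k)) i = (real k + 1) * real i * P * b"
    proof (cases i)
      case 0
      then show ?thesis unfolding X by simp
    next
      case (Suc j)
      have "Suc k - j = m + 2" "j \<le> Suc k" using Suc m by simp_all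
      moreover have "fact (Suc k) / fact j = (real k + 1) * real i * P"
        by (simp add: P_def Suc add.commute)
      ultimately show ?thesis unfolding X Suc by (simp add: coeff_hermite_poly b_def)
    qed
    have "k - i = m" using m by simp
    then have mk: "Polynomial.coeff (hermite_poly k) i = P * (- 2 * (real m + 2) * b)"
      using 1 b by (simp add: coeff_hermite_poly P_def)
    have k: "real k = real i + real m" "real (Suc k) = real i + real m + 1" using m by simp_all
    show ?thesis
      unfolding coeff_diff lhs mid coeff_smult mk k by (simp add: field_simps)
  next
    case 2
    then show ?thesis unfolding coeff_diff X by (simp add: coeff_hermite_poly gauss_coeff_def)
  next
    case 3
    then show ?thesis unfolding coeff_diff X
      by (simp add: coeff_hermite_poly gauss_coeff_def del: fact_Suc)
  next
    case 4
    then show ?thesis unfolding coeff_diff X by (auto simp: coeff_hermite_poly split: nat.splits)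
  qed
qed

section \<open>Partial fractions and the connection determinant\<close>
locale hermite_setting =
  fixes r :: nat and \<rho> d :: "nat \<Rightarrow> real" and a :: real
  assumes rho_pos: "h \<in> {1..r} \<Longrightarrow> 0 < \<rho> h" and d_ge_0: "h \<in> {1..r} \<Longrightarrow> 0 \<le> d h"
begin

text \<open>The half-line to the right of all points - rho_h; for \<open>r = 0\<close> it is the
  whole line.\<close>

definition S :: "real set" where
  "S = {z. \<forall>h\<in>{1..r}. 0 < \<rho> h + z}"

lemma S_pos: "\<lbrakk>z \<in> S; h \<in> {1..r}\<rbrakk> \<Longrightarrow> 0 < \<rho> h + z"
  by (simp add: S_def)

sublocale half_line S
proof
  have "S = (\<Inter>h\<in>{1..r}. {z. 0 < \<rho> h + z})" by (auto simp: S_def)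
  then show "open S" by (auto intro!: open_INT open_Collect_less continuous_intros)
  show "0 \<in> S" by (simp add: S_def rho_pos)
  show "w \<in> S" if "z \<in> S" "z \<le> w" for z w
    using that by (force simp: S_def)
qed

lemma rate_locale: "\<lbrakk>h \<in> {1..r}; 0 \<le> e\<rbrakk> \<Longrightarrow> half_line_rate S (\<rho> h) e"
  by (intro half_line_rate.intro half_line_axioms half_line_rate_axioms.intro) (auto simp: rho_pos S_pos)

lemma foldr_gamma_op:
  assumes "set hs \<subseteq> {1..r}" "\<And>h. h \<in> set hs \<Longrightarrow> 0 \<le> e h" "smooth_tame f"
  shows "smooth_tame (foldr (\<lambda>h. gamma_op (\<rho> h) (e h)) hs f)"
    and "z \<in> S \<Longrightarrow> bilateral (foldr (\<lambda>h. gamma_op (\<rho> h) (e h)) hs f) z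
           = (\<Prod>h\<leftarrow>hs. (\<rho> h / (\<rho> h + z)) powr e h) * bilateral f z"
proof -
  have "smooth_tame (foldr (\<lambda>h. gamma_op (\<rho> h) (e h)) hs f) \<and> (z \<in> S \<longrightarrow>
      bilateral (foldr (\<lambda>h. gamma_op (\<rho> h) (e h)) hs f) z
         = (\<Prod>h\<leftarrow>hs. (\<rho> h / (\<rho> h + z)) powr e h) * bilateral f z)"
    using assms(1,2)
  proof (induction hs)
    case (Cons h hs)
    interpret h: half_line_rate S "\<rho> h" "e h"
      using Cons.prems by (intro rate_locale) auto
    show ?case using Cons
      by (auto simp: h.bilateral_gamma_op smooth_tame_imp_tame intro!: h.smooth_tame_gamma_op)
  qed (use assms in simp)
  then show "smooth_tame (foldr (\<lambda>h. gamma_op (\<rho> h) (e h)) hs f)"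
    and "z \<in> S \<Longrightarrow> bilateral (foldr (\<lambda>h. gamma_op (\<rho> h) (e h)) hs f) z
           = (\<Prod>h\<leftarrow>hs. (\<rho> h / (\<rho> h + z)) powr e h) * bilateral f z"
    by auto
qed

lemma prod_list_upt: "(\<Prod>h\<leftarrow>[1..<r + 1]. f h) = (\<Prod>h\<in>{1..r}. f h)" for f :: "nat \<Rightarrow> real"
  by (subst prod.distinct_set_conv_list[symmetric]) (auto intro!: prod.cong)

abbreviation "F \<equiv> hermite_F r \<rho> d a"
abbreviation "U \<equiv> hermite_U r \<rho> d a"
abbreviation "L \<equiv> hermite_L r \<rho> d a"

lemma smooth_tame_F: "smooth_tame F"
  unfolding hermite_F_def by (intro foldr_gamma_op) (auto simp: d_ge_0 smooth_tame_gauss)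

text \<open>The real powers are moved into a single exponent, so that the derivative of
  \<open>L\<close> is \<open>L\<close> times the derivative of that exponent.\<close>

lemma L_eq:
  assumes "z \<in> S"
  shows "L z = exp (a * z + z\<^sup>2 / 4 + (\<Sum>h\<in>{1..r}. d h * (ln (\<rho> h) - ln (\<rho> h + z))))"
proof -
  have "L z = (\<Prod>h\<leftarrow>[1..<r + 1]. (\<rho> h / (\<rho> h + z)) powr d h) * bilateral (gauss a) z"
    unfolding hermite_L_def hermite_F_def using assms
    by (intro foldr_gamma_op) (auto simp: d_ge_0 smooth_tame_gauss)
  also have "(\<Prod>h\<leftarrow>[1..<r + 1]. (\<rho> h / (\<rho> h + z)) powr d h)
      = (\<Prod>h\<in>{1..r}. exp (d h * (ln (\<rho> h) - ln (\<rho> h + z))))"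
    unfolding prod_list_upt
  proof (rule prod.cong)
    fix h assume "h \<in> {1..r}"
    then show "(\<rho> h / (\<rho> h + z)) powr d h = exp (d h * (ln (\<rho> h) - ln (\<rho> h + z)))"
      using rho_pos[of h] S_pos[OF assms, of h] by (simp add: powr_def ln_div)
  qed simp
  finally show ?thesis
    by (simp add: bilateral_gauss exp_add exp_sum mult.commute)
qed

lemma L_pos: "z \<in> S \<Longrightarrow> 0 < L z"
  by (simp add: L_eq)

definition log_deriv :: "real \<Rightarrow> real" where
  "log_deriv z = a + z / 2 - (\<Sum>h\<in>{1..r}. d h / (\<rho> h + z))"

lemma DERIV_on_S_cong:
  assumes "\<And>z. z \<in> S \<Longrightarrow> f z = g z" "z \<in> S" "(g has_real_derivative D) (at z)"
  shows "(f has_real_derivative D) (at z)"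
  using has_field_derivative_transform_within_open[OF assms(3) open_S assms(2)] assms(1) by simp

lemma has_real_derivative_L:
  assumes z: "z \<in> S"
  shows "(L has_real_derivative L z * log_deriv z) (at z)"
proof (rule DERIV_on_S_cong[OF L_eq z])
  have "((\<lambda>z. \<Sum>h\<in>{1..r}. d h * (ln (\<rho> h) - ln (\<rho> h + z))) has_real_derivative
      (\<Sum>h\<in>{1..r}. - (d h / (\<rho> h + z)))) (at z)"
  proof (rule DERIV_sum)
    fix h assume "h \<in> {1..r}"
    then show "((\<lambda>z. d h * (ln (\<rho> h) - ln (\<rho> h + z))) has_real_derivative - (d h / (\<rho> h + z))) (at z)"
      using S_pos[OF z, of h] by (auto intro!: derivative_eq_intros simp: field_simps)
  qed
  moreover have "((\<lambda>z. a * z + z\<^sup>2 / 4) has_real_derivative a + z / 2) (at z)"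
    by (auto intro!: derivative_eq_intros)
  ultimately have "((\<lambda>z. a * z + z\<^sup>2 / 4 + (\<Sum>h\<in>{1..r}. d h * (ln (\<rho> h) - ln (\<rho> h + z)))) has_real_derivative
      a + z / 2 + (\<Sum>h\<in>{1..r}. - (d h / (\<rho> h + z)))) (at z)"
    by (rule DERIV_add[rotated])
  then have "((\<lambda>z. exp (a * z + z\<^sup>2 / 4 + (\<Sum>h\<in>{1..r}. d h * (ln (\<rho> h) - ln (\<rho> h + z))))) has_real_derivative
      exp (a * z + z\<^sup>2 / 4 + (\<Sum>h\<in>{1..r}. d h * (ln (\<rho> h) - ln (\<rho> h + z)))) * (a + z / 2 + (\<Sum>h\<in>{1..r}. - (d h / (\<rho> h + z))))) (at z)"
    by (rule DERIV_fun_exp)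
  then show "((\<lambda>z. exp (a * z + z\<^sup>2 / 4 + (\<Sum>h\<in>{1..r}. d h * (ln (\<rho> h) - ln (\<rho> h + z))))) has_real_derivative
      L z * log_deriv z) (at z)"
    by (simp only: L_eq[OF z] log_deriv_def sum_negf diff_conv_add_uminus)
qed

lemma smooth_tame_U:
  assumes "1 \<le> j"
  shows "smooth_tame (U j)"
proof (cases "j \<le> r")
  case True
  then interpret h: half_line_rate S "\<rho> j" 1
    using assms by (intro rate_locale) auto
  show ?thesis using True by (auto simp: hermite_U_def intro: h.smooth_tame_gamma_op smooth_tame_F)
qed (simp add: hermite_U_def smooth_tame_F)

lemma tame_U: "1 \<le> j \<Longrightarrow> tame (U j)"
  by (intro smooth_tame_imp_tame smooth_tame_U)

lemma bilateral_U:
  assumes "1 \<le> j" "z \<in> S"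
  shows "bilateral (U j) z = row_transform r \<rho> d a j z"
proof (cases "j \<le> r")
  case True
  then interpret h: half_line_rate S "\<rho> j" 1
    using assms by (intro rate_locale) auto
  have "0 < \<rho> j" "0 < \<rho> j + z" using True assms by (auto intro!: rho_pos S_pos)
  then show ?thesis
    using True h.bilateral_gamma_op[OF smooth_tame_imp_tame[OF smooth_tame_F] assms(2)]
    by (simp add: hermite_U_def row_transform_def hermite_L_def)
qed (simp add: hermite_U_def row_transform_def hermite_L_def)

lemma poly_deriv_op_row_transform:
  assumes "1 \<le> j" "z \<in> S"
  shows "poly_deriv_op P (row_transform r \<rho> d a j) z = bilateral (\<lambda>t. poly P t * U j t) z"
proof -
  have "(deriv ^^ l) (row_transform r \<rho> d a j) z = (deriv ^^ l) (bilateral (U j)) z" for l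
  proof (rule higher_deriv_cong_ev)
    show "\<forall>\<^sub>F w in nhds z. row_transform r \<rho> d a j w = bilateral (U j) w"
      using open_S assms bilateral_U[OF assms(1)] by (auto simp: eventually_nhds)
  qed simp
  then have "poly_deriv_op P (row_transform r \<rho> d a j) z = poly_deriv_op P (bilateral (U j)) z"
    by (simp add: poly_deriv_op_def)
  then show ?thesis using poly_deriv_op_bilateral[OF tame_U[OF assms(1)] assms(2)] by simp
qed

text \<open>The connection polynomial before the denominator D is cleared; the operator H_k(d/dz)
  appears here as multiplication by H_k(t) under the integral.\<close>

definition G :: "nat \<Rightarrow> nat \<Rightarrow> real \<Rightarrow> real" where
  "G j k z = bilateral (\<lambda>t. poly (hermite_poly k) t * U j t) z / L z"

text \<open>The members of \<open>pf_basis\<close> divided by the common denominator, as functions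
  on \<open>S\<close>.\<close>

definition pf_fun :: "nat \<times> nat \<Rightarrow> real \<Rightarrow> real" where
  "pf_fun = (\<lambda>(j, k) z. if j \<le> r then 1 / (\<rho> j + z) ^ Suc k else z ^ k)"

lemma G_0:
  assumes "1 \<le> j" "z \<in> S"
  shows "G j 0 z = (if j \<le> r then \<rho> j else 1) * pf_fun (j, 0) z"
  using L_pos[OF assms(2)] bilateral_U[OF assms]
  by (simp add: G_def hermite_poly_0 row_transform_def pf_fun_def)

lemma has_real_derivative_G:
  assumes j: "1 \<le> j" and z: "z \<in> S"
  shows "(G j k has_real_derivative
     bilateral (\<lambda>t. poly ([:0, 1:] * hermite_poly k) t * U j t) z / L z - log_deriv z * G j k z) (at z)"
proof -
  have "(bilateral (\<lambda>t. poly (hermite_poly k) t * U j t) has_real_derivative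
      bilateral (\<lambda>t. t * (poly (hermite_poly k) t * U j t)) z) (at z)"
    using j z by (intro has_real_derivative_bilateral tame_times_poly tame_U)
  from DERIV_divide[OF this has_real_derivative_L[OF z]] L_pos[OF z]
  have "(G j k has_real_derivative
      (bilateral (\<lambda>t. t * (poly (hermite_poly k) t * U j t)) z * L z
        - bilateral (\<lambda>t. poly (hermite_poly k) t * U j t) z * (L z * log_deriv z)) / (L z * L z)) (at z)"
    by (simp add: G_def[abs_def])
  then show ?thesis
    by (rule DERIV_cong) (use L_pos[OF z] in \<open>simp add: G_def field_simps\<close>)
qed

text \<open>Multiplying the integrand by t differentiates the transform, the quotient rule for
  division by \<open>L\<close> contributes \<open>log_deriv\<close>, and the three-term recursion
  adds the last summand. For \<open>k = 0\<close> the index \<open>k - 1\<close> is 0 and its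
  coefficient vanishes.\<close>

lemma G_Suc:
  assumes j: "1 \<le> j" and z: "z \<in> S" and D: "(G j k has_real_derivative D) (at z)"
  shows "G j (Suc k) z = D + log_deriv z * G j k z - real k / 2 * G j (k - 1) z"
proof -
  have D_eq: "D + log_deriv z * G j k z = bilateral (\<lambda>t. poly ([:0, 1:] * hermite_poly k) t * U j t) z / L z"
    using DERIV_unique[OF D has_real_derivative_G[OF j z]] by simp
  have "poly (hermite_poly (Suc k)) t * U j t
      = poly ([:0, 1:] * hermite_poly k) t * U j t + (- (real k / 2)) * (poly (hermite_poly (k - 1)) t * U j t)" for t
    by (cases k) (simp_all add: hermite_poly_0 hermite_poly_1[simplified] hermite_poly_Suc_Suc algebra_simps del: of_nat_Suc)
  then have "bilateral (\<lambda>t. poly (hermite_poly (Suc k)) t * U j t) z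
      = bilateral (\<lambda>t. poly ([:0, 1:] * hermite_poly k) t * U j t) z
        + (- (real k / 2)) * bilateral (\<lambda>t. poly (hermite_poly (k - 1)) t * U j t) z"
    using j z by (simp only: bilateral_add bilateral_cmult tame_cmult tame_times_poly tame_U)
  then show ?thesis
    unfolding D_eq unfolding G_def by (simp add: diff_divide_distrib)
qed

end

context hermite_setting
begin

text \<open>Poles of order at most \<open>k\<close> at every \<open>- \<rho>\<^sub>h\<close> and polynomial part of degree less than \<open>k\<close>.\<close>
definition level :: "nat \<Rightarrow> (real \<Rightarrow> real) \<Rightarrow> bool" where
  "level k f \<longleftrightarrow> (\<exists>c. \<forall>z\<in>S. f z = (\<Sum>b\<in>{1..r + 1} \<times> {..<k}. c b * pf_fun b z))"

lemma level_zero: "level k (\<lambda>z. 0)"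
  unfolding level_def by (rule exI[of _ "\<lambda>_. 0"]) simp

lemma level_cong: "\<lbrakk>\<And>z. z \<in> S \<Longrightarrow> f z = g z; level k g\<rbrakk> \<Longrightarrow> level k f"
  unfolding level_def by auto

lemma level_add:
  assumes "level k f" "level k g"
  shows "level k (\<lambda>z. f z + g z)"
proof -
  obtain c1 where c1: "\<forall>z\<in>S. f z = (\<Sum>b\<in>{1..r + 1} \<times> {..<k}. c1 b * pf_fun b z)"
    using assms(1) unfolding level_def by blast
  obtain c2 where c2: "\<forall>z\<in>S. g z = (\<Sum>b\<in>{1..r + 1} \<times> {..<k}. c2 b * pf_fun b z)"
    using assms(2) unfolding level_def by blast
  show ?thesis unfolding level_def
    by (rule exI[of _ "\<lambda>b. c1 b + c2 b"]) (simp add: c1 c2 distrib_right sum.distrib)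
qed

lemma level_cmult:
  assumes "level k f"
  shows "level k (\<lambda>z. x * f z)"
proof -
  obtain c where c: "\<forall>z\<in>S. f z = (\<Sum>b\<in>{1..r + 1} \<times> {..<k}. c b * pf_fun b z)"
    using assms(1) unfolding level_def by blast
  show ?thesis unfolding level_def
    by (rule exI[of _ "\<lambda>b. x * c b"]) (simp add: c sum_distrib_left mult.assoc)
qed

lemma level_sum: "(\<And>i. i \<in> I \<Longrightarrow> level k (f i)) \<Longrightarrow> level k (\<lambda>z. \<Sum>i\<in>I. f i z)"
  by (induction I rule: infinite_finite_induct) (auto intro: level_zero level_add)

lemma level_pf_fun:
  assumes "b \<in> {1..r + 1} \<times> {..<k}"
  shows "level k (pf_fun b)"
  unfolding level_def
  by (rule exI[of _ "\<lambda>b'. if b' = b then 1 else 0"])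
    (use assms in \<open>simp add: if_distrib[of "\<lambda>x. x * _"] cong: if_cong\<close>)

lemma level_mono:
  assumes "level k f" "k \<le> l"
  shows "level l f"
proof -
  obtain c where c: "\<forall>z\<in>S. f z = (\<Sum>b\<in>{1..r + 1} \<times> {..<k}. c b * pf_fun b z)"
    using assms(1) unfolding level_def by blast
  show ?thesis
  proof (rule level_cong)
    show "f z = (\<Sum>b\<in>{1..r + 1} \<times> {..<k}. c b * pf_fun b z)" if "z \<in> S" for z
      using c that by blast
    show "level l (\<lambda>z. \<Sum>b\<in>{1..r + 1} \<times> {..<k}. c b * pf_fun b z)"
      using assms(2) by (intro level_sum level_cmult level_pf_fun) auto
  qed
qed

lemma level_pole: "\<lbrakk>h \<in> {1..r}; i < k\<rbrakk> \<Longrightarrow> level k (\<lambda>z. 1 / (\<rho> h + z) ^ Suc i)"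
  using level_pf_fun[of "(h, i)" k] by (simp add: pf_fun_def)

lemma level_power: "i < k \<Longrightarrow> level k (\<lambda>z. z ^ i)"
  using level_pf_fun[of "(r + 1, i)" k] by (simp add: pf_fun_def)

lemma S_nonzero: "\<lbrakk>z \<in> S; h \<in> {1..r}\<rbrakk> \<Longrightarrow> \<rho> h + z \<noteq> 0"
  using S_pos by force

text \<open>With x = rho_h' + z and y = rho_h + z the difference y - x is a nonzero constant, and 1
  / (x y) = (1/x - 1/y) / (y - x) lowers the order of the multiple pole by one; no order above
  \<open>Suc i\<close> arises.\<close>

lemma level_two_poles:
  assumes h: "h \<in> {1..r}" "h' \<in> {1..r}" and ne: "\<rho> h \<noteq> \<rho> h'"
  shows "level (Suc i) (\<lambda>z. 1 / (\<rho> h' + z) * (1 / (\<rho> h + z) ^ Suc i))"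
proof (induction i)
  case 0
  show ?case
  proof (rule level_cong)
    show "level (Suc 0) (\<lambda>z. 1 / (\<rho> h - \<rho> h') * (1 / (\<rho> h' + z) ^ Suc 0 + (- 1) * (1 / (\<rho> h + z) ^ Suc 0)))"
      using h by (intro level_cmult level_add level_pole) auto
    show "1 / (\<rho> h' + z) * (1 / (\<rho> h + z) ^ Suc 0)
        = 1 / (\<rho> h - \<rho> h') * (1 / (\<rho> h' + z) ^ Suc 0 + (- 1) * (1 / (\<rho> h + z) ^ Suc 0))" if "z \<in> S" for z
      using S_nonzero[OF that h(1)] S_nonzero[OF that h(2)] ne by (simp add: divide_simps)
  qed
next
  case (Suc i)
  show ?case
  proof (rule level_cong)
    show "level (Suc (Suc i)) (\<lambda>z. 1 / (\<rho> h - \<rho> h') * (1 / (\<rho> h' + z) * (1 / (\<rho> h + z) ^ Suc i) + (- 1) * (1 / (\<rho> h + z) ^ Suc (Suc i))))"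
      using h by (intro level_cmult level_add level_pole level_mono[OF Suc.IH]) auto
    show "1 / (\<rho> h' + z) * (1 / (\<rho> h + z) ^ Suc (Suc i))
        = 1 / (\<rho> h - \<rho> h') * (1 / (\<rho> h' + z) * (1 / (\<rho> h + z) ^ Suc i) + (- 1) * (1 / (\<rho> h + z) ^ Suc (Suc i)))" if "z \<in> S" for z
    proof -
      define x y P where "x = \<rho> h' + z" and "y = \<rho> h + z" and "P = y ^ Suc i"
      have "x \<noteq> 0" "y \<noteq> 0" "P \<noteq> 0" "y - x \<noteq> 0"
        using S_nonzero[OF that h(1)] S_nonzero[OF that h(2)] ne by (simp_all add: x_def y_def P_def)
      then have "1 / x * (1 / (y * P)) = 1 / (y - x) * (1 / x * (1 / P) + (- 1) * (1 / (y * P)))"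
        by (simp add: field_simps)
      then show ?thesis by (simp add: x_def y_def P_def)
    qed
  qed
qed

text \<open>Division with remainder, one step at a time, by z = (rho_h + z) - rho_h.\<close>

lemma level_power_pole:
  assumes h: "h \<in> {1..r}"
  shows "level (Suc i) (\<lambda>z. 1 / (\<rho> h + z) * z ^ i)"
proof (induction i)
  case 0
  then show ?case using level_pole[OF h, of 0 1] by simp
next
  case (Suc i)
  show ?case
  proof (rule level_cong)
    show "level (Suc (Suc i)) (\<lambda>z. z ^ i + (- \<rho> h) * (1 / (\<rho> h + z) * z ^ i))"
      by (intro level_cmult level_add level_power level_mono[OF Suc.IH]) auto
    show "1 / (\<rho> h + z) * z ^ Suc i = z ^ i + (- \<rho> h) * (1 / (\<rho> h + z) * z ^ i)" if "z \<in> S" for z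
      using S_nonzero[OF that h] by (simp add: field_simps)
  qed
qed

definition pf_deriv :: "nat \<times> nat \<Rightarrow> real \<Rightarrow> real" where
  "pf_deriv = (\<lambda>(j, k) z. if j \<le> r then - real (Suc k) * (1 / (\<rho> j + z) ^ Suc (Suc k))
     else real k * z ^ (k - 1))"

lemma has_real_derivative_pf_fun:
  assumes b: "b \<in> {1..r + 1} \<times> UNIV" and z: "z \<in> S"
  shows "(pf_fun b has_real_derivative pf_deriv b z) (at z)"
proof -
  obtain j k where jk: "b = (j, k)" by (cases b)
  show ?thesis
  proof (cases "j \<le> r")
    case True
    then have nz: "\<rho> j + z \<noteq> 0" using b jk S_nonzero[OF z, of j] by auto
    have "((\<lambda>z. (\<rho> j + z) ^ Suc k) has_real_derivative real (Suc k) * (\<rho> j + z) ^ k) (at z)"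
      by (auto intro!: derivative_eq_intros simp del: power_Suc)
    from DERIV_inverse'[OF this] nz
    have "((\<lambda>z. inverse ((\<rho> j + z) ^ Suc k)) has_real_derivative
        - (inverse ((\<rho> j + z) ^ Suc k) * (real (Suc k) * (\<rho> j + z) ^ k) * inverse ((\<rho> j + z) ^ Suc k))) (at z)"
      by (simp del: power_Suc)
    moreover have "- (inverse (y ^ Suc k) * (real (Suc k) * y ^ k) * inverse (y ^ Suc k))
        = - real (Suc k) * (1 / y ^ Suc (Suc k))" if "y \<noteq> 0" for y :: real
      using that by (simp add: field_simps del: of_nat_Suc)
    note this[OF nz]
    ultimately show ?thesis
      using True by (simp only: jk pf_fun_def pf_deriv_def prod.case if_True inverse_eq_divide)
  next
    case False
    then show ?thesis using DERIV_pow[of k z] by (simp add: jk pf_fun_def pf_deriv_def)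
  qed
qed

text \<open>For a pole of order k + 1 at - rho_j, differentiation contributes - (k + 1) and the pole
  of L'/L at the same place contributes - d_j. For a monomial the value 1/2 is the slope of L'/L at
  infinity.\<close>

definition growth :: "nat \<Rightarrow> nat \<Rightarrow> real" where
  "growth j k = (if j \<le> r then - (d j + 1 + real k) else 1 / 2)"

text \<open>Differentiation conjugated by \<open>L\<close> is \<open>f \<mapsto> f' + (L'/L) f\<close>; it raises the level by one, with leading
  coefficient \<open>growth\<close>.\<close>
lemma level_raise_pf_fun:
  assumes j: "j \<in> {1..r + 1}" and inj: "inj_on \<rho> {1..r}"
  shows "level (Suc k) (\<lambda>z. pf_deriv (j, k) z + log_deriv z * pf_fun (j, k) z
     - growth j k * pf_fun (j, Suc k) z)"
proof (cases "j \<le> r")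
  case True
  then have h: "j \<in> {1..r}" using j by simp
  \<comment> \<open>The summand z/2 of \<open>log_deriv\<close> does not raise the order of a pole:
    z = (rho_j + z) - rho_j cancels one factor, leaving a constant when
    \<open>k = 0\<close>.\<close>
  have half: "level (Suc k) (\<lambda>z. z * (1 / (\<rho> j + z) ^ Suc k))"
  proof (cases k)
    case 0
    have "level (Suc k) (\<lambda>z. z ^ 0 + (- \<rho> j) * (1 / (\<rho> j + z) ^ Suc k))"
      using h by (intro level_add level_cmult level_pole level_power) auto
    then show ?thesis
      by (rule level_cong[rotated]) (use 0 S_nonzero[OF _ h] in \<open>auto simp: field_simps\<close>)
  next
    case (Suc i)
    have "level (Suc k) (\<lambda>z. 1 / (\<rho> j + z) ^ Suc i + (- \<rho> j) * (1 / (\<rho> j + z) ^ Suc k))"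
      using h Suc by (intro level_add level_cmult level_pole level_power) auto
    then show ?thesis
    proof (rule level_cong[rotated])
      fix z assume "z \<in> S"
      have "(y - \<rho> j) * (1 / (y * P)) = 1 / P + (- \<rho> j) * (1 / (y * P))" if "y \<noteq> 0" "P \<noteq> 0" for y P
        using that by (simp add: field_simps)
      from this[of "\<rho> j + z" "(\<rho> j + z) ^ Suc i"] S_nonzero[OF \<open>z \<in> S\<close> h]
      show "z * (1 / (\<rho> j + z) ^ Suc k) = 1 / (\<rho> j + z) ^ Suc i + (- \<rho> j) * (1 / (\<rho> j + z) ^ Suc k)"
        by (simp add: Suc)
    qed
  qed
  have "level (Suc k) (\<lambda>z. a * (1 / (\<rho> j + z) ^ Suc k) + 1 / 2 * (z * (1 / (\<rho> j + z) ^ Suc k))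
      + (\<Sum>h\<in>{1..r} - {j}. (- d h) * (1 / (\<rho> h + z) * (1 / (\<rho> j + z) ^ Suc k))))"
  proof (intro level_add level_cmult level_sum half)
    show "level (Suc k) (\<lambda>z. 1 / (\<rho> j + z) ^ Suc k)" using h by (intro level_pole) auto
    show "level (Suc k) (\<lambda>z. 1 / (\<rho> h' + z) * (1 / (\<rho> j + z) ^ Suc k))" if "h' \<in> {1..r} - {j}" for h'
      using that h inj by (intro level_two_poles) (auto dest: inj_onD)
  qed
  then show ?thesis
  proof (rule level_cong[rotated])
    fix z assume z: "z \<in> S"
    define P w where "P = 1 / (\<rho> j + z) ^ Suc k" and "w = 1 / (\<rho> j + z)"
    \<comment> \<open>Only the summand with h = j raises the pole order; together with the
      differentiated pole it makes up \<open>growth\<close>.\<close>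
    have split: "(\<Sum>h\<in>{1..r}. d h / (\<rho> h + z)) = d j * w + (\<Sum>h\<in>{1..r} - {j}. d h / (\<rho> h + z))"
      using h by (subst sum.remove[of _ j]) (auto simp: w_def)
    have pole: "1 / (\<rho> j + z) ^ Suc (Suc k) = w * P" by (simp add: P_def w_def)
    have "(\<Sum>h\<in>{1..r} - {j}. (- d h) * (1 / (\<rho> h + z) * P)) = - (\<Sum>h\<in>{1..r} - {j}. d h / (\<rho> h + z)) * P"
      by (simp add: sum_distrib_right sum_negf)
    then show "pf_deriv (j, k) z + log_deriv z * pf_fun (j, k) z - growth j k * pf_fun (j, Suc k) z
        = a * (1 / (\<rho> j + z) ^ Suc k) + 1 / 2 * (z * (1 / (\<rho> j + z) ^ Suc k))
      + (\<Sum>h\<in>{1..r} - {j}. (- d h) * (1 / (\<rho> h + z) * (1 / (\<rho> j + z) ^ Suc k)))"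
      using True unfolding pf_deriv_def pf_fun_def growth_def log_deriv_def split prod.case pole P_def[symmetric]
      by (simp add: algebra_simps add_divide_distrib)
  qed
next
  case False
  then have j: "j = r + 1" using j by simp
  \<comment> \<open>The summand z/2 of \<open>log_deriv\<close> is absent here: times z^k it is
    exactly the subtracted leading term.\<close>
  have "level (Suc k) (\<lambda>z. real k * z ^ (k - 1) + a * z ^ k + (\<Sum>h\<in>{1..r}. (- d h) * (1 / (\<rho> h + z) * z ^ k)))"
    by (intro level_add level_cmult level_sum level_power level_power_pole) auto
  then show ?thesis
  proof (rule level_cong[rotated])
    fix z
    have "(\<Sum>h\<in>{1..r}. (- d h) * (1 / (\<rho> h + z) * z ^ k)) = - (\<Sum>h\<in>{1..r}. d h / (\<rho> h + z)) * z ^ k"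
      by (simp add: sum_distrib_right sum_negf)
    then show "pf_deriv (j, k) z + log_deriv z * pf_fun (j, k) z - growth j k * pf_fun (j, Suc k) z
       = real k * z ^ (k - 1) + a * z ^ k + (\<Sum>h\<in>{1..r}. (- d h) * (1 / (\<rho> h + z) * z ^ k))"
      by (simp add: j pf_deriv_def pf_fun_def growth_def log_deriv_def algebra_simps)
  qed
qed

lemma level_raise:
  assumes f: "level k f" and inj: "inj_on \<rho> {1..r}"
    and f': "\<And>z. z \<in> S \<Longrightarrow> (f has_real_derivative f' z) (at z)"
  shows "level (Suc k) (\<lambda>z. f' z + log_deriv z * f z)"
proof -
  let ?B = "{1..r + 1} \<times> {..<k}"
  obtain c where c: "\<And>z. z \<in> S \<Longrightarrow> f z = (\<Sum>b\<in>?B. c b * pf_fun b z)"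
    using f unfolding level_def by blast
  have raise: "level (Suc k) (\<lambda>z. pf_deriv b z + log_deriv z * pf_fun b z)" if b_in: "b \<in> ?B" for b
  proof -
    obtain j i where b: "b = (j, i)" "j \<in> {1..r + 1}" "i < k" using b_in by auto
    have "level (Suc k) (\<lambda>z. (pf_deriv (j, i) z + log_deriv z * pf_fun (j, i) z
        - growth j i * pf_fun (j, Suc i) z) + growth j i * pf_fun (j, Suc i) z)"
      using b by (intro level_add level_cmult level_pf_fun level_mono[OF level_raise_pf_fun[OF b(2) inj]]) auto
    then show ?thesis by (simp add: b)
  qed
  have "level (Suc k) (\<lambda>z. \<Sum>b\<in>?B. c b * (pf_deriv b z + log_deriv z * pf_fun b z))"
    by (intro level_sum level_cmult raise)
  then show ?thesis
  proof (rule level_cong[rotated])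
    fix z assume z: "z \<in> S"
    have "((\<lambda>z. \<Sum>b\<in>?B. c b * pf_fun b z) has_real_derivative (\<Sum>b\<in>?B. c b * pf_deriv b z)) (at z)"
      using z by (intro DERIV_sum DERIV_cmult has_real_derivative_pf_fun) auto
    from DERIV_unique[OF DERIV_on_S_cong[OF c z this] f'[OF z]]
    show "f' z + log_deriv z * f z = (\<Sum>b\<in>?B. c b * (pf_deriv b z + log_deriv z * pf_fun b z))"
      using c[OF z] by (simp add: sum.distrib sum_distrib_left algebra_simps)
  qed
qed

text \<open>The product of \<open>growth j i\<close> over \<open>i < k\<close>, times the
  coefficient of \<open>pf_fun (j, 0)\<close> in \<open>G j 0\<close>.\<close>

definition lead :: "nat \<Rightarrow> nat \<Rightarrow> real" where
  "lead j k = (if j \<le> r then \<rho> j * (- 1) ^ k * pochhammer (d j + 1) k else 1 / 2 ^ k)"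

lemma lead_Suc: "lead j (Suc k) = growth j k * lead j k"
  by (simp add: lead_def growth_def pochhammer_Suc algebra_simps)

text \<open>Strong induction, because the Hermite recursion reaches back two levels. At level 0 the
  quotient is already a single pole or a constant; products of poles, and with them distinct rates,
  enter from level 1 on.\<close>

lemma level_G:
  assumes j: "j \<in> {1..r + 1}" and "k = 0 \<or> inj_on \<rho> {1..r}"
  shows "level k (\<lambda>z. G j k z - lead j k * pf_fun (j, k) z)"
  using assms(2)
proof (induction k rule: less_induct)
  case (less k)
  show ?case
  proof (cases k)
    case 0
    show ?thesis
      by (rule level_cong[OF _ level_zero]) (use j in \<open>auto simp: 0 G_0 lead_def\<close>)
  next
    case (Suc i)
    then have inj: "inj_on \<rho> {1..r}" using less.prems by simp
    have IH: "level i (\<lambda>z. G j i z - lead j i * pf_fun (j, i) z)"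
      using less.IH[of i] Suc inj by simp
    define G' where "G' z = bilateral (\<lambda>t. poly ([:0, 1:] * hermite_poly i) t * U j t) z / L z - log_deriv z * G j i z" for z
    have G': "(G j i has_real_derivative G' z) (at z)" if "z \<in> S" for z
      unfolding G'_def using j that by (intro has_real_derivative_G) auto
    have 1: "level (Suc i) (\<lambda>z. (G' z - lead j i * pf_deriv (j, i) z)
        + log_deriv z * (G j i z - lead j i * pf_fun (j, i) z))"
      using j by (intro level_raise[OF IH inj] DERIV_diff DERIV_cmult has_real_derivative_pf_fun G') auto
    have 2: "level (Suc i) (\<lambda>z. lead j i * (pf_deriv (j, i) z + log_deriv z * pf_fun (j, i) z
        - growth j i * pf_fun (j, Suc i) z))"
      by (intro level_cmult level_raise_pf_fun j inj)
    \<comment> \<open>The contribution of \<open>G j (i - 1)\<close> consists of terms below level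
      \<open>Suc i\<close>, so it leaves the leading coefficient alone.\<close>
    have 3: "level (Suc i) (\<lambda>z. - (real i / 2) * G j (i - 1) z)"
    proof (cases i)
      case 0
      then show ?thesis by (simp add: level_zero)
    next
      case (Suc l)
      have "level (Suc i) (\<lambda>z. (G j l z - lead j l * pf_fun (j, l) z) + lead j l * pf_fun (j, l) z)"
        using less.IH[of l] Suc \<open>k = Suc i\<close> inj j
        by (intro level_add level_cmult level_pf_fun level_mono[of l _ "Suc i"]) auto
      then have "level (Suc i) (G j l)" by simp
      then show ?thesis unfolding Suc diff_Suc_1 using Suc by (intro level_cmult) simp
    qed
    show ?thesis unfolding Suc
    proof (rule level_cong[OF _ level_add[OF level_add[OF 1 2] 3]])
      fix z assume z: "z \<in> S"
      show "G j (Suc i) z - lead j (Suc i) * pf_fun (j, Suc i) z =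
         G' z - lead j i * pf_deriv (j, i) z + log_deriv z * (G j i z - lead j i * pf_fun (j, i) z)
         + lead j i * (pf_deriv (j, i) z + log_deriv z * pf_fun (j, i) z - growth j i * pf_fun (j, Suc i) z)
         + - (real i / 2) * G j (i - 1) z"
        using G_Suc[OF _ z G'[OF z]] j by (simp add: lead_Suc algebra_simps)
    qed
  qed
qed

end

lemma prod_power_lessThan: "(\<Prod>k<n. x ^ k) = x ^ (n choose 2)" for x :: real
  by (induction n) (simp_all add: choose_Suc_2 power_add numeral_2_eq_2)

lemma prod_lex_index:
  "(\<Prod>x<index_weight k v. f (lex_index k v ! x)) = (\<Prod>i\<in>{1..k}. \<Prod>l<v i. f (i, l))"
  for f :: "nat \<times> nat \<Rightarrow> real"
proof -
  have "(\<Prod>x<index_weight k v. f (lex_index k v ! x)) = (\<Prod>b\<in>set (lex_index k v). f b)"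
    by (rule prod.reindex_bij_betw) (simp add: bij_betw_nth distinct_lex_index length_lex_index)
  also have "set (lex_index k v) = Sigma {1..k} (\<lambda>i. {..<v i})"
    by (auto simp: set_lex_index)
  also have "(\<Prod>b\<in>Sigma {1..k} (\<lambda>i. {..<v i}). f b) = (\<Prod>i\<in>{1..k}. \<Prod>l<v i. f (i, l))"
    by (simp add: prod.Sigma)
  finally show ?thesis .
qed

lemma sum_lex_index:
  "(\<Sum>x\<in>{0..<index_weight k v}. f (lex_index k v ! x)) = (\<Sum>b\<in>set (lex_index k v). f b)"
  for f :: "nat \<times> nat \<Rightarrow> real"
  by (rule sum.reindex_bij_betw) (simp add: bij_betw_nth distinct_lex_index length_lex_index lessThan_atLeast0[symmetric])

section \<open>The connection determinant of a near-diagonal index\<close>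

locale hermite_index = hermite_setting +
  fixes lam :: "nat \<Rightarrow> nat"
  assumes near_diagonal: "\<lbrakk>j \<in> {1..r + 1}; j' \<in> {1..r + 1}\<rbrakk> \<Longrightarrow> lam j \<le> lam j' + 1"
    and weight_pos: "1 \<le> index_weight (r + 1) lam"
    and distinct_rates: "inj_on \<rho> {h \<in> {1..r}. 0 < lam h}"
begin

abbreviation "N \<equiv> index_weight (r + 1) lam"
abbreviation "idx \<equiv> lex_index (r + 1) lam"

text \<open>If \<open>0 < k < lam j\<close>, then \<open>lam j\<close> is at least 2, so every
  \<open>lam h\<close> is at least 1 and the distinctness hypothesis covers all rates.\<close>

lemma idx_level_0_or_inj:
  assumes "(j, k) \<in> set idx"
  shows "k = 0 \<or> inj_on \<rho> {1..r}"
proof (cases "k = 0")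
  case False
  have "0 < lam h" if "h \<in> {1..r}" for h
    using near_diagonal[of j h] assms that False by (simp add: set_lex_index)
  then have "{h \<in> {1..r}. 0 < lam h} = {1..r}" by auto
  with distinct_rates show ?thesis by simp
qed simp

text \<open>l < k < lam j <= lam i + 1 gives l < lam i. Through this closure of the index set under
  lower levels the near-diagonal shape enters the triangular factorisation.\<close>

lemma lower_level_idx:
  assumes "(j, k) \<in> set idx"
  shows "{1..r + 1} \<times> {..<k} \<subseteq> set idx"
proof
  fix b assume "b \<in> {1..r + 1} \<times> {..<k}"
  then obtain i l where b: "b = (i, l)" "i \<in> {1..r + 1}" "l < k" by auto
  then show "b \<in> set idx" using assms near_diagonal[of j i] by (simp add: set_lex_index)
qed

lemma infinite_S: "infinite S"
proof
  assume "finite S"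
  moreover have "{0..} \<subseteq> S" using up_S[OF zero_S] by auto
  ultimately show False using infinite_Ici[of "0 :: real"] finite_subset by blast
qed

lemma poly_eq_on_S:
  assumes "\<And>z. z \<in> S \<Longrightarrow> poly P z = poly Q z"
  shows "P = Q"
proof (rule ccontr)
  assume "P \<noteq> Q"
  then have "finite {z. poly (P - Q) z = 0}" by (intro poly_roots_finite) simp
  moreover have "S \<subseteq> {z. poly (P - Q) z = 0}" using assms by auto
  ultimately show False using infinite_S finite_subset by blast
qed

lemma degree_pf_basis:
  assumes "b \<in> set idx"
  shows "Polynomial.degree (pf_basis r \<rho> lam b) \<le> N - 1"
proof -
  obtain j k where b: "b = (j, k)" by (cases b)
  have N: "N = index_weight r lam + lam (r + 1)" by (simp add: index_weight_Suc)
  show ?thesis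
  proof (cases "j \<le> r")
    case True
    then show ?thesis using degree_pf_basis_pole[of j r k lam \<rho>] assms b N by (simp add: set_lex_index)
  next
    case False
    have "Polynomial.degree (pf_basis r \<rho> lam b) \<le> k + index_weight r lam"
      using False degree_mult_le[of "Polynomial.monom 1 k" "rate_product r \<rho> lam"]
      by (simp add: b pf_basis_def degree_monom_eq degree_rate_product)
    moreover have "k < lam (r + 1)" using assms b False by (auto simp: set_lex_index le_Suc_eq)
    ultimately show ?thesis using N by simp
  qed
qed

lemma rate_poly_pos: "z \<in> S \<Longrightarrow> 0 < rate_poly r \<rho> lam z"
  unfolding rate_poly_def by (intro prod_pos ballI zero_less_power S_pos)

lemma poly_pf_basis:
  assumes b: "b \<in> set idx" and z: "z \<in> S"
  shows "poly (pf_basis r \<rho> lam b) z = rate_poly r \<rho> lam z * pf_fun b z"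
proof -
  obtain j k where jk: "b = (j, k)" by (cases b)
  show ?thesis
  proof (cases "j \<le> r")
    case True
    then have j: "1 \<le> j" "k < lam j" using b jk by (simp_all add: set_lex_index)
    then have nz: "\<rho> j + z \<noteq> 0" using S_nonzero[OF z, of j] True by simp
    have lin: "poly (linear_factor \<rho> j) z = \<rho> j + z" by (simp add: linear_factor_def)
    have "lam j = (lam j - Suc k) + Suc k" using j by simp
    then have "(\<rho> j + z) ^ lam j = (\<rho> j + z) ^ (lam j - Suc k) * (\<rho> j + z) ^ Suc k"
      by (metis power_add)
    then show ?thesis using nz True
      by (simp add: jk pf_basis_def pf_fun_def lin rate_product_remove[OF j(1) True] flip: poly_rate_product)
  next
    case False
    then show ?thesis by (simp add: jk pf_basis_def pf_fun_def poly_monom poly_rate_product)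
  qed
qed

text \<open>Resolves the definite description: \<open>S\<close> is infinite, so values on it admit
  at most one polynomial.\<close>

lemma connection_poly_eq:
  assumes jk: "(j, k) \<in> set idx"
    and deg: "Polynomial.degree P \<le> N - 1"
    and P: "\<And>z. z \<in> S \<Longrightarrow> poly P z = rate_poly r \<rho> lam z * G j k z"
  shows "connection_poly r \<rho> d a lam j k = P"
proof -
  have j: "1 \<le> j" using jk by (simp add: set_lex_index)
  have G: "rate_poly r \<rho> lam z / L z * poly_deriv_op (monic_hermite k) (row_transform r \<rho> d a j) z
      = rate_poly r \<rho> lam z * G j k z" if "z \<in> S" for z
    using poly_deriv_op_row_transform[OF j that] by (simp add: G_def monic_hermite_eq)
  show ?thesis
    unfolding connection_poly_def
  proof (rule the_equality)
    show "Polynomial.degree P \<le> N - 1 \<and> (\<forall>z. (\<forall>h\<in>{1..r}. 0 < \<rho> h + z) \<longrightarrow> poly P z =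
        rate_poly r \<rho> lam z / L z * poly_deriv_op (monic_hermite k) (row_transform r \<rho> d a j) z)"
      using deg P G by (simp add: S_def)
    fix Q
    assume Q: "Polynomial.degree Q \<le> N - 1 \<and> (\<forall>z. (\<forall>h\<in>{1..r}. 0 < \<rho> h + z) \<longrightarrow> poly Q z =
        rate_poly r \<rho> lam z / L z * poly_deriv_op (monic_hermite k) (row_transform r \<rho> d a j) z)"
    show "Q = P"
    proof (rule poly_eq_on_S)
      fix z assume "z \<in> S"
      then show "poly Q z = poly P z" using Q G P by (simp add: S_def)
    qed
  qed
qed

text \<open>Multiplying the level expansion by the common denominator turns each term into a member
  of \<open>pf_basis\<close> with index in \<open>idx\<close>; all three facts are read off this one
  witness.\<close>

lemma
  assumes jk: "(j, k) \<in> set idx"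
  shows connection_poly_expansion:
      "\<exists>c. connection_poly r \<rho> d a lam j k = Polynomial.smult (lead j k) (pf_basis r \<rho> lam (j, k))
         + (\<Sum>b\<in>{1..r + 1} \<times> {..<k}. Polynomial.smult (c b) (pf_basis r \<rho> lam b))" (is "\<exists>c. ?eq c")
    and degree_connection_poly: "Polynomial.degree (connection_poly r \<rho> d a lam j k) \<le> N - 1"
    and poly_connection_poly: "z \<in> S \<Longrightarrow>
      poly (connection_poly r \<rho> d a lam j k) z = rate_poly r \<rho> lam z * G j k z"
proof -
    have "level k (\<lambda>z. G j k z - lead j k * pf_fun (j, k) z)"
      using jk idx_level_0_or_inj by (intro level_G) (auto simp: set_lex_index)
    then obtain c where c: "\<And>z. z \<in> S \<Longrightarrow> G j k z - lead j k * pf_fun (j, k) z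
        = (\<Sum>b\<in>{1..r + 1} \<times> {..<k}. c b * pf_fun b z)"
      unfolding level_def by blast
    define P where "P = Polynomial.smult (lead j k) (pf_basis r \<rho> lam (j, k))
       + (\<Sum>b\<in>{1..r + 1} \<times> {..<k}. Polynomial.smult (c b) (pf_basis r \<rho> lam b))"
    have low: "b \<in> set idx" if "b \<in> {1..r + 1} \<times> {..<k}" for b
      using lower_level_idx[OF jk] that by blast
    have deg: "Polynomial.degree P \<le> N - 1"
      unfolding P_def using jk low
      by (intro degree_add_le degree_sum_le order_trans[OF degree_smult_le] degree_pf_basis) auto
    have val: "poly P z = rate_poly r \<rho> lam z * G j k z" if z: "z \<in> S" for z
    proof -
      have "poly P z = lead j k * (rate_poly r \<rho> lam z * pf_fun (j, k) z)
          + (\<Sum>b\<in>{1..r + 1} \<times> {..<k}. c b * (rate_poly r \<rho> lam z * pf_fun b z))"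
        unfolding P_def poly_add poly_smult poly_sum using poly_pf_basis[OF jk z] poly_pf_basis[OF low z]
        by simp
      also have "\<dots> = rate_poly r \<rho> lam z * (lead j k * pf_fun (j, k) z
          + (\<Sum>b\<in>{1..r + 1} \<times> {..<k}. c b * pf_fun b z))"
        by (simp add: distrib_left sum_distrib_left mult.left_commute)
      finally show ?thesis unfolding c[OF z, symmetric] by simp
    qed
    have P_eq: "connection_poly r \<rho> d a lam j k = P"
      using connection_poly_eq[OF jk deg val] .
    show "z \<in> S \<Longrightarrow> poly (connection_poly r \<rho> d a lam j k) z = rate_poly r \<rho> lam z * G j k z"
      using P_eq val by simp
    show "Polynomial.degree (connection_poly r \<rho> d a lam j k) \<le> N - 1" using P_eq deg by simp
    show "\<exists>c. ?eq c" using P_eq unfolding P_def by (rule exI[of ?eq])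
qed

lemma connection_det_eq:
  "connection_det r \<rho> d a lam
    = poly_list_det (map (pf_basis r \<rho> lam) idx) * (\<Prod>j\<in>{1..r + 1}. \<Prod>k<lam j. lead j k)"
proof -
  define c where "c j k = (SOME c. connection_poly r \<rho> d a lam j k
      = Polynomial.smult (lead j k) (pf_basis r \<rho> lam (j, k))
       + (\<Sum>b\<in>{1..r + 1} \<times> {..<k}. Polynomial.smult (c b) (pf_basis r \<rho> lam b)))" for j k
  have c: "connection_poly r \<rho> d a lam j k = Polynomial.smult (lead j k) (pf_basis r \<rho> lam (j, k))
       + (\<Sum>b\<in>{1..r + 1} \<times> {..<k}. Polynomial.smult (c j k b) (pf_basis r \<rho> lam b))"
    if "(j, k) \<in> set idx" for j k
    using someI_ex[OF connection_poly_expansion[OF that]] unfolding c_def .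
  define V where "V = Matrix.mat N N (\<lambda>(\<nu>, x). Polynomial.coeff (pf_basis r \<rho> lam (idx ! x)) \<nu>)"
  \<comment> \<open>The coordinate of the connection polynomial with index b' at the basis element
    b. Off the diagonal it vanishes unless b has strictly smaller level, as
    \<open>det_level_triangular\<close> requires.\<close>
  define t where "t b b' = (if b = b' then lead (fst b) (snd b)
     else if snd b < snd b' then c (fst b') (snd b') b else 0)" for b b'
  define T where "T = Matrix.mat N N (\<lambda>(x, y). t (idx ! x) (idx ! y))"
  have carr: "V \<in> carrier_mat N N" "T \<in> carrier_mat N N" by (simp_all add: V_def T_def)
  have len: "length idx = N" by (simp add: length_lex_index)
  have "connection_matrix r \<rho> d a lam = V * T"
  proof (rule eq_matI)
    fix \<nu> y assume "\<nu> < dim_row (V * T)" "y < dim_col (V * T)"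
    then have \<nu>y: "\<nu> < N" "y < N" by (simp_all add: V_def T_def)
    obtain j k where jk: "idx ! y = (j, k)" by (cases "idx ! y")
    then have in_idx: "(j, k) \<in> set idx" using \<nu>y len nth_mem by metis
    let ?B = "{1..r + 1} \<times> {..<k}"
    let ?f = "\<lambda>b. Polynomial.coeff (pf_basis r \<rho> lam b) \<nu>"
    have low: "?B \<subseteq> set idx" by (rule lower_level_idx[OF in_idx])
    have "(V * T) $$ (\<nu>, y) = (\<Sum>x\<in>{0..<N}. ?f (idx ! x) * t (idx ! x) (j, k))"
      using \<nu>y by (simp add: V_def T_def scalar_prod_def jk[simplified])
    also have "\<dots> = (\<Sum>b\<in>set idx. ?f b * t b (j, k))"
      by (rule sum_lex_index)
    also have "\<dots> = (\<Sum>b\<in>insert (j, k) ?B. ?f b * t b (j, k))"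
    proof (rule sum.mono_neutral_right)
      show "insert (j, k) ?B \<subseteq> set idx" using low in_idx by (simp only: insert_subset simp_thms)
      show "\<forall>b\<in>set idx - insert (j, k) ?B. ?f b * t b (j, k) = 0"
        by (auto simp: t_def set_lex_index)
    qed simp
    also have "\<dots> = ?f (j, k) * lead j k + (\<Sum>b\<in>?B. ?f b * t b (j, k))"
      by (subst sum.insert) (auto simp: t_def)
    also have "(\<Sum>b\<in>?B. ?f b * t b (j, k)) = (\<Sum>b\<in>?B. c j k b * ?f b)"
      by (rule sum.cong) (auto simp: t_def)
    also have "?f (j, k) * lead j k + \<dots> = Polynomial.coeff (connection_poly r \<rho> d a lam j k) \<nu>"
      by (simp add: c[OF in_idx] coeff_sum)
    finally show "connection_matrix r \<rho> d a lam $$ (\<nu>, y) = (V * T) $$ (\<nu>, y)"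
      using \<nu>y by (simp add: connection_matrix_def jk[simplified])
  qed (simp_all add: connection_matrix_def V_def T_def)
  then have "connection_det r \<rho> d a lam = Determinant.det V * Determinant.det T"
    using det_mult[OF carr] by (simp add: connection_det_def)
  also have "Determinant.det V = poly_list_det (map (pf_basis r \<rho> lam) idx)"
    by (auto simp: poly_list_det_def V_def length_lex_index intro!: arg_cong[where f = Determinant.det] eq_matI)
  also have "Determinant.det T = (\<Prod>x<N. T $$ (x, x))"
  proof (rule det_level_triangular[OF carr(2), where lev = "\<lambda>x. snd (idx ! x)"])
    fix x y assume "x < N" "y < N" "x \<noteq> y" "\<not> snd (idx ! x) < snd (idx ! y)"
    moreover have "idx ! x \<noteq> idx ! y"
      using calculation distinct_lex_index nth_eq_iff_index_eq len by metis
    ultimately show "T $$ (x, y) = 0" by (simp add: T_def t_def)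
  qed
  also have "\<dots> = (\<Prod>x<N. (\<lambda>(j, k). lead j k) (idx ! x))"
    by (rule prod.cong) (auto simp: T_def t_def split: prod.split)
  also have "\<dots> = (\<Prod>j\<in>{1..r + 1}. \<Prod>k<lam j. lead j k)"
    by (subst prod_lex_index) simp
  finally show ?thesis .
qed

lemma prod_lead:
  "(\<Prod>j\<in>{1..r + 1}. \<Prod>k<lam j. lead j k)
    = 1 / 2 ^ (lam (r + 1) choose 2)
      * (\<Prod>h\<in>{1..r}. (- 1) ^ (lam h choose 2) * (\<rho> h ^ lam h * (\<Prod>k\<in>{0..<lam h}. pochhammer (d h + 1) k)))"
proof -
  have "(\<Prod>k<lam h. lead h k) = (- 1) ^ (lam h choose 2) * (\<rho> h ^ lam h * (\<Prod>k\<in>{0..<lam h}. pochhammer (d h + 1) k))"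
    if "h \<in> {1..r}" for h
    using that by (simp add: lead_def prod.distrib prod_power_lessThan flip: lessThan_atLeast0)
  moreover have "(\<Prod>k<lam (Suc r). lead (Suc r) k) = 1 / 2 ^ (lam (Suc r) choose 2)"
    using prod_power_lessThan[of "1 / 2" "lam (Suc r)"] by (simp add: lead_def power_divide)
  ultimately show ?thesis by (simp add: prod.distrib)
qed

text \<open>The sign (-1)^(n_h choose 2) arises twice, from the determinant of the poles and from
  the leading coefficients, and squares to one.\<close>

lemma connection_det_formula:
  "connection_det r \<rho> d a lam =
     1 / 2 ^ (lam (r + 1) choose 2)
     * (\<Prod>h\<in>{1..r}. \<rho> h ^ lam h * (\<Prod>k\<in>{0..<lam h}. pochhammer (d h + 1) k))
     * (\<Prod>h\<in>{1..r}. \<Prod>j\<in>{1..<h}. (\<rho> h - \<rho> j) ^ (lam j * lam h))"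
proof -
  define e :: real where "e = (\<Prod>h\<in>{1..r}. (- 1) ^ (lam h choose 2))"
  have "(x ^ n) * (x ^ n) = 1" if "x * x = 1" for x :: real and n
    using that by (simp flip: power_mult_distrib)
  then have sign: "e * e = 1" by (simp add: e_def flip: prod.distrib)
  show ?thesis
    unfolding connection_det_eq prod_lead poly_list_det_pf_basis prod.distrib e_def[symmetric]
    using sign by (simp add: mult_ac)
qed

text \<open>A rate difference with a vanishing multiplicity has exponent zero and contributes 1, so
  only differences of rates with positive multiplicity matter; the Pochhammer factors are positive
  because d_h + 1 > 0.\<close>

lemma connection_det_nonzero: "connection_det r \<rho> d a lam \<noteq> 0"
proof -
  have "pochhammer (d h + 1) k \<noteq> 0" if "h \<in> {1..r}" for h k
    using d_ge_0[OF that] pochhammer_pos[of "d h + 1" k] by simp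
  moreover have "\<rho> h \<noteq> 0" if "h \<in> {1..r}" for h
    using rho_pos[OF that] by simp
  moreover have "(\<rho> h - \<rho> j) ^ (lam j * lam h) \<noteq> 0" if "h \<in> {1..r}" "j \<in> {1..<h}" for h j
    using inj_onD[OF distinct_rates, of h j] that by auto
  ultimately show ?thesis
    unfolding connection_det_formula by (simp add: prod_zero_iff)
qed

end

section \<open>Vanishing moments and divisibility\<close>
text \<open>With its converse below, this turns divisibility into a growth bound at
  \<open>x\<close>, a notion that survives multiplication by a weight that is not a
  polynomial.\<close>

lemma linear_power_dvd_bound:
  fixes x :: real
  assumes "[:- x, 1:] ^ m dvd A"
  shows "\<exists>C \<epsilon>. 0 < \<epsilon> \<and> (\<forall>z. \<bar>z - x\<bar> < \<epsilon> \<longrightarrow> \<bar>poly A z\<bar> \<le> C * \<bar>z - x\<bar> ^ m)"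
proof -
  obtain Q where Q: "A = [:- x, 1:] ^ m * Q" using assms by (elim dvdE)
  have "continuous_on {x - 1..x + 1} (poly Q)" by (intro continuous_intros)
  then obtain C where C: "\<And>z. z \<in> {x - 1..x + 1} \<Longrightarrow> norm (poly Q z) \<le> C"
    using continuous_on_compact_bound[OF compact_Icc] by metis
  have "\<bar>poly A z\<bar> \<le> C * \<bar>z - x\<bar> ^ m" if "\<bar>z - x\<bar> < 1" for z
  proof -
    have "\<bar>poly A z\<bar> = \<bar>z - x\<bar> ^ m * \<bar>poly Q z\<bar>" by (simp add: Q abs_mult power_abs abs_minus_commute)
    also have "\<dots> \<le> \<bar>z - x\<bar> ^ m * C" using that C[of z] by (intro mult_left_mono) (auto simp: abs_less_iff)
    finally show ?thesis by (simp add: mult.commute)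
  qed
  then show ?thesis by (intro exI[of _ C] exI[of _ 1]) simp
qed

text \<open>If the order j of the zero were smaller than \<open>m\<close>, the cofactor would be
  bounded by a multiple of |z - x|^(m - j), hence tend to 0 at \<open>x\<close>, where it does not
  vanish.\<close>

lemma linear_power_dvd_if_bound:
  fixes x :: real
  assumes "0 < \<epsilon>" and bound: "\<And>z. \<bar>z - x\<bar> < \<epsilon> \<Longrightarrow> \<bar>poly A z\<bar> \<le> C * \<bar>z - x\<bar> ^ m"
  shows "[:- x, 1:] ^ m dvd A"
proof (cases "A = 0")
  case False
  define j where "j = Polynomial.order x A"
  show ?thesis
  proof (cases "m \<le> j")
    case True
    then show ?thesis using order_1[of x A] unfolding j_def by (meson dvd_trans le_imp_power_dvd)
  next
    case less: False
    obtain Q where Q: "A = [:- x, 1:] ^ j * Q" "\<not> [:- x, 1:] dvd Q"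
      using order_decomp[OF False] unfolding j_def by blast
    have "poly Q x \<noteq> 0" using Q(2) by (simp add: poly_eq_0_iff_dvd)
    have Qb: "\<bar>poly Q z\<bar> \<le> C * \<bar>z - x\<bar> ^ (m - j)" if "\<bar>z - x\<bar> < \<epsilon>" "z \<noteq> x" for z
    proof -
      have "\<bar>z - x\<bar> ^ m = \<bar>z - x\<bar> ^ j * \<bar>z - x\<bar> ^ (m - j)" using less by (simp flip: power_add)
      then have "\<bar>z - x\<bar> ^ j * \<bar>poly Q z\<bar> \<le> \<bar>z - x\<bar> ^ j * (C * \<bar>z - x\<bar> ^ (m - j))"
        using bound[OF that(1)] by (simp add: Q(1) abs_mult power_abs mult_ac abs_minus_commute)
      then show ?thesis using that by (simp add: mult_le_cancel_left)
    qed
    have "(poly Q \<longlongrightarrow> poly Q x) (at x)" by (intro tendsto_intros)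
    moreover have "(poly Q \<longlongrightarrow> 0) (at x)"
    proof (rule Lim_null_comparison)
      show "\<forall>\<^sub>F z in at x. norm (poly Q z) \<le> C * \<bar>z - x\<bar> ^ (m - j)"
        using Qb assms(1) by (auto simp: eventually_at dist_real_def intro!: exI[of _ \<epsilon>])
      have "((\<lambda>z. C * \<bar>z - x\<bar> ^ (m - j)) \<longlongrightarrow> C * \<bar>x - x\<bar> ^ (m - j)) (at x)"
        by (intro tendsto_intros)
      then show "((\<lambda>z. C * \<bar>z - x\<bar> ^ (m - j)) \<longlongrightarrow> 0) (at x)"
        using less by (simp add: power_0_left)
    qed
    ultimately have "poly Q x = 0" by (intro tendsto_unique) auto
    with \<open>poly Q x \<noteq> 0\<close> show ?thesis by simp
  qed
qed simp

context half_line
begin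

text \<open>The k-th moment at \<open>x\<close> is the k-th derivative of the transform; the
  Lagrange remainder is bounded because the m-th derivative is continuous on a compact
  interval.\<close>

lemma bilateral_Taylor:
  assumes f: "tame f" and x: "x \<in> S"
  shows "\<exists>C \<epsilon>. 0 < \<epsilon> \<and> (\<forall>z. \<bar>z - x\<bar> < \<epsilon> \<longrightarrow>
     \<bar>bilateral f z - (\<Sum>k<m. bilateral (\<lambda>t. t ^ k * f t) x / fact k * (z - x) ^ k)\<bar> \<le> C * \<bar>z - x\<bar> ^ m)"
proof -
  obtain \<epsilon> where e: "0 < \<epsilon>" "{x - \<epsilon>..x + \<epsilon>} \<subseteq> S"
  proof -
    obtain e where "0 < e" "\<And>w. dist w x < e \<Longrightarrow> w \<in> S" using open_S x by (auto simp: open_dist)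
    then have "{x - e / 2..x + e / 2} \<subseteq> S" by (auto simp: dist_real_def)
    then show thesis using that[of "e / 2"] \<open>0 < e\<close> by simp
  qed
  define D where "D k z = bilateral (\<lambda>t. t ^ k * f t) z" for k z
  have der: "(D k has_real_derivative D (Suc k) z) (at z)" if "z \<in> S" for k z
    using has_real_derivative_bilateral[OF tame_times_power[OF f] that, of k]
    by (simp add: D_def[abs_def] mult.assoc)
  have "continuous_on {x - \<epsilon>..x + \<epsilon>} (D m)"
  proof (rule continuous_at_imp_continuous_on, rule ballI)
    fix z assume "z \<in> {x - \<epsilon>..x + \<epsilon>}"
    then show "isCont (D m) z" using DERIV_isCont[OF der] e(2) by (meson subsetD)
  qed
  then obtain C where C: "\<And>z. z \<in> {x - \<epsilon>..x + \<epsilon>} \<Longrightarrow> norm (D m z) \<le> C"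
    using continuous_on_compact_bound[OF compact_Icc] by metis
  have D0: "D 0 = bilateral f" by (simp add: D_def fun_eq_iff)
  have "\<bar>bilateral f z - (\<Sum>k<m. D k x / fact k * (z - x) ^ k)\<bar> \<le> C * \<bar>z - x\<bar> ^ m"
    if z: "\<bar>z - x\<bar> < \<epsilon>" for z
  \<comment> \<open>Taylor's theorem with Lagrange remainder, applied in the other case, asks for
    \<open>m > 0\<close> and \<open>z \<noteq> x\<close>.\<close>
  proof (cases "m = 0 \<or> z = x")
    case True
    then show ?thesis
    proof
      assume "m = 0"
      then show ?thesis using C[of z] z by (auto simp: D0 abs_if split: if_splits)
    next
      assume "z = x"
      then show ?thesis
        using C[of x] e(1) by (cases m) (simp_all add: sum.lessThan_Suc_shift flip: D0 del: sum.lessThan_Suc)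
    qed
  next
    case False
    have "\<exists>t. (if z < x then z < t \<and> t < x else x < t \<and> t < z) \<and>
        bilateral f z = (\<Sum>k<m. D k x / fact k * (z - x) ^ k) + D m t / fact m * (z - x) ^ m"
      using False z e der D0 by (intro Taylor[where a = "x - \<epsilon>" and b = "x + \<epsilon>"]) auto
    then obtain t where t: "if z < x then z < t \<and> t < x else x < t \<and> t < z"
        "bilateral f z = (\<Sum>k<m. D k x / fact k * (z - x) ^ k) + D m t / fact m * (z - x) ^ m" by blast
    have "\<bar>D m t\<bar> \<le> C" using t(1) z C[of t] by (auto split: if_splits)
    then have "\<bar>D m t\<bar> / fact m \<le> C"
      using fact_ge_1[of m, where 'a = real] mult_left_mono[of 1 "fact m" "\<bar>D m t\<bar>"]
      by (intro order_trans[OF _ \<open>\<bar>D m t\<bar> \<le> C\<close>]) (simp add: divide_le_eq)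
    then show ?thesis
      unfolding t(2) using mult_right_mono[of "\<bar>D m t\<bar> / fact m" C "\<bar>z - x\<bar> ^ m"]
      by (simp add: abs_mult power_abs)
  qed
  then show ?thesis using e(1) by (intro exI[of _ C] exI[of _ \<epsilon>]) (simp add: D_def)
qed

text \<open>Up to order |z - x|^m the transform equals its Taylor polynomial \<open>P\<close>, and
  near \<open>x\<close> the weight lies between positive constants. So \<open>A\<close> satisfies a
  bound of order \<open>m\<close> exactly if \<open>P\<close> does, and since only degrees below
  \<open>m\<close> occur in \<open>P\<close>, this forces \<open>P\<close> to vanish.\<close>

lemma vanishing_moments_iff_dvd:
  assumes f: "tame f" and x: "x \<in> S" and cont: "isCont W x" and W: "0 < W x"
    and T: "\<And>z. z \<in> S \<Longrightarrow> bilateral f z = W z * poly A z"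
  shows "(\<forall>k<m. bilateral (\<lambda>t. t ^ k * f t) x = 0) \<longleftrightarrow> [:- x, 1:] ^ m dvd A"
proof -
  define P where "P = (\<Sum>k<m. Polynomial.monom (bilateral (\<lambda>t. t ^ k * f t) x / fact k) k)"
  have P: "poly P (z - x) = (\<Sum>k<m. bilateral (\<lambda>t. t ^ k * f t) x / fact k * (z - x) ^ k)" for z
    by (simp add: P_def poly_sum poly_monom)
  obtain C1 e1 where e1: "0 < e1" "\<And>z. \<bar>z - x\<bar> < e1 \<Longrightarrow> \<bar>bilateral f z - poly P (z - x)\<bar> \<le> C1 * \<bar>z - x\<bar> ^ m"
    using bilateral_Taylor[OF f x, of m] unfolding P[symmetric] by blast
  obtain e2 where e2: "0 < e2" "\<And>z. \<bar>z - x\<bar> < e2 \<Longrightarrow> z \<in> S"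
    using open_S x by (auto simp: open_dist dist_real_def)
  have "\<forall>\<^sub>F z in at x. dist (W z) (W x) < W x / 2"
    using cont W by (intro tendstoD) (auto simp: isCont_def)
  then obtain e3 where e3: "0 < e3" "\<And>z. z \<noteq> x \<Longrightarrow> \<bar>z - x\<bar> < e3 \<Longrightarrow> dist (W z) (W x) < W x / 2"
    by (auto simp: eventually_at dist_real_def)
  \<comment> \<open>Continuity and positivity keep the weight within a factor of two of its value at
    \<open>x\<close>: the lower bound serves one direction, the upper bound the other.\<close>
  have Wb: "W x / 2 < W z" "W z < 2 * W x" if "\<bar>z - x\<bar> < e3" for z
  proof -
    have "\<bar>W z - W x\<bar> < W x / 2" using e3(2)[of z] that W by (cases "z = x") (auto simp: dist_real_def)
    then show "W x / 2 < W z" "W z < 2 * W x" using W by linarith+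
  qed
  define e where "e = min e1 (min e2 e3)"
  have e: "0 < e" using e1 e2 e3 by (simp add: e_def)
  show ?thesis
  proof
    assume "\<forall>k<m. bilateral (\<lambda>t. t ^ k * f t) x = 0"
    then have "P = 0" by (simp add: P_def)
    show "[:- x, 1:] ^ m dvd A"
    proof (rule linear_power_dvd_if_bound[OF e])
      fix z assume z: "\<bar>z - x\<bar> < e"
      have "W z * \<bar>poly A z\<bar> \<le> C1 * \<bar>z - x\<bar> ^ m"
        using e1(2)[of z] T[OF e2(2)[of z]] Wb[of z] W z \<open>P = 0\<close> by (simp add: e_def abs_mult)
      moreover have "W x / 2 * \<bar>poly A z\<bar> \<le> W z * \<bar>poly A z\<bar>"
        using Wb[of z] z by (intro mult_right_mono) (auto simp: e_def)
      ultimately have "W x / 2 * \<bar>poly A z\<bar> \<le> C1 * \<bar>z - x\<bar> ^ m" by linarith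
      then show "\<bar>poly A z\<bar> \<le> 2 * C1 / W x * \<bar>z - x\<bar> ^ m"
        using W by (simp add: field_simps)
    qed
  next
    assume "[:- x, 1:] ^ m dvd A"
    then obtain C4 e4 where e4: "0 < e4" "\<And>z. \<bar>z - x\<bar> < e4 \<Longrightarrow> \<bar>poly A z\<bar> \<le> C4 * \<bar>z - x\<bar> ^ m"
      using linear_power_dvd_bound by blast
    have "[:- 0, 1:] ^ m dvd P"
    proof (rule linear_power_dvd_if_bound)
      show "0 < min e e4" using e e4 by simp
      fix w assume w: "\<bar>w - 0\<bar> < min e e4"
      define z where "z = x + w"
      have z: "\<bar>z - x\<bar> < min e e4" and w_eq: "w - 0 = z - x" "w = z - x" using w by (simp_all add: z_def)
      have Wz: "0 \<le> W z" "W z \<le> 2 * W x" using Wb[of z] z W by (auto simp: e_def)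
      have "\<bar>bilateral f z\<bar> = W z * \<bar>poly A z\<bar>"
        using T[OF e2(2)[of z]] z Wz by (simp add: e_def abs_mult)
      also have "\<dots> \<le> 2 * W x * (C4 * \<bar>z - x\<bar> ^ m)"
        using Wz e4(2)[of z] z W by (intro mult_mono) auto
      finally have "\<bar>bilateral f z\<bar> \<le> 2 * W x * C4 * \<bar>z - x\<bar> ^ m" by (simp only: mult.assoc)
      moreover have "\<bar>bilateral f z - poly P (z - x)\<bar> \<le> C1 * \<bar>z - x\<bar> ^ m"
        using z by (intro e1(2)) (simp add: e_def)
      ultimately have "\<bar>poly P (z - x)\<bar> \<le> 2 * W x * C4 * \<bar>z - x\<bar> ^ m + C1 * \<bar>z - x\<bar> ^ m" by linarith
      then show "\<bar>poly P w\<bar> \<le> (2 * W x * C4 + C1) * \<bar>w - 0\<bar> ^ m"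
        unfolding w_eq(1) by (simp only: w_eq(2) distrib_right)
    qed
    then have coeff: "Polynomial.coeff P k = 0" if "k < m" for k
      using that monom_1_dvd_iff'[of m P] by (simp add: monom_altdef)
    show "\<forall>k<m. bilateral (\<lambda>t. t ^ k * f t) x = 0"
    proof (intro allI impI)
      fix k assume "k < m"
      then show "bilateral (\<lambda>t. t ^ k * f t) x = 0"
        using coeff[of k] by (simp add: P_def coeff_sum)
    qed
  qed
qed

end

text \<open>\<open>hermite_poly n\<close> is monic of degree \<open>n\<close>, so subtracting a
  multiple of it removes the top coefficient.\<close>

lemma hermite_poly_span:
  assumes "P = 0 \<or> Polynomial.degree P < n"
  shows "\<exists>c. P = (\<Sum>k<n. Polynomial.smult (c k) (hermite_poly k))"
  using assms
proof (induction n arbitrary: P)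
  case (Suc n)
  define Q where "Q = P - Polynomial.smult (Polynomial.coeff P n) (hermite_poly n)"
  have "Polynomial.coeff Q i = 0" if "n \<le> i" for i
  proof (cases "i = n")
    case False
    then have "n < i" using that by simp
    then have "Polynomial.coeff P i = 0" using Suc.prems by (auto intro: coeff_eq_0)
    then show ?thesis using \<open>n < i\<close> by (simp add: Q_def coeff_hermite_poly)
  qed (simp add: Q_def coeff_hermite_poly_self)
  then have "Q = 0 \<or> Polynomial.degree Q < n"
    by (metis leading_coeff_0_iff not_le)
  then obtain c where c: "Q = (\<Sum>k<n. Polynomial.smult (c k) (hermite_poly k))"
    using Suc.IH by blast
  have "P = (\<Sum>k<n. Polynomial.smult ((c(n := Polynomial.coeff P n)) k) (hermite_poly k))
      + Polynomial.smult ((c(n := Polynomial.coeff P n)) n) (hermite_poly n)"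
    using c by (simp add: Q_def algebra_simps)
  then show ?case by (intro exI[of _ "c(n := Polynomial.coeff P n)"]) simp
qed simp

lemma nonsingular_mat_inverse:
  fixes A :: "real mat"
  assumes A: "A \<in> carrier_mat n n" and "Determinant.det A \<noteq> 0"
  obtains B where "B \<in> carrier_mat n n" "A * B = 1\<^sub>m n" "B * A = 1\<^sub>m n"
  using det_non_zero_imp_unit[OF assms] unfolding Units_def ring_mat_def by auto

lemma nonsingular_mat_invertible:
  fixes A :: "real mat"
  assumes "A \<in> carrier_mat n n" and "Determinant.det A \<noteq> 0"
  shows "invertible_mat A"
proof -
  obtain B where "B \<in> carrier_mat n n" "A * B = 1\<^sub>m n" "B * A = 1\<^sub>m n"
    using nonsingular_mat_inverse[OF assms] .
  then show ?thesis
    using assms(1) by (auto simp: invertible_mat_def inverts_mat_def)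
qed

lemma nonsingular_mat_solve:
  fixes A :: "real mat"
  assumes A: "A \<in> carrier_mat n n" and "Determinant.det A \<noteq> 0" and b: "b \<in> carrier_vec n"
  obtains w where "w \<in> carrier_vec n" "A *\<^sub>v w = b"
proof -
  obtain B where B: "B \<in> carrier_mat n n" "A * B = 1\<^sub>m n"
    using nonsingular_mat_inverse[OF assms(1,2)] .
  show thesis
  proof
    show "B *\<^sub>v b \<in> carrier_vec n" using B b by simp
    show "A *\<^sub>v (B *\<^sub>v b) = b"
      using assoc_mult_mat_vec[OF A B(1) b] B(2) b by simp
  qed
qed

lemma vec_as_lex_family:
  fixes w :: "real Matrix.vec"
  obtains c where "\<And>x. x < index_weight k v \<Longrightarrow> c (lex_index k v ! x) = w $ x"
proof -
  let ?n = "index_weight k v"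
  define c where "c b = the (map_of (zip (lex_index k v) (map (\<lambda>x. w $ x) [0..<?n])) b)" for b
  have "c (lex_index k v ! x) = w $ x" if "x < ?n" for x
    using that map_of_zip_nth[of "lex_index k v" "map (\<lambda>x. w $ x) [0..<?n]" x]
    by (simp add: c_def length_lex_index distinct_lex_index)
  then show thesis by (rule that)
qed

section \<open>The correspondence between linear forms and polynomials of degree below N\<close>

context hermite_index
begin

definition weight :: "real \<Rightarrow> real" where
  "weight z = L z / rate_poly r \<rho> lam z"

lemma weight_fun_pos: "z \<in> S \<Longrightarrow> 0 < weight z"
  by (simp add: weight_def L_pos rate_poly_pos)

lemma isCont_weight:
  assumes "z \<in> S"
  shows "isCont weight z"
proof -
  have "isCont L z" using has_real_derivative_L[OF assms] by (rule DERIV_isCont)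
  moreover have "isCont (rate_poly r \<rho> lam) z"
    unfolding rate_poly_def[abs_def] by (intro continuous_intros)
  ultimately show ?thesis
    unfolding weight_def[abs_def] using rate_poly_pos[OF assms] by (intro continuous_intros) auto
qed

abbreviation "form \<equiv> linear_form r \<rho> d a"

lemma tame_form: "tame (form B)"
  unfolding linear_form_def[abs_def] by (intro tame_sum tame_times_poly tame_U) auto

text \<open>Kept as a relation; nonsingularity of the connection matrix makes it a bijection from
  the admissible vectors onto the polynomials of degree below \<open>N\<close>. The bound
  \<open>N - 1\<close> expresses degree below \<open>N\<close> because \<open>N\<close> is
  positive.\<close>

definition transforms_to :: "(nat \<Rightarrow> real poly) \<Rightarrow> real poly \<Rightarrow> bool" where
  "transforms_to B A \<longleftrightarrow> Polynomial.degree A \<le> N - 1 \<and> (\<forall>z\<in>S. bilateral (form B) z = weight z * poly A z)"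

lemma transforms_to_unique:
  assumes "transforms_to B A" "transforms_to B A'"
  shows "A = A'"
proof (rule poly_eq_on_S)
  fix z assume "z \<in> S"
  then have "weight z * poly A z = weight z * poly A' z"
    using assms by (simp add: transforms_to_def)
  then show "poly A z = poly A' z" using weight_fun_pos[OF \<open>z \<in> S\<close>] by simp
qed

text \<open>The one linear combination that is used: it compares two vectors, produces zero from
  equal arguments, and expresses scalar multiples.\<close>

lemma transforms_to_diff:
  assumes "transforms_to B A" "transforms_to B' A'"
  shows "transforms_to (\<lambda>j. B j - Polynomial.smult c (B' j)) (A - Polynomial.smult c A')"
  unfolding transforms_to_def
proof (intro conjI ballI)
  show "Polynomial.degree (A - Polynomial.smult c A') \<le> N - 1"
    using assms by (intro degree_diff_le) (auto simp: transforms_to_def intro: order_trans[OF degree_smult_le])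
  fix z assume z: "z \<in> S"
  have "form (\<lambda>j. B j - Polynomial.smult c (B' j)) = (\<lambda>t. form B t + (- c) * form B' t)"
    by (simp add: fun_eq_iff linear_form_def algebra_simps sum_subtractf sum_distrib_left sum_negf)
  then have "bilateral (form (\<lambda>j. B j - Polynomial.smult c (B' j))) z
      = bilateral (form B) z + (- c) * bilateral (form B') z"
    by (simp only: bilateral_add[OF tame_form tame_cmult[OF tame_form] z] bilateral_cmult)
  then show "bilateral (form (\<lambda>j. B j - Polynomial.smult c (B' j))) z
      = weight z * poly (A - Polynomial.smult c A') z"
    using assms z by (simp add: transforms_to_def algebra_simps)
qed

text \<open>Coordinates in the Hermite basis, because the columns of the connection matrix belong to
  H_k and not to t^k.\<close>

definition hermite_comb :: "(nat \<times> nat \<Rightarrow> real) \<Rightarrow> nat \<Rightarrow> real poly" where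
  "hermite_comb v j = (if j \<in> {1..r + 1}
     then \<Sum>k<lam j. Polynomial.smult (v (j, k)) (hermite_poly k) else 0)"

definition connection_comb :: "(nat \<times> nat \<Rightarrow> real) \<Rightarrow> real poly" where
  "connection_comb v = (\<Sum>(j, k)\<in>set idx. Polynomial.smult (v (j, k)) (connection_poly r \<rho> d a lam j k))"

lemma set_idx_Sigma: "set idx = Sigma {1..r + 1} (\<lambda>j. {..<lam j})"
  by (auto simp: set_lex_index)

lemma hermite_comb_admissible: "hermite_comb v \<in> admissible_vecs (r + 1) lam"
proof -
  have "(\<Sum>k<n. Polynomial.smult (c k) (hermite_poly k)) = 0
      \<or> Polynomial.degree (\<Sum>k<n. Polynomial.smult (c k) (hermite_poly k)) < n" for n c
  proof (cases "n = 0")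
    case False
    then show ?thesis
      by (intro disjI2 degree_sum_less) (auto intro: le_less_trans[OF degree_smult_le] simp: degree_hermite_poly)
  qed simp
  then show ?thesis by (auto simp: admissible_vecs_def hermite_comb_def)
qed

lemma admissible_hermite_comb:
  assumes "B \<in> admissible_vecs (r + 1) lam"
  obtains v where "B = hermite_comb v"
proof -
  have "\<exists>c. j \<in> {1..r + 1} \<longrightarrow> B j = (\<Sum>k<lam j. Polynomial.smult (c k) (hermite_poly k))" for j
    using hermite_poly_span[of "B j" "lam j"] assms by (auto simp: admissible_vecs_def)
  then obtain c where "\<And>j. j \<in> {1..r + 1} \<longrightarrow> B j = (\<Sum>k<lam j. Polynomial.smult (c j k) (hermite_poly k))"
    by metis
  then have "B = hermite_comb (\<lambda>(j, k). c j k)"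
    using assms by (auto simp: fun_eq_iff hermite_comb_def admissible_vecs_def)
  then show thesis by (rule that)
qed

lemma transforms_to_hermite_comb: "transforms_to (hermite_comb v) (connection_comb v)"
  unfolding transforms_to_def
proof (intro conjI ballI)
  show "Polynomial.degree (connection_comb v) \<le> N - 1"
    unfolding connection_comb_def
  proof (rule degree_sum_le)
    fix b assume b_in: "b \<in> set idx"
    obtain j k where b: "b = (j, k)" by (cases b)
    show "Polynomial.degree (case b of (j, k) \<Rightarrow> Polynomial.smult (v (j, k)) (connection_poly r \<rho> d a lam j k)) \<le> N - 1"
      unfolding b prod.case by (rule order_trans[OF degree_smult_le degree_connection_poly[OF b_in[unfolded b]]])
  qed simp
  fix z assume z: "z \<in> S"
  have trans: "bilateral (\<lambda>t. poly (hermite_poly k) t * U j t) z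
      = weight z * poly (connection_poly r \<rho> d a lam j k) z" if "(j, k) \<in> set idx" for j k
    using poly_connection_poly[OF that z] L_pos[OF z] rate_poly_pos[OF z]
    by (simp add: weight_def G_def)
  have tame: "tame (\<lambda>t. v (j, k) * (poly (hermite_poly k) t * U j t))" if "j \<in> {1..r + 1}" for j k
    using that by (intro tame_cmult tame_times_poly tame_U) auto
  have form_eq: "form (hermite_comb v) = (\<lambda>t. \<Sum>j\<in>{1..r + 1}. \<Sum>k<lam j. v (j, k) * (poly (hermite_poly k) t * U j t))"
    by (simp add: fun_eq_iff linear_form_def hermite_comb_def poly_sum sum_distrib_right mult.assoc)
  have "bilateral (form (hermite_comb v)) z
      = (\<Sum>j\<in>{1..r + 1}. bilateral (\<lambda>t. \<Sum>k<lam j. v (j, k) * (poly (hermite_poly k) t * U j t)) z)"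
    unfolding form_eq by (intro bilateral_sum tame_sum tame z)
  also have "\<dots> = (\<Sum>j\<in>{1..r + 1}. \<Sum>k<lam j. weight z * (v (j, k) * poly (connection_poly r \<rho> d a lam j k) z))"
  proof (rule sum.cong)
    fix j assume j: "j \<in> {1..r + 1}"
    have "bilateral (\<lambda>t. \<Sum>k<lam j. v (j, k) * (poly (hermite_poly k) t * U j t)) z
        = (\<Sum>k<lam j. v (j, k) * bilateral (\<lambda>t. poly (hermite_poly k) t * U j t) z)"
      using bilateral_sum[OF tame[OF j] z] by (simp only: bilateral_cmult)
    also have "\<dots> = (\<Sum>k<lam j. weight z * (v (j, k) * poly (connection_poly r \<rho> d a lam j k) z))"
      using j by (intro sum.cong refl) (simp add: trans set_lex_index)
    finally show "bilateral (\<lambda>t. \<Sum>k<lam j. v (j, k) * (poly (hermite_poly k) t * U j t)) z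
        = (\<Sum>k<lam j. weight z * (v (j, k) * poly (connection_poly r \<rho> d a lam j k) z))" .
  qed simp
  also have "\<dots> = (\<Sum>(j, k)\<in>set idx. weight z * (v (j, k) * poly (connection_poly r \<rho> d a lam j k) z))"
    unfolding set_idx_Sigma by (rule sum.Sigma) auto
  also have "\<dots> = weight z * poly (connection_comb v) z"
    by (simp add: connection_comb_def poly_sum sum_distrib_left split_def)
  finally show "bilateral (form (hermite_comb v)) z = weight z * poly (connection_comb v) z" .
qed

lemma connection_matrix_carrier: "connection_matrix r \<rho> d a lam \<in> carrier_mat N N"
  by (simp add: connection_matrix_def)

lemma coeff_connection_comb:
  assumes "\<nu> < N"
  shows "Polynomial.coeff (connection_comb v) \<nu>
    = (connection_matrix r \<rho> d a lam *\<^sub>v Matrix.vec N (\<lambda>x. v (idx ! x))) $ \<nu>"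
proof -
  let ?f = "\<lambda>b. (case b of (j, k) \<Rightarrow> Polynomial.coeff (connection_poly r \<rho> d a lam j k) \<nu>) * v b"
  have "Polynomial.coeff (connection_comb v) \<nu> = (\<Sum>b\<in>set idx. ?f b)"
    by (simp add: connection_comb_def coeff_sum split_def mult.commute)
  also have "\<dots> = (\<Sum>x\<in>{0..<N}. ?f (idx ! x))"
    by (rule sum_lex_index[symmetric])
  also have "\<dots> = (connection_matrix r \<rho> d a lam *\<^sub>v Matrix.vec N (\<lambda>x. v (idx ! x))) $ \<nu>"
    using assms by (simp add: connection_matrix_def scalar_prod_def)
  finally show ?thesis .
qed

lemma connection_comb_eq_0:
  assumes "connection_comb v = 0"
  shows "hermite_comb v = (\<lambda>j. 0)"
proof -
  let ?w = "Matrix.vec N (\<lambda>x. v (idx ! x))"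
  have "connection_matrix r \<rho> d a lam *\<^sub>v ?w = 0\<^sub>v N"
  proof (rule eq_vecI)
    fix \<nu> assume "\<nu> < dim_vec (0\<^sub>v N :: real Matrix.vec)"
    then show "(connection_matrix r \<rho> d a lam *\<^sub>v ?w) $ \<nu> = 0\<^sub>v N $ \<nu>"
      using coeff_connection_comb[of \<nu> v] assms by simp
  qed (simp add: connection_matrix_def)
  then have "?w = 0\<^sub>v N"
    using det_0_iff_vec_prod_zero_field[OF connection_matrix_carrier]
      connection_det_nonzero[unfolded connection_det_def] vec_carrier[of N "\<lambda>x. v (idx ! x)"] by blast
  have zero: "v b = 0" if b: "b \<in> set idx" for b
  proof -
    obtain x where x: "x < N" "b = idx ! x"
      using b by (auto simp: in_set_conv_nth length_lex_index)
    then have "?w $ x = 0" using \<open>?w = 0\<^sub>v N\<close> by simp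
    then show ?thesis using x by simp
  qed
  show ?thesis
  proof
    fix j
    have "(\<Sum>k<lam j. Polynomial.smult (v (j, k)) (hermite_poly k)) = 0" if "j \<in> {1..r + 1}"
      using that zero[of "(j, _)"] by (intro sum.neutral) (simp add: set_lex_index)
    then show "hermite_comb v j = 0" by (simp add: hermite_comb_def)
  qed
qed

lemma connection_comb_surj:
  assumes "Polynomial.degree A \<le> N - 1"
  obtains v where "connection_comb v = A"
proof -
  obtain w where w: "w \<in> carrier_vec N"
      "connection_matrix r \<rho> d a lam *\<^sub>v w = Matrix.vec N (Polynomial.coeff A)"
    using nonsingular_mat_solve[OF connection_matrix_carrier, of "Matrix.vec N (Polynomial.coeff A)"]
      connection_det_nonzero by (auto simp: connection_det_def)
  obtain v where "\<And>x. x < N \<Longrightarrow> v (idx ! x) = w $ x"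
    using vec_as_lex_family[of "r + 1" lam w] by blast
  then have vw: "Matrix.vec N (\<lambda>x. v (idx ! x)) = w" using w(1) by (intro eq_vecI) auto
  have "connection_comb v = A"
  proof (rule poly_eqI)
    fix \<nu>
    show "Polynomial.coeff (connection_comb v) \<nu> = Polynomial.coeff A \<nu>"
    proof (cases "\<nu> < N")
      case True
      then show ?thesis using coeff_connection_comb[OF True, of v] vw w(2) by simp
    next
      case False
      have "Polynomial.degree (connection_comb v) \<le> N - 1"
        using transforms_to_hermite_comb[of v] by (simp add: transforms_to_def)
      then have "Polynomial.degree (connection_comb v) < \<nu>" "Polynomial.degree A < \<nu>"
        using False assms weight_pos by linarith+
      then show ?thesis by (simp add: coeff_eq_0)
    qed
  qed
  then show thesis by (rule that)
qed

lemma transforms_to_exists: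
  assumes "B \<in> admissible_vecs (r + 1) lam"
  obtains A where "transforms_to B A"
  using admissible_hermite_comb[OF assms] transforms_to_hermite_comb that by metis

lemma transforms_to_surj:
  assumes "Polynomial.degree A \<le> N - 1"
  obtains B where "B \<in> admissible_vecs (r + 1) lam" "transforms_to B A"
  using connection_comb_surj[OF assms] transforms_to_hermite_comb hermite_comb_admissible that by metis

lemma transforms_to_0_imp_0:
  assumes "B \<in> admissible_vecs (r + 1) lam" "transforms_to B 0"
  shows "B = (\<lambda>j. 0)"
proof -
  obtain v where v: "B = hermite_comb v" using admissible_hermite_comb[OF assms(1)] .
  have "connection_comb v = 0"
    using transforms_to_unique[OF transforms_to_hermite_comb] assms(2) unfolding v .
  then show ?thesis unfolding v by (rule connection_comb_eq_0)
qed

end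

text \<open>\<open>P\<close> does not vanish at \<open>x\<close>, so the order of the zero of
  \<open>A\<close> at \<open>x\<close> is carried entirely by the cofactor of
  \<open>P\<close>.\<close>

lemma linear_power_mult_dvd:
  fixes x :: real
  assumes "[:- x, 1:] ^ n dvd A" "P dvd A" "poly P x \<noteq> 0"
  shows "[:- x, 1:] ^ n * P dvd A"
proof -
  obtain Q where A: "A = P * Q" using assms(2) by (elim dvdE)
  have "[:- x, 1:] ^ n dvd Q"
  proof (cases "A = 0")
    case True
    then show ?thesis using assms(3) A by auto
  next
    case False
    then have "Polynomial.order x A = Polynomial.order x Q"
      using assms(3) by (simp add: A order_mult order_0I)
    then show ?thesis using assms(1) False by (auto simp: order_divides)
  qed
  then show ?thesis by (simp add: A mult.commute[of P])
qed

text \<open>Distinctness of the nodes keeps the product over the earlier ones nonzero at each new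
  node, so the powers can be multiplied in one after another.\<close>

lemma prod_linear_powers_dvd_iff:
  fixes \<xi> :: "'i \<Rightarrow> real"
  assumes "finite I" "inj_on \<xi> I"
  shows "(\<Prod>i\<in>I. [:- \<xi> i, 1:] ^ v i) dvd A \<longleftrightarrow> (\<forall>i\<in>I. [:- \<xi> i, 1:] ^ v i dvd A)"
proof
  show "\<forall>i\<in>I. [:- \<xi> i, 1:] ^ v i dvd A" if "(\<Prod>i\<in>I. [:- \<xi> i, 1:] ^ v i) dvd A"
    using that assms(1) by (meson dvd_prodI dvd_trans)
  show "(\<Prod>i\<in>I. [:- \<xi> i, 1:] ^ v i) dvd A" if "\<forall>i\<in>I. [:- \<xi> i, 1:] ^ v i dvd A"
    using assms that
  proof (induction I rule: finite_induct)
    case (insert x I)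
    have "poly (\<Prod>i\<in>I. [:- \<xi> i, 1:] ^ v i) (\<xi> x) \<noteq> 0"
      using insert.hyps insert.prems(1) by (auto simp: poly_prod inj_on_def)
    then show ?case
      unfolding prod.insert[OF insert.hyps] using insert by (intro linear_power_mult_dvd) auto
  qed simp
qed

lemma degree_prod_linear_powers:
  fixes \<xi> :: "'i \<Rightarrow> real"
  shows "Polynomial.degree (\<Prod>i\<in>I. [:- \<xi> i, 1:] ^ v i) = (\<Sum>i\<in>I. v i)"
  by (subst degree_prod_sum_eq) (auto simp: degree_power_eq)

section \<open>Nodes: the moment matrix, weak normality and the Rodrigues function\<close>

locale hermite_nodes = hermite_index +
  fixes p :: nat and \<xi> :: "nat \<Rightarrow> real"
  assumes inj_nodes: "inj_on \<xi> {1..p}" and nodes_S: "i \<in> {1..p} \<Longrightarrow> \<xi> i \<in> S"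
begin

definition root_poly :: "(nat \<Rightarrow> nat) \<Rightarrow> real poly" where
  "root_poly v = (\<Prod>i\<in>{1..p}. [:- \<xi> i, 1:] ^ v i)"

lemma degree_root_poly: "Polynomial.degree (root_poly v) = index_weight p v"
  by (simp add: root_poly_def index_weight_def degree_prod_linear_powers)

lemma root_poly_neq_0: "root_poly v \<noteq> 0"
  by (simp add: root_poly_def)

lemma moment_eq_bilateral:
  "(LINT t|lborel. t ^ k * exp (x * t) * f t) = bilateral (\<lambda>t. t ^ k * f t) x"
  by (simp add: bilateral_def mult_ac)

lemma moments_vanish_iff:
  assumes "transforms_to B A"
  shows "(\<forall>i\<in>{1..p}. \<forall>k<v i. (LINT t|lborel. t ^ k * exp (\<xi> i * t) * form B t) = 0) \<longleftrightarrow> root_poly v dvd A"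
proof -
  have "(\<forall>k<v i. (LINT t|lborel. t ^ k * exp (\<xi> i * t) * form B t) = 0) \<longleftrightarrow> [:- \<xi> i, 1:] ^ v i dvd A"
    if "i \<in> {1..p}" for i
    unfolding moment_eq_bilateral using nodes_S[OF that] assms
    by (intro vanishing_moments_iff_dvd[OF tame_form _ isCont_weight weight_fun_pos])
      (auto simp: transforms_to_def)
  then show ?thesis
    unfolding root_poly_def using inj_nodes by (simp add: prod_linear_powers_dvd_iff)
qed

lemma admissible_moments_imp_0:
  assumes B: "B \<in> admissible_vecs (r + 1) lam" and "N \<le> index_weight p v"
    and "\<forall>i\<in>{1..p}. \<forall>k<v i. (LINT t|lborel. t ^ k * exp (\<xi> i * t) * form B t) = 0"
  shows "B = (\<lambda>j. 0)"
proof -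
  obtain A where A: "transforms_to B A" using transforms_to_exists[OF B] .
  have dvd: "root_poly v dvd A" using moments_vanish_iff[OF A] assms(3) by blast
  have "A = 0"
  proof (rule ccontr)
    assume "A \<noteq> 0"
    then have "index_weight p v \<le> Polynomial.degree A"
      using dvd_imp_degree_le[OF dvd] by (simp add: degree_root_poly)
    moreover have "Polynomial.degree A \<le> N - 1" using A by (simp add: transforms_to_def)
    ultimately show False using assms(2) weight_pos by linarith
  qed
  then show ?thesis using transforms_to_0_imp_0[OF B] A by simp
qed

text \<open>A kernel vector is the coefficient vector of an admissible \<open>B\<close> whose form
  satisfies \<open>N\<close> moment conditions, so \<open>B\<close> vanishes by
  \<open>admissible_moments_imp_0\<close>.\<close>

lemma invertible_moment_matrix:
  assumes "N = index_weight p m + 1" and i0: "i0 \<in> {1..p}"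
  shows "invertible_mat (adjacent_moment_matrix r \<rho> d a lam p \<xi> m i0)"
proof -
  \<comment> \<open>The extra condition at \<open>i0\<close> raises the number of conditions from N
    - 1 to N.\<close>
  define v where "v i = m i + (if i = i0 then 1 else 0)" for i
  let ?rows = "lex_index p v"
  let ?M = "adjacent_moment_matrix r \<rho> d a lam p \<xi> m i0"
  have weight_v: "index_weight p v = N"
    using assms by (simp add: index_weight_def v_def sum.distrib)
  have M_def: "?M = Matrix.mat N N (\<lambda>(x, y). case ?rows ! x of (i, l) \<Rightarrow> case idx ! y of (j, k) \<Rightarrow>
      LINT t|lborel. t ^ (k + l) * exp (\<xi> i * t) * U j t)"
    unfolding adjacent_moment_matrix_def Let_def v_def[symmetric] length_lex_index weight_v ..
  have M: "?M \<in> carrier_mat N N" by (simp add: M_def)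
  have "Determinant.det ?M \<noteq> 0"
  proof
    assume "Determinant.det ?M = 0"
    then obtain w where w: "w \<in> carrier_vec N" "w \<noteq> 0\<^sub>v N" "?M *\<^sub>v w = 0\<^sub>v N"
      using det_0_iff_vec_prod_zero_field[OF M] by blast
    obtain c where c: "\<And>x. x < N \<Longrightarrow> c (idx ! x) = w $ x"
      using vec_as_lex_family[of "r + 1" lam w] by blast
    \<comment> \<open>Monomial coordinates this time: the columns of the moment matrix stand for
      t^k, not for H_k.\<close>
    define B where "B j = (if j \<in> {1..r + 1} then \<Sum>k<lam j. Polynomial.monom (c (j, k)) k else 0)" for j
    have "(\<Sum>k<n. Polynomial.monom (e k) k) = 0 \<or> Polynomial.degree (\<Sum>k<n. Polynomial.monom (e k) k) < n"
      for n and e :: "nat \<Rightarrow> real"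
    proof (cases "n = 0")
      case False
      then show ?thesis
        by (intro disjI2 degree_sum_less) (auto intro: le_less_trans[OF degree_monom_le])
    qed simp
    then have B_adm: "B \<in> admissible_vecs (r + 1) lam" by (auto simp: admissible_vecs_def B_def)
    have "(LINT t|lborel. t ^ l * exp (\<xi> i * t) * form B t) = 0" if i: "i \<in> {1..p}" and l: "l < v i" for i l
    proof -
      have "(i, l) \<in> set ?rows" using i l by (simp add: set_lex_index)
      then obtain x where x: "x < N" "?rows ! x = (i, l)"
        by (auto simp: in_set_conv_nth length_lex_index weight_v)
      have "t ^ l * form B t = (\<Sum>(j, k)\<in>set idx. c (j, k) * (t ^ (k + l) * U j t))" for t
      proof -
        have "form B t = (\<Sum>j\<in>{1..r + 1}. \<Sum>k<lam j. c (j, k) * t ^ k * U j t)"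
          by (simp add: linear_form_def B_def poly_sum poly_monom sum_distrib_right)
        also have "\<dots> = (\<Sum>(j, k)\<in>set idx. c (j, k) * t ^ k * U j t)"
          unfolding set_idx_Sigma by (rule sum.Sigma) auto
        finally show ?thesis by (simp add: sum_distrib_left split_def power_add mult_ac)
      qed
      then have "bilateral (\<lambda>t. t ^ l * form B t) (\<xi> i)
          = bilateral (\<lambda>t. \<Sum>b\<in>set idx. c b * (t ^ (snd b + l) * U (fst b) t)) (\<xi> i)"
        by (simp add: split_def)
      also have "\<dots> = (\<Sum>b\<in>set idx. bilateral (\<lambda>t. c b * (t ^ (snd b + l) * U (fst b) t)) (\<xi> i))"
      proof (rule bilateral_sum[OF _ nodes_S[OF i]])
        fix b assume "b \<in> set idx"
        then have "1 \<le> fst b" by (auto simp: set_lex_index)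
        then show "tame (\<lambda>t. c b * (t ^ (snd b + l) * U (fst b) t))"
          by (intro tame_cmult tame_times_power tame_U)
      qed
      also have "\<dots> = (\<Sum>b\<in>set idx. (LINT t|lborel. t ^ (snd b + l) * exp (\<xi> i * t) * U (fst b) t) * c b)"
        by (intro sum.cong refl, subst bilateral_cmult, subst moment_eq_bilateral, rule mult.commute)
      also have "\<dots> = (\<Sum>y\<in>{0..<N}. (LINT t|lborel. t ^ (snd (idx ! y) + l) * exp (\<xi> i * t) * U (fst (idx ! y)) t) * c (idx ! y))"
        by (rule sum_lex_index[symmetric])
      also have "\<dots> = (?M *\<^sub>v w) $ x"
        using x w(1) c by (simp add: M_def scalar_prod_def split_def)
      also have "\<dots> = 0" using w(3) x by simp
      finally show ?thesis by (simp add: moment_eq_bilateral)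
    qed
    then have "B = (\<lambda>j. 0)" using admissible_moments_imp_0[OF B_adm, of v] weight_v by simp
    have "w = 0\<^sub>v N"
    proof (rule eq_vecI)
      fix x assume "x < dim_vec (0\<^sub>v N :: real Matrix.vec)"
      then have x: "x < N" by simp
      obtain j k where jk: "idx ! x = (j, k)" by (cases "idx ! x")
      then have in_idx: "(j, k) \<in> set idx" using x nth_mem[of x idx] length_lex_index[of "r + 1" lam] by metis
      have "Polynomial.coeff (B j) k = c (j, k)"
        using in_idx by (auto simp: B_def set_lex_index coeff_sum)
      then show "w $ x = 0\<^sub>v N $ x" using \<open>B = (\<lambda>j. 0)\<close> c[OF x] x jk by simp
    qed (use w(1) in simp)
    with w(2) show False by simp
  qed
  then show ?thesis by (rule nonsingular_mat_invertible[OF M])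
qed

lemma admissible_diff:
  assumes "B \<in> admissible_vecs (r + 1) lam" "B' \<in> admissible_vecs (r + 1) lam"
  shows "(\<lambda>j. B j - Polynomial.smult c (B' j)) \<in> admissible_vecs (r + 1) lam"
  unfolding admissible_vecs_def
proof (intro CollectI conjI ballI allI impI)
  fix j assume j: "j \<in> {1..r + 1}"
  have "Polynomial.degree (P - Polynomial.smult c Q) < n \<or> P - Polynomial.smult c Q = 0"
    if "P = 0 \<or> Polynomial.degree P < n" "Q = 0 \<or> Polynomial.degree Q < n" for P Q :: "real poly" and n
  proof (cases "n = 0")
    case False
    then show ?thesis using that degree_smult_le[of c Q]
      by (intro disjI1 degree_diff_less) (auto intro: le_less_trans)
  qed (use that in auto)
  then show "B j - Polynomial.smult c (B' j) = 0 \<or> Polynomial.degree (B j - Polynomial.smult c (B' j)) < lam j"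
    using assms j unfolding admissible_vecs_def by blast
qed (use assms in \<open>simp add: admissible_vecs_def\<close>)

text \<open>\<open>root_poly m\<close> has degree exactly N - 1, so its multiples of degree below N
  are scalar ones, and the vector corresponding to it spans the solutions.\<close>

lemma weakly_normal_nodes:
  assumes N: "N = index_weight p m + 1"
  shows "weakly_normal r \<rho> d a lam p \<xi> m"
proof -
  have deg0: "Polynomial.degree (root_poly m) \<le> N - 1" using N by (simp add: degree_root_poly)
  obtain B0 where B0: "B0 \<in> admissible_vecs (r + 1) lam" "transforms_to B0 (root_poly m)"
    using transforms_to_surj[OF deg0] .
  have "transforms_to (\<lambda>j. B0 j - Polynomial.smult 1 (B0 j)) (root_poly m - Polynomial.smult 1 (root_poly m))"
    by (rule transforms_to_diff[OF B0(2) B0(2)])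
  then have zero: "transforms_to (\<lambda>j. 0) 0" by simp
  have B0_nz: "B0 \<noteq> 0"
    using transforms_to_unique[OF B0(2)] zero root_poly_neq_0[of m] by (auto simp: zero_fun_def)
  have "B_solutions r \<rho> d a lam p \<xi> m = range (\<lambda>c. poly_vec_scale c B0)"
  proof (intro equalityI subsetI)
    fix B assume "B \<in> B_solutions r \<rho> d a lam p \<xi> m"
    then have B: "B \<in> admissible_vecs (r + 1) lam"
      "\<forall>i\<in>{1..p}. \<forall>k<m i. (LINT t|lborel. t ^ k * exp (\<xi> i * t) * form B t) = 0"
      by (simp_all add: B_solutions_def)
    obtain A where A: "transforms_to B A" using transforms_to_exists[OF B(1)] .
    have "root_poly m dvd A" using moments_vanish_iff[OF A, of m] B(2) by blast
    then obtain Q where Q: "A = root_poly m * Q" by (elim dvdE)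
    have "Polynomial.degree Q = 0"
    proof (cases "Q = 0")
      case False
      have "Polynomial.degree A \<le> N - 1" using A by (simp add: transforms_to_def)
      then show ?thesis using False root_poly_neq_0[of m] N by (simp add: Q degree_mult_eq degree_root_poly)
    qed simp
    then obtain c where "Q = [:c:]" by (rule degree_eq_zeroE)
    then have "A = Polynomial.smult c (root_poly m)" by (simp add: Q)
    then have "transforms_to (\<lambda>j. B j - Polynomial.smult c (B0 j)) 0"
      using transforms_to_diff[OF A B0(2), of c] by simp
    then have "(\<lambda>j. B j - Polynomial.smult c (B0 j)) = (\<lambda>j. 0)"
      by (rule transforms_to_0_imp_0[OF admissible_diff[OF B(1) B0(1)]])
    then have "B = poly_vec_scale c B0" by (simp add: poly_vec_scale_def fun_eq_iff)
    then show "B \<in> range (\<lambda>c. poly_vec_scale c B0)" by blast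
  next
    fix B assume "B \<in> range (\<lambda>c. poly_vec_scale c B0)"
    then obtain c where "B = poly_vec_scale c B0" by blast
    \<comment> \<open>A scalar multiple is written as a difference so that
      \<open>transforms_to_diff\<close> and \<open>admissible_diff\<close> apply to it.\<close>
    then have B_eq: "B = (\<lambda>j. B0 j - Polynomial.smult (1 - c) (B0 j))"
      by (simp add: poly_vec_scale_def fun_eq_iff smult_diff_left)
    have "transforms_to B (root_poly m - Polynomial.smult (1 - c) (root_poly m))"
      unfolding B_eq by (rule transforms_to_diff[OF B0(2) B0(2)])
    moreover have "root_poly m dvd root_poly m - Polynomial.smult (1 - c) (root_poly m)"
      by (intro dvd_diff dvd_smult) auto
    moreover have "B \<in> admissible_vecs (r + 1) lam"
      unfolding B_eq by (rule admissible_diff[OF B0(1) B0(1)])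
    ultimately show "B \<in> B_solutions r \<rho> d a lam p \<xi> m"
      using moments_vanish_iff by (simp add: B_solutions_def)
  qed
  then have sol: "B_solutions r \<rho> d a lam p \<xi> m = poly_vec.span {B0}"
    by (simp add: poly_vec.span_singleton)
  have "poly_vec.dim (poly_vec.span {B0}) = card {B0}"
    using B0_nz by (intro poly_vec.dim_eq_card) (simp_all add: poly_vec.span_span poly_vec.dependent_single)
  then show ?thesis
    by (simp add: weakly_normal_def sol poly_vec.subspace_span)
qed

text \<open>The division by \<open>\<rho> h ^ lam h\<close> cancels the numerator of (rho_h / (rho_h
  + z))^(n_h), which leaves the factors of 1 / D; for \<open>lam h = 0\<close> the averaging
  operator is the identity.\<close>

lemma rate_integrals:
  assumes "set hs \<subseteq> {1..r}" "smooth_tame f"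
  shows "smooth_tame (foldr (\<lambda>h f t. gamma_op (\<rho> h) (real (lam h)) f t / \<rho> h ^ lam h) hs f) \<and>
    (\<forall>z\<in>S. bilateral (foldr (\<lambda>h f t. gamma_op (\<rho> h) (real (lam h)) f t / \<rho> h ^ lam h) hs f) z
       = (\<Prod>h\<leftarrow>hs. 1 / (\<rho> h + z) ^ lam h) * bilateral f z)"
  using assms(1)
proof (induction hs)
  case (Cons h hs)
  let ?g = "foldr (\<lambda>h f t. gamma_op (\<rho> h) (real (lam h)) f t / \<rho> h ^ lam h) hs f"
  interpret h: half_line_rate S "\<rho> h" "real (lam h)"
    using Cons.prems by (intro rate_locale) auto
  have h: "h \<in> {1..r}" using Cons.prems by simp
  have g: "smooth_tame ?g" "\<And>z. z \<in> S \<Longrightarrow> bilateral ?g z = (\<Prod>h\<leftarrow>hs. 1 / (\<rho> h + z) ^ lam h) * bilateral f z"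
    using Cons by auto
  have eq: "foldr (\<lambda>h f t. gamma_op (\<rho> h) (real (lam h)) f t / \<rho> h ^ lam h) (h # hs) f
      = (\<lambda>t. 1 / \<rho> h ^ lam h * gamma_op (\<rho> h) (real (lam h)) ?g t)"
    by simp
  show ?case
    unfolding eq
  proof (intro conjI ballI)
    show "smooth_tame (\<lambda>t. 1 / \<rho> h ^ lam h * gamma_op (\<rho> h) (real (lam h)) ?g t)"
      by (intro smooth_tame_cmult h.smooth_tame_gamma_op g)
    fix z assume z: "z \<in> S"
    have "(\<rho> h / (\<rho> h + z)) powr real (lam h) = \<rho> h ^ lam h / (\<rho> h + z) ^ lam h"
      using rho_pos[OF h] S_pos[OF z h] by (simp add: powr_realpow power_divide)
    then show "bilateral (\<lambda>t. 1 / \<rho> h ^ lam h * gamma_op (\<rho> h) (real (lam h)) ?g t) z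
        = (\<Prod>h\<leftarrow>h # hs. 1 / (\<rho> h + z) ^ lam h) * bilateral f z"
      unfolding bilateral_cmult h.bilateral_gamma_op[OF smooth_tame_imp_tame[OF g(1)] z] g(2)[OF z]
      using rho_pos[OF h] by simp
  qed
qed (use assms in simp)

lemma shifted_deriv:
  assumes "smooth_tame f"
  shows "smooth_tame (\<lambda>t. x * f t + deriv f t)"
    and "z \<in> S \<Longrightarrow> bilateral (\<lambda>t. x * f t + deriv f t) z = (x - z) * bilateral f z"
proof -
  show "smooth_tame (\<lambda>t. x * f t + deriv f t)"
    by (intro smooth_tame_add smooth_tame_cmult smooth_tame_deriv assms)
  assume z: "z \<in> S"
  have "bilateral (\<lambda>t. x * f t + deriv f t) z = x * bilateral f z + - z * bilateral f z"
    using assms z by (simp only: bilateral_add bilateral_cmult bilateral_deriv tame_cmult smooth_tame_imp_tame smooth_tame_deriv)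
  then show "bilateral (\<lambda>t. x * f t + deriv f t) z = (x - z) * bilateral f z"
    by (simp add: algebra_simps)
qed

lemma shifted_deriv_power:
  assumes "smooth_tame f"
  shows "smooth_tame (((\<lambda>f t. x * f t + deriv f t) ^^ n) f) \<and>
    (\<forall>z\<in>S. bilateral (((\<lambda>f t. x * f t + deriv f t) ^^ n) f) z = (x - z) ^ n * bilateral f z)"
  by (induction n) (use assms shifted_deriv in auto)

lemma shifted_derivs:
  assumes "smooth_tame f"
  shows "smooth_tame (foldr (\<lambda>i. (\<lambda>f t. \<xi> i * f t + deriv f t) ^^ m i) is f) \<and>
    (\<forall>z\<in>S. bilateral (foldr (\<lambda>i. (\<lambda>f t. \<xi> i * f t + deriv f t) ^^ m i) is f) z
       = (\<Prod>i\<leftarrow>is. (\<xi> i - z) ^ m i) * bilateral f z)"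
  by (induction "is") (use assms shifted_deriv_power in auto)

text \<open>Each xi_i + d/dt becomes the factor xi_i - z, so the polynomial is
  \<open>root_poly m\<close> up to sign.\<close>

lemma rodrigues_transform:
  shows "tame (rodrigues r \<rho> d a lam p \<xi> m)"
    and "z \<in> S \<Longrightarrow> bilateral (rodrigues r \<rho> d a lam p \<xi> m) z
      = weight z * poly (\<Prod>i\<in>{1..p}. [:\<xi> i, - 1:] ^ m i) z"
proof -
  let ?f = "foldr (\<lambda>h f t. gamma_op (\<rho> h) (real (lam h)) f t / \<rho> h ^ lam h) [1..<r + 1] F"
  have sub: "set [1..<r + 1] \<subseteq> {1..r}" by auto
  have f: "smooth_tame ?f" "\<And>z. z \<in> S \<Longrightarrow> bilateral ?f z = (\<Prod>h\<leftarrow>[1..<r + 1]. 1 / (\<rho> h + z) ^ lam h) * L z"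
    using rate_integrals[OF sub smooth_tame_F] unfolding hermite_L_def by blast+
  have R: "smooth_tame (rodrigues r \<rho> d a lam p \<xi> m)"
    "\<And>z. z \<in> S \<Longrightarrow> bilateral (rodrigues r \<rho> d a lam p \<xi> m) z = (\<Prod>i\<leftarrow>[1..<p + 1]. (\<xi> i - z) ^ m i) * bilateral ?f z"
    using shifted_derivs[OF f(1), of m "[1..<p + 1]"] unfolding rodrigues_def by blast+
  show "tame (rodrigues r \<rho> d a lam p \<xi> m)" using R(1) by (rule smooth_tame_imp_tame)
  assume z: "z \<in> S"
  have "(\<Prod>i\<leftarrow>[1..<p + 1]. (\<xi> i - z) ^ m i) = poly (\<Prod>i\<in>{1..p}. [:\<xi> i, - 1:] ^ m i) z"
    by (subst prod.distinct_set_conv_list[symmetric]) (auto simp: poly_prod intro!: prod.cong)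
  moreover have "(\<Prod>h\<leftarrow>[1..<r + 1]. 1 / (\<rho> h + z) ^ lam h) = 1 / rate_poly r \<rho> lam z"
    unfolding prod_list_upt by (simp add: rate_poly_def prod_dividef)
  ultimately show "bilateral (rodrigues r \<rho> d a lam p \<xi> m) z
      = weight z * poly (\<Prod>i\<in>{1..p}. [:\<xi> i, - 1:] ^ m i) z"
    unfolding R(2)[OF z] f(2)[OF z] weight_def by simp
qed

text \<open>Existence: some admissible vector has the transform of the Rodrigues function, and both
  sides are tame, so equal transforms make them equal at every point. Uniqueness: the difference of
  two such vectors corresponds to the polynomial 0.\<close>

lemma rodrigues_decomposition:
  assumes N: "N = index_weight p m + 1"
  shows "\<exists>!B. B \<in> admissible_vecs (r + 1) lam \<and> (\<forall>t. rodrigues r \<rho> d a lam p \<xi> m t = form B t)"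
proof -
  let ?A = "\<Prod>i\<in>{1..p}. [:\<xi> i, - 1:] ^ m i"
  have deg: "Polynomial.degree ?A \<le> N - 1"
    using N by (subst degree_prod_sum_eq) (auto simp: degree_power_eq index_weight_def)
  show ?thesis
  proof (rule ex_ex1I)
    obtain B where B: "B \<in> admissible_vecs (r + 1) lam" "transforms_to B ?A"
      using transforms_to_surj[OF deg] .
    have "rodrigues r \<rho> d a lam p \<xi> m t = form B t" for t
      by (rule bilateral_inject[OF rodrigues_transform(1) tame_form])
        (use B(2) rodrigues_transform(2) in \<open>simp add: transforms_to_def\<close>)
    then show "\<exists>B. B \<in> admissible_vecs (r + 1) lam \<and> (\<forall>t. rodrigues r \<rho> d a lam p \<xi> m t = form B t)"
      using B(1) by blast
  next
    fix B B'
    assume B: "B \<in> admissible_vecs (r + 1) lam \<and> (\<forall>t. rodrigues r \<rho> d a lam p \<xi> m t = form B t)"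
      and B': "B' \<in> admissible_vecs (r + 1) lam \<and> (\<forall>t. rodrigues r \<rho> d a lam p \<xi> m t = form B' t)"
    have tr: "transforms_to B'' ?A" if "\<forall>t. rodrigues r \<rho> d a lam p \<xi> m t = form B'' t" for B''
    proof -
      have "form B'' = rodrigues r \<rho> d a lam p \<xi> m" using that by (simp add: fun_eq_iff)
      then show ?thesis using deg rodrigues_transform(2) by (simp add: transforms_to_def)
    qed
    have "transforms_to (\<lambda>j. B j - Polynomial.smult 1 (B' j)) (?A - Polynomial.smult 1 ?A)"
      using B B' by (intro transforms_to_diff tr) auto
    then have "transforms_to (\<lambda>j. B j - Polynomial.smult 1 (B' j)) 0" by simp
    then have "(\<lambda>j. B j - Polynomial.smult 1 (B' j)) = (\<lambda>j. 0)"
      using B B' by (intro transforms_to_0_imp_0 admissible_diff) auto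
    then show "B = B'" by (simp add: fun_eq_iff)
  qed
qed

end

theorem proposition5p13:
  fixes r p :: nat
    and \<rho> d \<xi> :: "nat \<Rightarrow> real"
    and a :: real
    and lam :: "nat \<Rightarrow> nat"
  assumes "1 \<le> p"
    and "\<forall>h\<in>{1..r}. 0 < \<rho> h"
    and "\<forall>h\<in>{1..r}. 0 \<le> d h"
    and "inj_on \<xi> {1..p}"
    and "\<forall>i\<in>{1..p}. \<forall>h\<in>{1..r}. 0 < \<xi> i + \<rho> h"
    and "\<forall>j\<in>{1..r + 1}. \<forall>j'\<in>{1..r + 1}. lam j \<le> lam j' + 1"
    and "1 \<le> index_weight (r + 1) lam"
    and "inj_on \<rho> {h \<in> {1..r}. 0 < lam h}"
  shows "connection_det r \<rho> d a lam =
           1 / 2 ^ (lam (r + 1) choose 2)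
           * (\<Prod>h\<in>{1..r}. \<rho> h ^ lam h * (\<Prod>k\<in>{0..<lam h}. pochhammer (d h + 1) k))
           * (\<Prod>h\<in>{1..r}. \<Prod>j\<in>{1..<h}. (\<rho> h - \<rho> j) ^ (lam j * lam h))
       \<and> connection_det r \<rho> d a lam \<noteq> 0
       \<and> (\<forall>m :: nat \<Rightarrow> nat. index_weight (r + 1) lam = index_weight p m + 1 \<longrightarrow>
            (\<forall>i0\<in>{1..p}. invertible_mat (adjacent_moment_matrix r \<rho> d a lam p \<xi> m i0))
          \<and> weakly_normal r \<rho> d a lam p \<xi> m
          \<and> (\<exists>!B. B \<in> admissible_vecs (r + 1) lam \<and>
                 (\<forall>t. rodrigues r \<rho> d a lam p \<xi> m t = linear_form r \<rho> d a B t)))"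
proof -
  \<comment> \<open>Interpreted separately to make \<open>S\<close> available, in terms of which the
    node hypothesis of the next locale is stated.\<close>
  interpret set: hermite_setting r \<rho> d a
    by unfold_locales (use assms in auto)
  interpret hermite_nodes r \<rho> d a lam p \<xi>
    by unfold_locales (use assms in \<open>auto simp: set.S_def add.commute\<close>)
  show ?thesis
    using connection_det_formula connection_det_nonzero invertible_moment_matrix
      weakly_normal_nodes rodrigues_decomposition by blast
qed

end
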